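(* Let $\Delta>0$ and $\varepsilon\in\mathbb{R}$, and put $N=\lfloor \Delta+|\varepsilon|+1\rfloor$. For $g>0$ let $\tau=g^2+N$. Then for every $s\in\mathbb{C}$ with $\operatorname{Re}(s)>1$, \[ \lim_{g\to\infty}\zeta_{\varepsilon}(s;g^2+N)=\zeta(s,N+\varepsilon)+\zeta(s,N-\varepsilon). \] In particular, if $\varepsilon=0$ and $0<\Delta<1$ (so that $N=1$), then $\lim_{g\to\infty}\zeta_{0}(s;g^2+1)=2\zeta(s)$, where $\zeta(s)$ is the Riemann zeta function.
   Context: The asymmetric quantum Rabi model (AQRM) is the self-adjoint operator on $L^2(\mathbb{R})\otimes\mathbb{C}^2$ \[ H_\varepsilon=a^\dagger a+\Delta\sigma_z+g(a+a^\dagger)\sigma_x+\varepsilon\sigma_x, \] where $a=\tfrac{1}{\sqrt2}(x+\tfrac{d}{dx})$ and $a^\dagger=\tfrac{1}{\sqrt2}(x-\tfrac{d}{dx})$, so that $[a,a^\dagger]=1$. The Pauli matrices are $\sigma_x=\begin{pmatrix}0&1\\1&0\end{pmatrix}$ and $\sigma_z=\begin{pmatrix}1&0\\0&-1\end{pmatrix}$. The parameters satisfy $g>0$, $\Delta>0$ and $\varepsilon\in\mathbb{R}$; the case $\varepsilon=0$ is the quantum Rabi model. The spectrum of $H_\varepsilon$ is discrete and bounded below. Each eigenvalue has multiplicity at most 2. Let $\lambda_1^{(\varepsilon)}\le\lambda_2^{(\varepsilon)}\le\cdots$ be its eigenvalues, repeated according to multiplicity. The spectral zeta function is \[ \zeta_\varepsilon(s;\tau)=\sum_{j\ge1}\big(\lambda_j^{(\varepsilon)}+\tau\big)^{-s}.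 \] With $\tau=g^2+N$ one has $\lambda_j^{(\varepsilon)}+\tau>0$ for all $j$, and the series converges absolutely for $\operatorname{Re}(s)>1$. The Hurwitz zeta function is $\zeta(s,a)=\sum_{n\ge0}(n+a)^{-s}$ for $a>0$ and $\operatorname{Re}(s)>1$. *)

theory Defs
  imports "HOL-Analysis.Analysis"
begin

text \<open>
  The AQRM Hamiltonian
    H = a^+ a + Delta sigma_z + g (a + a^+) sigma_x + eps sigma_x
  with a = (x + d/dx)/sqrt 2, a^+ = (x - d/dx)/sqrt 2 acts on psi = (psi1, psi2) as
    (H psi)_1 = -psi1''/2 + ((x^2 - 1)/2 + Delta) psi1 + (sqrt 2 g x + eps) psi2
    (H psi)_2 = -psi2''/2 + ((x^2 - 1)/2 - Delta) psi2 + (sqrt 2 g x + eps) psi1.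
  A solution of the eigenvalue equation H psi = lambda psi in the domain of the
  (self-adjoint, limit-point) operator is a pair of twice differentiable
  square-integrable functions satisfying the ODE system pointwise.
\<close>

definition aqrm_solution ::
  "real \<Rightarrow> real \<Rightarrow> real \<Rightarrow> real \<Rightarrow> (real \<Rightarrow> complex) \<Rightarrow> (real \<Rightarrow> complex) \<Rightarrow> bool" where
  "aqrm_solution \<Delta> g \<epsilon> E \<psi>1 \<psi>2 \<longleftrightarrow>
     (\<exists>\<psi>1' \<psi>1'' \<psi>2' \<psi>2''.
        (\<forall>x. (\<psi>1 has_vector_derivative \<psi>1' x) (at x) \<and> (\<psi>1' has_vector_derivative \<psi>1'' x) (at x) \<and>
             (\<psi>2 has_vector_derivative \<psi>2' x) (at x) \<and> (\<psi>2' has_vector_derivative \<psi>2'' x) (at x) \<and>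
             - \<psi>1'' x / 2 + complex_of_real ((x\<^sup>2 - 1) / 2 + \<Delta>) * \<psi>1 x
               + complex_of_real (sqrt 2 * g * x + \<epsilon>) * \<psi>2 x = complex_of_real E * \<psi>1 x \<and>
             - \<psi>2'' x / 2 + complex_of_real ((x\<^sup>2 - 1) / 2 - \<Delta>) * \<psi>2 x
               + complex_of_real (sqrt 2 * g * x + \<epsilon>) * \<psi>1 x = complex_of_real E * \<psi>2 x))
     \<and> (\<lambda>x. (cmod (\<psi>1 x))\<^sup>2) integrable_on UNIV
     \<and> (\<lambda>x. (cmod (\<psi>2 x))\<^sup>2) integrable_on UNIV"

definition aqrm_mult :: "real \<Rightarrow> real \<Rightarrow> real \<Rightarrow> real \<Rightarrow> nat" where
  "aqrm_mult \<Delta> g \<epsilon> E = Sup {n. \<exists>\<Phi>1 \<Phi>2 :: nat \<Rightarrow> real \<Rightarrow> complex.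
       (\<forall>i<n. aqrm_solution \<Delta> g \<epsilon> E (\<Phi>1 i) (\<Phi>2 i)) \<and>
       (\<forall>c :: nat \<Rightarrow> complex.
          (\<forall>x. (\<Sum>i<n. c i * \<Phi>1 i x) = 0 \<and> (\<Sum>i<n. c i * \<Phi>2 i x) = 0)
          \<longrightarrow> (\<forall>i<n. c i = 0))}"

definition aqrm_zeta :: "real \<Rightarrow> real \<Rightarrow> real \<Rightarrow> complex \<Rightarrow> real \<Rightarrow> complex" where
  "aqrm_zeta \<Delta> g \<epsilon> s \<tau> =
     infsum (\<lambda>E. of_nat (aqrm_mult \<Delta> g \<epsilon> E) * complex_of_real (E + \<tau>) powr (- s))
            {E. aqrm_mult \<Delta> g \<epsilon> E > 0}"

definition hurwitz_zeta :: "complex \<Rightarrow> real \<Rightarrow> complex" where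
  "hurwitz_zeta s a = (\<Sum>n. complex_of_real (real n + a) powr (- s))"

definition riemann_zeta :: "complex \<Rightarrow> complex" where
  "riemann_zeta s = (\<Sum>n. complex_of_real (real n + 1) powr (- s))"

end

theory Submission
  imports Defs "HOL-Probability.Probability" "HOL-Real_Asymp.Real_Asymp"
begin

text \<open>
  In the sum and difference of the two components the equation decouples, up to the bounded
  coupling $\Delta$, into two oscillators centred at $\mp\sqrt 2 g$, with energies
  $n + N \pm \varepsilon$ once $g^2 + N$ is added.  Expanding in the Hermite functions of these two
  wells turns the problem into $D + B$ on $\ell^2$, where $D$ is diagonal and independent of $g$ and
  $B$ is the matrix of overlaps between the wells, with $\|B\| \le \Delta$ below the bottom of $D$.
  Minimising the form of $D + B$ on successive orthogonal complements gives a complete orthonormal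
  sequence of eigenvectors, and comparison of test spaces in both directions bounds the distance of
  the $k$-th eigenvalues of $D + B$ and $D$ by the size of the form of $B$ on vectors of bounded
  $D$-energy.  Such vectors are concentrated on finitely many basis vectors, whose overlaps vanish
  as $g \to \infty$.  The bound by $\Delta$ dominates the zeta series uniformly in $g$, so the limit
  may be taken term by term.
\<close>

section \<open>Square-summable sequences\<close>

text \<open>The definitions know only pointwise square-integrable solutions of the differential
  equation, while the variational argument lives in a sequence space. Between them stands a
  dictionary that must be exact in both directions, multiplicities included: an eigenvector of D + B
  must synthesise to twice differentiable functions, and a solution of unknown behaviour at infinity
  must have coefficients in the domain of D. The common ground is growth that is at most
  exponential: the equation and square integrability force it, and it suffices for pairing with
  Hermite functions and integrating by parts. Real sequences are enough because the equation has
  real coefficients. Completing the square, x^2/2 +- sqrt 2 g x = (x +- sqrt 2 g)^2/2 - g^2,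
  accounts for the shift by g^2. The choice of N gives N - |eps| > Delta, so each diagonal entry
  exceeds Delta and the entries of D lowered by Delta stay positive; they bound the eigenvalues from
  below and yield a summable majorant free of g. Convergence of eigenvalues is established one index
  at a time, without uniformity in the index, which is why the majorant is needed.\<close>

typedef l2 = "{x :: nat \<Rightarrow> real. summable (\<lambda>i. (x i)\<^sup>2)}"
  morphisms crd Abs_l2
  by (rule exI[of _ "\<lambda>_. 0"]) simp

lemma summable_crd_sq: "summable (\<lambda>i. (crd x i)\<^sup>2)"
  using crd[of x] by simp

lemma l2_eqI: "(\<And>i. crd x i = crd y i) \<Longrightarrow> x = y"
  by (metis crd_inject ext)

lemma summable_mult_of_sq:
  fixes f g :: "nat \<Rightarrow> real"
  assumes "summable (\<lambda>i. (f i)\<^sup>2)" "summable (\<lambda>i. (g i)\<^sup>2)"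
  shows "summable (\<lambda>i. \<bar>f i * g i\<bar>)" "summable (\<lambda>i. f i * g i)"
proof -
  have "norm \<bar>f i * g i\<bar> \<le> (f i)\<^sup>2 + (g i)\<^sup>2" for i
  proof -
    have "0 \<le> (\<bar>f i\<bar> - \<bar>g i\<bar>)\<^sup>2" by simp
    then have "2 * (\<bar>f i\<bar> * \<bar>g i\<bar>) \<le> (f i)\<^sup>2 + (g i)\<^sup>2"
      by (simp add: power2_diff)
    then show ?thesis
      using mult_nonneg_nonneg[of "\<bar>f i\<bar>" "\<bar>g i\<bar>"] unfolding real_norm_def abs_abs abs_mult by linarith
  qed
  then show "summable (\<lambda>i. \<bar>f i * g i\<bar>)"
    by (intro summable_comparison_test'[OF summable_add[OF assms], of 0]) auto
  then show "summable (\<lambda>i. f i * g i)"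
    by (rule summable_rabs_cancel)
qed

lemma summable_add_sq:
  fixes f g :: "nat \<Rightarrow> real"
  assumes "summable (\<lambda>i. (f i)\<^sup>2)" "summable (\<lambda>i. (g i)\<^sup>2)"
  shows "summable (\<lambda>i. (f i + g i)\<^sup>2)"
proof -
  have "summable (\<lambda>i. (f i)\<^sup>2 + (g i)\<^sup>2 + 2 * (f i * g i))"
    by (intro summable_add summable_mult summable_mult_of_sq assms)
  then show ?thesis by (simp add: power2_sum mult.assoc)
qed

instantiation l2 :: real_inner
begin

definition "0 = Abs_l2 (\<lambda>_. 0)"
definition "x + y = Abs_l2 (\<lambda>i. crd x i + crd y i)"
definition "- x = Abs_l2 (\<lambda>i. - crd x i)"
definition "x - y = Abs_l2 (\<lambda>i. crd x i - crd y i)"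
definition "r *\<^sub>R x = Abs_l2 (\<lambda>i. r * crd x i)"
definition "x \<bullet> y = (\<Sum>i. crd x i * crd y i)"
definition norm_l2_def: "norm (x::l2) = sqrt (x \<bullet> x)"
definition sgn_l2_def: "sgn (x::l2) = inverse (norm x) *\<^sub>R x"
definition dist_l2_def: "dist (x::l2) y = norm (x - y)"
definition "uniformity = (INF e\<in>{0 <..}. principal {(x::l2, y). dist x y < e})"
definition "open (U :: l2 set) \<longleftrightarrow> (\<forall>x\<in>U. eventually (\<lambda>(x', y). x' = x \<longrightarrow> y \<in> U) uniformity)"

lemma crd_zero: "crd 0 i = 0"
  by (simp add: zero_l2_def Abs_l2_inverse)
lemma crd_add: "crd (x + y) i = crd x i + crd y i"
  by (simp add: plus_l2_def Abs_l2_inverse summable_add_sq summable_crd_sq)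
lemma crd_uminus: "crd (- x) i = - crd x i"
  by (simp add: uminus_l2_def Abs_l2_inverse summable_crd_sq)
lemma crd_diff: "crd (x - y) i = crd x i - crd y i"
proof -
  have "summable (\<lambda>i. (crd x i + crd (- y) i)\<^sup>2)"
    by (intro summable_add_sq summable_crd_sq)
  then show ?thesis by (simp add: minus_l2_def crd_uminus Abs_l2_inverse)
qed
lemma crd_scaleR: "crd (r *\<^sub>R x) i = r * crd x i"
  by (simp add: scaleR_l2_def Abs_l2_inverse power_mult_distrib summable_mult summable_crd_sq)

lemmas crd_simps [simp] = crd_zero crd_add crd_uminus crd_diff crd_scaleR

lemma inner_l2_sums: "(\<lambda>i. crd x i * crd y i) sums (x \<bullet> y)"
  unfolding inner_l2_def by (intro summable_sums summable_mult_of_sq summable_crd_sq)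

instance
proof
  fix x y z :: l2 and r s :: real
  show "x + y + z = x + (y + z)" "x + y = y + x" "0 + x = x" "- x + x = 0" "x - y = x + - y"
    "r *\<^sub>R (x + y) = r *\<^sub>R x + r *\<^sub>R y" "(r + s) *\<^sub>R x = r *\<^sub>R x + s *\<^sub>R x"
    "r *\<^sub>R s *\<^sub>R x = (r * s) *\<^sub>R x" "1 *\<^sub>R x = x"
    by (auto intro!: l2_eqI simp: crd_simps algebra_simps)
  show "dist x y = norm (x - y)" "sgn x = inverse (norm x) *\<^sub>R x" "norm x = sqrt (x \<bullet> x)"
    by (simp_all add: dist_l2_def sgn_l2_def norm_l2_def)
  show "uniformity = (INF e\<in>{0 <..}. principal {(x::l2, y). dist x y < e})"
    by (fact uniformity_l2_def)
  show "open U \<longleftrightarrow> (\<forall>x\<in>U. eventually (\<lambda>(x', y). x' = x \<longrightarrow> y \<in> U) uniformity)" for U :: "l2 set"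
    by (fact open_l2_def)
  show "x \<bullet> y = y \<bullet> x" by (simp add: inner_l2_def mult.commute)
  have "(\<lambda>i. crd x i * crd z i + crd y i * crd z i) sums (x \<bullet> z + y \<bullet> z)"
    by (intro sums_add inner_l2_sums)
  then show "(x + y) \<bullet> z = x \<bullet> z + y \<bullet> z"
    using inner_l2_sums[of "x + y" z] by (simp add: crd_simps algebra_simps sums_unique2)
  have "(\<lambda>i. r * (crd x i * crd y i)) sums (r * (x \<bullet> y))"
    by (intro sums_mult inner_l2_sums)
  then show "r *\<^sub>R x \<bullet> y = r * (x \<bullet> y)"
    using inner_l2_sums[of "r *\<^sub>R x" y] by (simp add: crd_simps algebra_simps sums_unique2)
  have s: "summable (\<lambda>i. crd x i * crd x i)"
    using inner_l2_sums sums_summable by blast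
  show "0 \<le> x \<bullet> x" unfolding inner_l2_def using s by (intro suminf_nonneg) auto
  show "x \<bullet> x = 0 \<longleftrightarrow> x = 0"
    unfolding inner_l2_def using suminf_eq_zero_iff[OF s]
    by (auto intro!: l2_eqI simp: crd_simps)
qed

end

lemma norm_l2_sums: "(\<lambda>i. (crd x i)\<^sup>2) sums (norm x)\<^sup>2"
  using inner_l2_sums[of x x] by (simp add: power2_eq_square power2_norm_eq_inner[symmetric])

lemma crd_sum [simp]: "crd (\<Sum>k\<in>A. f k) i = (\<Sum>k\<in>A. crd (f k) i)"
  by (induction A rule: infinite_finite_induct) auto

definition ket :: "nat \<Rightarrow> l2" where
  "ket n = Abs_l2 (\<lambda>i. if i = n then 1 else 0)"

lemma crd_ket: "crd (ket n) i = (if i = n then 1 else 0)"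
proof -
  have "(\<lambda>i. (if i = n then (1::real) else 0)\<^sup>2) = (\<lambda>i. if i = n then 1 else 0)" by auto
  then have "summable (\<lambda>i. (if i = n then (1::real) else 0)\<^sup>2)"
    using sums_single[of n "\<lambda>_. 1::real"] sums_summable by metis
  then show ?thesis by (simp add: ket_def Abs_l2_inverse)
qed

lemma inner_ket [simp]: "x \<bullet> ket n = crd x n"
proof -
  have "(\<lambda>i. crd x i * crd (ket n) i) = (\<lambda>i. if i = n then crd x i else 0)"
    by (auto simp: crd_ket)
  then show ?thesis
    using inner_l2_sums[of x "ket n"] sums_single[of n "crd x"] by (simp add: sums_unique2)
qed

lemma inner_ket' [simp]: "ket n \<bullet> x = crd x n"
  by (simp add: inner_commute)

lemma abs_crd_le: "\<bar>crd x i\<bar> \<le> norm x"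
proof -
  have "(crd x i)\<^sup>2 \<le> (norm x)\<^sup>2"
    using sum_le_suminf[OF summable_crd_sq, of "{i}" x] norm_l2_sums[of x]
    by (simp add: sums_iff)
  then show ?thesis using abs_le_square_iff[of "crd x i" "norm x"] by simp
qed

lemma tendsto_crd: "(X \<longlongrightarrow> x) F \<Longrightarrow> ((\<lambda>k. crd (X k) i) \<longlongrightarrow> crd x i) F"
  using tendsto_inner[OF _ tendsto_const[of "ket i"], of X x F] by simp

definition trunc :: "nat \<Rightarrow> l2 \<Rightarrow> l2" where
  "trunc M x = (\<Sum>i<M. crd x i *\<^sub>R ket i)"

lemma crd_trunc: "crd (trunc M x) i = (if i < M then crd x i else 0)"
  by (simp add: trunc_def crd_ket if_distrib[of "(*) _"] cong: if_cong)

lemma trunc_tendsto: "(\<lambda>M. trunc M x) \<longlonglongrightarrow> x"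
proof -
  have "(norm (x - trunc M x))\<^sup>2 = (norm x)\<^sup>2 - (\<Sum>i<M. (crd x i)\<^sup>2)" for M
  proof -
    have "(\<lambda>i. (crd x i)\<^sup>2 - (if i \<in> {..<M} then (crd x i)\<^sup>2 else 0)) sums ((norm x)\<^sup>2 - (\<Sum>i<M. (crd x i)\<^sup>2))"
      by (intro sums_diff norm_l2_sums sums_If_finite_set) simp
    also have "(\<lambda>i. (crd x i)\<^sup>2 - (if i \<in> {..<M} then (crd x i)\<^sup>2 else 0)) = (\<lambda>i. (crd (x - trunc M x) i)\<^sup>2)"
      by (auto simp: crd_trunc)
    finally show ?thesis using norm_l2_sums[of "x - trunc M x"] by (simp add: sums_unique2)
  qed
  moreover have "(\<lambda>M. (norm x)\<^sup>2 - (\<Sum>i<M. (crd x i)\<^sup>2)) \<longlonglongrightarrow> (norm x)\<^sup>2 - (norm x)\<^sup>2"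
    using norm_l2_sums[of x] unfolding sums_def by (intro tendsto_diff tendsto_const)
  ultimately have "(\<lambda>M. (norm (x - trunc M x))\<^sup>2) \<longlonglongrightarrow> 0" by simp
  from tendsto_real_sqrt[OF this] have "(\<lambda>M. norm (trunc M x - x)) \<longlonglongrightarrow> 0"
    by (simp add: norm_minus_commute)
  then show ?thesis by (simp add: tendsto_norm_zero_iff LIM_zero_cancel)
qed

lemma norm_trunc_le: "norm (trunc M x) \<le> norm x"
proof -
  have "(norm (trunc M x))\<^sup>2 \<le> (norm x)\<^sup>2"
    by (rule sums_le[OF _ norm_l2_sums norm_l2_sums]) (auto simp: crd_trunc)
  then show ?thesis by (rule power2_le_imp_le) simp
qed

text \<open>Chebyshev's inequality for the weights \<open>\<mu>\<close>: mass beyond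
  \<open>M\<close> costs at least \<open>K\<close> per unit of squared norm.\<close>

lemma form_tail_le:
  fixes \<mu> :: "nat \<Rightarrow> real"
  assumes s: "(\<lambda>i. \<mu> i * (crd x i)\<^sup>2) sums A" and nn: "\<And>i. 0 \<le> \<mu> i"
    and big: "\<And>i. i \<ge> M \<Longrightarrow> K \<le> \<mu> i" and K: "K > 0"
  shows "(norm (x - trunc M x))\<^sup>2 \<le> A / K"
proof -
  have "K * (norm (x - trunc M x))\<^sup>2 \<le> A"
  proof (rule sums_le[OF _ sums_mult[OF norm_l2_sums] s])
    show "K * (crd (x - trunc M x) i)\<^sup>2 \<le> \<mu> i * (crd x i)\<^sup>2" for i
      using nn[of i] big[of i] by (auto simp: crd_trunc intro: mult_right_mono)
  qed
  then show ?thesis using K by (simp add: field_simps)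
qed

text \<open>Rellich's argument. Bounded coordinates lie in a compact cube, so a subsequence
  converges coordinatewise; bounded weighted sums with \<open>\<mu>\<close> tending to infinity make
  the tails uniformly small, which upgrades this to convergence in norm.\<close>

lemma l2_compactness:
  fixes \<mu> :: "nat \<Rightarrow> real" and X :: "nat \<Rightarrow> l2"
  assumes nn: "\<And>i. 0 \<le> \<mu> i" and lim: "filterlim \<mu> at_top sequentially"
    and nb: "\<And>k. norm (X k) \<le> R"
    and A: "\<And>k. (\<lambda>i. \<mu> i * (crd (X k) i)\<^sup>2) sums A k" "\<And>k. A k \<le> C"
  obtains x r where "strict_mono (r::nat\<Rightarrow>nat)" "(X \<circ> r) \<longlonglongrightarrow> x"
proof -
  define S where "S = (\<Pi>\<^sub>E i\<in>(UNIV::nat set). {-R..R})"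
  have "compactin (product_topology (\<lambda>i. euclidean) UNIV) S"
    unfolding S_def by (simp add: compactin_PiE)
  then have "seq_compact S"
    by (simp add: euclidean_product_topology compact_imp_seq_compact)
  moreover have "crd (X k) \<in> S" for k
    unfolding S_def
  proof (rule PiE_I)
    show "crd (X k) i \<in> {-R..R}" for i
      using abs_crd_le[of "X k" i] nb[of k] by auto
  qed auto
  ultimately obtain y r where r: "strict_mono (r::nat\<Rightarrow>nat)" "((\<lambda>k. crd (X k)) \<circ> r) \<longlonglongrightarrow> y"
    unfolding seq_compact_def by meson
  have lim_y: "(\<lambda>k. crd (X (r k)) i) \<longlonglongrightarrow> y i" for i
  proof -
    have "continuous_on UNIV (\<lambda>f::nat\<Rightarrow>real. f i)" by (intro continuous_on_product_coordinates)
    then show ?thesis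
      using continuous_on_tendsto_compose[of UNIV "\<lambda>f. f i", OF _ r(2)] by (simp add: o_def)
  qed
  have sy: "summable (\<lambda>i. (y i)\<^sup>2)"
  proof (rule bounded_imp_summable)
    show "(\<Sum>i\<le>n. (y i)\<^sup>2) \<le> R\<^sup>2" for n
    proof (rule tendsto_upperbound[OF _ always_eventually])
      show "(\<lambda>k. \<Sum>i\<le>n. (crd (X (r k)) i)\<^sup>2) \<longlonglongrightarrow> (\<Sum>i\<le>n. (y i)\<^sup>2)"
        by (intro tendsto_intros lim_y)
      show "\<forall>k. (\<Sum>i\<le>n. (crd (X (r k)) i)\<^sup>2) \<le> R\<^sup>2"
      proof
        fix k
        have "(\<Sum>i\<le>n. (crd (X (r k)) i)\<^sup>2) \<le> (norm (X (r k)))\<^sup>2"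
          using sum_le_suminf[OF summable_crd_sq, of "{..n}" "X (r k)"] norm_l2_sums[of "X (r k)"]
          by (simp add: sums_iff)
        also have "\<dots> \<le> R\<^sup>2" using nb[of "r k"] by (intro power_mono) auto
        finally show "(\<Sum>i\<le>n. (crd (X (r k)) i)\<^sup>2) \<le> R\<^sup>2" .
      qed
    qed simp
  qed simp
  define x where "x = Abs_l2 y"
  have crd_x: "crd x i = y i" for i
    unfolding x_def using sy by (simp add: Abs_l2_inverse)
  have C: "0 \<le> C"
  proof -
    have "0 \<le> A 0" by (rule sums_le[OF _ sums_zero A(1)[of 0]]) (simp add: nn)
    then show ?thesis using A(2)[of 0] by linarith
  qed
  have "(X \<circ> r) \<longlonglongrightarrow> x"
  proof (rule LIMSEQ_I)
    fix e :: real assume e: "e > 0"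
    \<comment> \<open>Three errors below e / 4 will be added. This \<open>K\<close> makes the
      squared tail bound C / K smaller than (e / 4)^2; the added 1 gives strictness and keeps
      \<open>K\<close> positive when C = 0.\<close>
    define K where "K = 16 * (C + 1) / e\<^sup>2"
    have K: "K > 0" unfolding K_def using e C by simp
    obtain M1 where M1: "\<And>i. i \<ge> M1 \<Longrightarrow> K \<le> \<mu> i"
      using lim unfolding filterlim_at_top eventually_sequentially by meson
    have "eventually (\<lambda>M. norm (trunc M x - x) < e / 4) sequentially"
      using tendstoD[OF trunc_tendsto, of "e / 4" x] e by (simp add: dist_norm)
    then obtain M2 where M2: "\<And>M. M \<ge> M2 \<Longrightarrow> norm (trunc M x - x) < e / 4"
      by (auto simp: eventually_sequentially)
    define M where "M = max M1 M2"
    have tail: "norm (X k - trunc M (X k)) < e / 4" for k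
    proof -
      have "(norm (X k - trunc M (X k)))\<^sup>2 \<le> A k / K"
        using form_tail_le[OF A(1) nn _ K] M1 unfolding M_def by simp
      also have "\<dots> \<le> C / K" using A(2) K by (simp add: divide_right_mono)
      also have "\<dots> < (e / 4)\<^sup>2"
      proof -
        have "(e / 4)\<^sup>2 * K = C + 1" unfolding K_def using e by (simp add: power_divide)
        then show ?thesis using K by (simp add: pos_divide_less_eq)
      qed
      finally show ?thesis using e by (intro power2_less_imp_less[of _ "e / 4"]) auto
    qed
    have "(\<lambda>k. trunc M (X (r k))) \<longlonglongrightarrow> trunc M x"
      unfolding trunc_def crd_x by (intro tendsto_sum tendsto_scaleR tendsto_const lim_y)
    from tendstoD[OF this, of "e / 4"]
    have "eventually (\<lambda>k. norm (trunc M (X (r k)) - trunc M x) < e / 4) sequentially"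
      using e by (simp add: dist_norm)
    then have "eventually (\<lambda>k. norm ((X \<circ> r) k - x) < e) sequentially"
    proof eventually_elim
      case (elim k)
      have "(X \<circ> r) k - x = (X (r k) - trunc M (X (r k))) + (trunc M (X (r k)) - trunc M x) + (trunc M x - x)"
        by simp
      then have "norm ((X \<circ> r) k - x) \<le> norm (X (r k) - trunc M (X (r k))) + norm (trunc M (X (r k)) - trunc M x) + norm (trunc M x - x)"
        using norm_triangle_ineq[of "(X (r k) - trunc M (X (r k))) + (trunc M (X (r k)) - trunc M x)" "trunc M x - x"]
          norm_triangle_ineq[of "X (r k) - trunc M (X (r k))" "trunc M (X (r k)) - trunc M x"] by simp
      then show ?case using tail[of "r k"] elim M2[of M] e unfolding M_def by linarith
    qed
    then show "\<exists>n0. \<forall>n\<ge>n0. norm ((X \<circ> r) n - x) < e"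
      unfolding eventually_sequentially .
  qed
  then show ?thesis using that r(1) by simp
qed

text \<open>Lower semicontinuity of the form, by Fatou's argument on finite partial sums. It also
  places the limit in the form domain, which convergence in norm alone would not do.\<close>

lemma form_limit_le:
  fixes \<mu> :: "nat \<Rightarrow> real"
  assumes nn: "\<And>i. 0 \<le> \<mu> i" and X: "X \<longlonglongrightarrow> x"
    and A: "\<And>k. (\<lambda>i. \<mu> i * (crd (X k) i)\<^sup>2) sums A k" and lim: "A \<longlonglongrightarrow> a"
  obtains b where "(\<lambda>i. \<mu> i * (crd x i)\<^sup>2) sums b" "b \<le> a"
proof -
  have le: "(\<Sum>i<n. \<mu> i * (crd x i)\<^sup>2) \<le> a" for n
  proof (rule tendsto_le[OF _ lim])
    show "(\<lambda>k. \<Sum>i<n. \<mu> i * (crd (X k) i)\<^sup>2) \<longlonglongrightarrow> (\<Sum>i<n. \<mu> i * (crd x i)\<^sup>2)"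
      by (rule tendsto_sum) (rule tendsto_mult_left[OF tendsto_power[OF tendsto_crd[OF X]]])
    have "(\<Sum>i<n. \<mu> i * (crd (X k) i)\<^sup>2) \<le> A k" for k
    proof -
      have "(\<Sum>i<n. \<mu> i * (crd (X k) i)\<^sup>2) \<le> suminf (\<lambda>i. \<mu> i * (crd (X k) i)\<^sup>2)"
        using nn by (intro sum_le_suminf sums_summable[OF A[of k]]) auto
      then show ?thesis using sums_unique[OF A[of k]] by simp
    qed
    then show "\<forall>\<^sub>F k in sequentially. (\<Sum>i<n. \<mu> i * (crd (X k) i)\<^sup>2) \<le> A k" by simp
  qed simp
  then have s: "summable (\<lambda>i. \<mu> i * (crd x i)\<^sup>2)"
    using nn by (intro summableI_nonneg_bounded[OF _ le]) auto
  show ?thesis by (rule that[OF summable_sums[OF s] suminf_le_const[OF s le]])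
qed

section \<open>Successive minimisation of a perturbed diagonal form\<close>

text \<open>Gaussian elimination, by induction on the number of equations. The field is arbitrary
  because the comparison of eigenvalues needs real coefficients and the count of multiplicities
  complex ones.\<close>

lemma homogeneous_system_nontrivial:
  fixes v :: "'i \<Rightarrow> nat \<Rightarrow> 'a::field"
  assumes "finite I" "m < card I"
  shows "\<exists>c. (\<exists>i\<in>I. c i \<noteq> 0) \<and> (\<forall>k<m. (\<Sum>i\<in>I. c i * v i k) = 0)"
  using assms
proof (induction m arbitrary: I v)
  case 0
  then have "I \<noteq> {}" by auto
  then show ?case by (intro exI[of _ "\<lambda>_. 1"]) auto
next
  case (Suc m)
  show ?case
  proof (cases "\<forall>i\<in>I. v i m = 0")
    case True
    obtain c where c: "\<exists>i\<in>I. c i \<noteq> 0" "\<forall>k<m. (\<Sum>i\<in>I. c i * v i k) = 0"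
      using Suc.IH[of I v] Suc.prems by auto
    have "(\<Sum>i\<in>I. c i * v i m) = 0" using True by simp
    then have "\<forall>k<Suc m. (\<Sum>i\<in>I. c i * v i k) = 0"
      using c(2) by (auto simp: less_Suc_eq)
    then show ?thesis using c(1) by blast
  next
    case False
    then obtain p where p: "p \<in> I" "v p m \<noteq> 0" by blast
    \<comment> \<open>The last equation is solved for the unknown \<open>p\<close>; \<open>w\<close>
      is the system that remains for the other unknowns.\<close>
    define w where "w i k = v i k - v i m / v p m * v p k" for i k
    have "m < card (I - {p})" using Suc.prems p by simp
    then obtain c where c: "\<exists>i\<in>I - {p}. c i \<noteq> 0" "\<forall>k<m. (\<Sum>i\<in>I - {p}. c i * w i k) = 0"
      using Suc.IH[of "I - {p}" w] Suc.prems by auto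
    define s where "s = (\<Sum>i\<in>I - {p}. c i * v i m) / v p m"
    define d where "d = c(p := - s)"
    have split: "(\<Sum>i\<in>I. d i * v i k) = (\<Sum>i\<in>I - {p}. c i * v i k) - s * v p k" for k
      using sum.remove[OF Suc.prems(1) p(1), of "\<lambda>i. d i * v i k"] by (simp add: d_def)
    have "(\<Sum>i\<in>I. d i * v i k) = (\<Sum>i\<in>I - {p}. c i * w i k)" for k
      unfolding split w_def s_def
      by (simp add: sum_subtractf sum_distrib_right sum_divide_distrib right_diff_distrib mult.assoc)
    then have "\<forall>k<m. (\<Sum>i\<in>I. d i * v i k) = 0" using c(2) by simp
    moreover have "(\<Sum>i\<in>I. d i * v i m) = 0" unfolding split s_def using p by simp
    moreover have "\<exists>i\<in>I. d i \<noteq> 0" using c(1) by (auto simp: d_def)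
    ultimately show ?thesis by (intro exI[of _ d]) (auto simp: less_Suc_eq)
  qed
qed

text \<open>The first-order condition at a minimum: near t = 0 a nonzero linear term would outweigh
  the quadratic one for one sign of t.\<close>

lemma linear_coeff_zero_of_nonneg:
  fixes \<alpha> \<beta> :: real
  assumes "\<And>t. 0 \<le> 2 * t * \<alpha> + t\<^sup>2 * \<beta>"
  shows "\<alpha> = 0"
proof (rule ccontr)
  assume a: "\<alpha> \<noteq> 0"
  \<comment> \<open>The trial value is t = - \<alpha> / q. Since q exceeds both \<beta> and 0, the
    expression there is a negative multiple of \<alpha>^2.\<close>
  define q where "q = \<bar>\<beta>\<bar> + 1"
  have q: "q > 0" "\<beta> < q" by (auto simp: q_def)
  have "0 \<le> q\<^sup>2 * (2 * (- \<alpha> / q) * \<alpha> + (- \<alpha> / q)\<^sup>2 * \<beta>)"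
    by (intro mult_nonneg_nonneg assms) simp
  also have "\<dots> = \<alpha>\<^sup>2 * (\<beta> - 2 * q)"
    using q by (simp add: field_simps power2_eq_square)
  finally show False using a q by (simp add: zero_le_mult_iff)
qed

locale l2_perturbation =
  fixes \<mu> :: "nat \<Rightarrow> real" and B :: "l2 \<Rightarrow> l2" and \<Delta> :: real
  assumes lin: "linear B" and bdd: "norm (B x) \<le> \<Delta> * norm x" and sym: "B x \<bullet> y = x \<bullet> B y"
    and mu_gt: "\<Delta> < \<mu> i" and mu_lim: "filterlim \<mu> at_top sequentially"
begin

text \<open>
  Below, $D$ is multiplication by $\mu$.  Since $D$ is unbounded, membership in its domains is
  part of the predicates: \<open>diag_image y w\<close> says that $y$ is in the domain of $D$ and $D y = w$, and
  \<open>energy y a\<close> that $y$ is in the form domain and $\langle D y, y\rangle = a$.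
\<close>

definition energy :: "l2 \<Rightarrow> real \<Rightarrow> bool" where
  "energy x a \<longleftrightarrow> (\<lambda>i. \<mu> i * (crd x i)\<^sup>2) sums a"

definition diag_image :: "l2 \<Rightarrow> l2 \<Rightarrow> bool" where
  "diag_image y w \<longleftrightarrow> (\<forall>i. \<mu> i * crd y i = crd w i)"

definition eigenvec :: "l2 \<Rightarrow> real \<Rightarrow> bool" where
  "eigenvec x l \<longleftrightarrow> (\<forall>i. \<mu> i * crd x i + crd (B x) i = l * crd x i)"

lemma Delta_nonneg: "0 \<le> \<Delta>"
proof -
  have "norm (ket 0) = 1" by (simp add: norm_eq_sqrt_inner crd_ket)
  then show ?thesis using bdd[of "ket 0"] norm_ge_zero[of "B (ket 0)"] by (simp del: norm_ge_zero)
qed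

lemma mu_nonneg: "0 \<le> \<mu> i"
  using mu_gt[of i] Delta_nonneg by simp

lemma abs_B_le: "\<bar>B x \<bullet> x\<bar> \<le> \<Delta> * (norm x)\<^sup>2"
proof -
  have "\<bar>B x \<bullet> x\<bar> \<le> norm (B x) * norm x" by (rule Cauchy_Schwarz_ineq2)
  also have "\<dots> \<le> \<Delta> * norm x * norm x" by (intro mult_right_mono bdd) simp
  finally show ?thesis by (simp add: power2_eq_square mult.assoc)
qed

lemma bounded_linear_B: "bounded_linear B"
  using bdd by (intro bounded_linear_intro[of _ \<Delta>]) (auto simp: mult.commute linear_add[OF lin] linear_scale[OF lin])

lemmas B_add = linear_add[OF lin] and B_scaleR = linear_scale[OF lin] and B_sum = linear_sum[OF lin]
  and B_diff = linear_diff[OF lin]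

lemma eigenvec_iff_diag_image: "eigenvec x l \<longleftrightarrow> diag_image x (l *\<^sub>R x - B x)"
  by (auto simp: eigenvec_def diag_image_def algebra_simps)

lemma diag_image_scaleR: "diag_image y w \<Longrightarrow> diag_image (c *\<^sub>R y) (c *\<^sub>R w)"
  by (auto simp: diag_image_def algebra_simps)

lemma diag_image_diff: "diag_image y w \<Longrightarrow> diag_image y' w' \<Longrightarrow> diag_image (y - y') (w - w')"
  by (auto simp: diag_image_def algebra_simps)

lemma diag_image_sum: "(\<And>i. i \<in> I \<Longrightarrow> diag_image (y i) (w i)) \<Longrightarrow> diag_image (\<Sum>i\<in>I. y i) (\<Sum>i\<in>I. w i)"
  by (induction I rule: infinite_finite_induct) (auto simp: diag_image_def algebra_simps)

lemma diag_image_ket: "diag_image (ket n) (\<mu> n *\<^sub>R ket n)"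
  by (auto simp: diag_image_def crd_ket)

lemma diag_image_sums:
  assumes "diag_image y w"
  shows "(\<lambda>i. \<mu> i * (crd x i * crd y i)) sums (x \<bullet> w)"
proof -
  have "crd x i * crd w i = \<mu> i * (crd x i * crd y i)" for i
    using assms[unfolded diag_image_def, rule_format, of i] by (metis mult.left_commute)
  then show ?thesis using inner_l2_sums[of x w] by (simp only:)
qed

lemma diag_image_sym: "diag_image x v \<Longrightarrow> diag_image y w \<Longrightarrow> v \<bullet> y = x \<bullet> w"
  using diag_image_sums[of y w x] diag_image_sums[of x v y] by (simp add: mult.commute inner_commute sums_unique2)

lemma energy_diag_image: "diag_image y w \<Longrightarrow> energy y (y \<bullet> w)"
  using diag_image_sums[of y w y] by (simp add: energy_def power2_eq_square)

text \<open>Only the direction \<open>y\<close> must lie in the domain of D, since the mixed term is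
  computed from its image. A minimiser, of which no more than finite energy is known, can therefore
  be varied.\<close>

lemma energy_add:
  assumes "energy x a" "diag_image y w"
  shows "energy (x + t *\<^sub>R y) (a + 2 * t * (x \<bullet> w) + t\<^sup>2 * (y \<bullet> w))"
proof -
  have "(\<lambda>i. \<mu> i * (crd x i)\<^sup>2 + 2 * t * (\<mu> i * (crd x i * crd y i)) + t\<^sup>2 * (\<mu> i * (crd y i * crd y i)))
    sums (a + 2 * t * (x \<bullet> w) + t\<^sup>2 * (y \<bullet> w))"
    by (intro sums_add sums_mult diag_image_sums assms(1)[unfolded energy_def] assms(2))
  then show ?thesis unfolding energy_def by (simp add: power2_eq_square algebra_simps)
qed

lemma energy_scaleR: "energy x a \<Longrightarrow> energy (c *\<^sub>R x) (c\<^sup>2 * a)"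
  unfolding energy_def using sums_mult[of "\<lambda>i. \<mu> i * (crd x i)\<^sup>2" a "c\<^sup>2"]
  by (simp add: power_mult_distrib mult.left_commute)

lemma energy_ge:
  assumes "energy y b" "\<And>i. crd y i \<noteq> 0 \<Longrightarrow> m \<le> \<mu> i"
  shows "m * (norm y)\<^sup>2 \<le> b"
proof (rule sums_le[OF _ sums_mult[OF norm_l2_sums] assms(1)[unfolded energy_def]])
  show "m * (crd y i)\<^sup>2 \<le> \<mu> i * (crd y i)\<^sup>2" for i
    using assms(2)[of i] by (cases "crd y i = 0") (auto intro: mult_right_mono)
qed

lemma eigenvec_orthogonal:
  assumes "eigenvec x l" "eigenvec y m" "l \<noteq> m"
  shows "x \<bullet> y = 0"
proof -
  have "(l *\<^sub>R x - B x) \<bullet> y = x \<bullet> (m *\<^sub>R y - B y)"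
    using assms unfolding eigenvec_iff_diag_image by (intro diag_image_sym)
  then have "(l - m) * (x \<bullet> y) = 0"
    using sym[of x y] by (simp add: algebra_simps)
  then show ?thesis using assms(3) by simp
qed

text \<open>A homogeneous lower bound for the Rayleigh quotient of D + B on the complement of the
  first \<open>j\<close> vectors. It covers the whole form domain, so test vectors need no
  normalisation; attainment is recorded separately.\<close>

definition minimal :: "(nat \<Rightarrow> l2) \<Rightarrow> nat \<Rightarrow> real \<Rightarrow> bool" where
  "minimal \<psi> j l \<longleftrightarrow> (\<forall>y b. energy y b \<longrightarrow> (\<forall>i<j. y \<bullet> \<psi> i = 0) \<longrightarrow> l * (norm y)\<^sup>2 \<le> b + B y \<bullet> y)"

text \<open>The Euler-Lagrange equation, tested coordinate by coordinate. Each admissible direction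
  is a basis vector projected off the earlier eigenvectors.\<close>

lemma minimizer_eigenvec:
  assumes orth: "\<And>i k. i < j \<Longrightarrow> k < j \<Longrightarrow> \<psi> i \<bullet> \<psi> k = (if i = k then 1 else 0)"
    and eigenvec: "\<And>i. i < j \<Longrightarrow> eigenvec (\<psi> i) (eigval i)"
    and x: "norm x = 1" "\<And>i. i < j \<Longrightarrow> x \<bullet> \<psi> i = 0" "energy x a"
    and min: "minimal \<psi> j (a + B x \<bullet> x)"
  shows "eigenvec x (a + B x \<bullet> x)"
  unfolding eigenvec_def
proof
  fix n
  define l where "l = a + B x \<bullet> x"
  \<comment> \<open>The subtracted vectors are eigenvectors, so \<open>y\<close> stays in the domain
    of D with explicit image \<open>w\<close>. Their contributions to the linear coefficient are the
    products B x with \<open>\<psi> i\<close>, occurring once with each sign, and cancel.\<close>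
  define y where "y = ket n - (\<Sum>i<j. crd (\<psi> i) n *\<^sub>R \<psi> i)"
  define w where "w = \<mu> n *\<^sub>R ket n - (\<Sum>i<j. crd (\<psi> i) n *\<^sub>R (eigval i *\<^sub>R \<psi> i - B (\<psi> i)))"
  have diag_image: "diag_image y w" unfolding y_def w_def
    using eigenvec unfolding eigenvec_iff_diag_image by (intro diag_image_diff diag_image_ket diag_image_sum diag_image_scaleR) auto
  have y_orth: "y \<bullet> \<psi> k = 0" if "k < j" for k
  proof -
    have "(\<Sum>i<j. crd (\<psi> i) n * (\<psi> i \<bullet> \<psi> k)) = (\<Sum>i<j. if i = k then crd (\<psi> i) n else 0)"
      using orth that by (intro sum.cong) auto
    then show ?thesis using that by (simp add: y_def inner_diff_left inner_sum_left)
  qed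
  have "0 \<le> 2 * t * (x \<bullet> w + B x \<bullet> y - l * (x \<bullet> y)) + t\<^sup>2 * (y \<bullet> w + B y \<bullet> y - l * (y \<bullet> y))" for t
  proof -
    have "l * (norm (x + t *\<^sub>R y))\<^sup>2 \<le> a + 2 * t * (x \<bullet> w) + t\<^sup>2 * (y \<bullet> w) + B (x + t *\<^sub>R y) \<bullet> (x + t *\<^sub>R y)"
      using min energy_add[OF x(3) diag_image, of t] x(2) y_orth
      unfolding minimal_def l_def by (simp add: inner_add_left)
    moreover have "(norm (x + t *\<^sub>R y))\<^sup>2 = 1 + 2 * t * (x \<bullet> y) + t\<^sup>2 * (y \<bullet> y)"
      using x(1) unfolding power2_norm_eq_inner
      by (simp add: inner_add inner_commute power2_eq_square algebra_simps norm_eq_sqrt_inner)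
    moreover have "B (x + t *\<^sub>R y) \<bullet> (x + t *\<^sub>R y) = B x \<bullet> x + 2 * t * (B x \<bullet> y) + t\<^sup>2 * (B y \<bullet> y)"
      using sym[of y x] by (simp add: B_add B_scaleR inner_add inner_commute power2_eq_square algebra_simps)
    ultimately show ?thesis unfolding l_def by (simp add: algebra_simps)
  qed
  then have "x \<bullet> w + B x \<bullet> y - l * (x \<bullet> y) = 0"
    by (rule linear_coeff_zero_of_nonneg)
  moreover have "x \<bullet> y = crd x n"
    using x(2) by (simp add: y_def inner_diff_right inner_sum_right)
  moreover have "B x \<bullet> y = crd (B x) n - (\<Sum>i<j. crd (\<psi> i) n * (B x \<bullet> \<psi> i))"
    by (simp add: y_def inner_diff_right inner_sum_right)
  moreover have "x \<bullet> w = \<mu> n * crd x n + (\<Sum>i<j. crd (\<psi> i) n * (B x \<bullet> \<psi> i))"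
    using x(2) by (simp add: w_def inner_diff_right inner_sum_right sym sum_negf)
  ultimately show "\<mu> n * crd x n + crd (B x) n = (a + B x \<bullet> x) * crd x n"
    by (simp add: l_def)
qed

text \<open>A combination of the first j + 1 basis vectors can meet j conditions, and finite support
  makes its energy finite. This keeps the infimum in the minimisation from being over the empty
  set.\<close>

lemma exists_unit_orthogonal:
  fixes \<psi> :: "nat \<Rightarrow> l2"
  shows "\<exists>y b. norm y = 1 \<and> (\<forall>i<j. y \<bullet> \<psi> i = 0) \<and> energy y b"
proof -
  obtain c where c: "\<exists>i\<in>{..<Suc j}. c i \<noteq> 0" "\<forall>k<j. (\<Sum>i\<in>{..<Suc j}. c i * crd (\<psi> k) i) = 0"
    using homogeneous_system_nontrivial[of "{..<Suc j}" j "\<lambda>i k. crd (\<psi> k) i"] by auto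
  define y where "y = (\<Sum>i<Suc j. c i *\<^sub>R ket i)"
  have "diag_image y (\<Sum>i<Suc j. c i *\<^sub>R (\<mu> i *\<^sub>R ket i))"
    unfolding y_def by (intro diag_image_sum diag_image_scaleR diag_image_ket)
  then obtain b where b: "energy y b" using energy_diag_image by blast
  obtain i where i: "i < Suc j" "c i \<noteq> 0" using c(1) by auto
  have "crd y i = c i" using i by (simp add: y_def crd_ket if_distrib[of "(*) _"] del: sum.lessThan_Suc cong: if_cong)
  then have "y \<noteq> 0" using i by auto
  have "y \<bullet> \<psi> k = 0" if "k < j" for k
    using c(2) that by (simp add: y_def inner_sum_left inner_commute[of "ket _"] del: sum.lessThan_Suc)
  then show ?thesis
    using \<open>y \<noteq> 0\<close> energy_scaleR[OF b, of "inverse (norm y)"]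
    by (intro exI[of _ "inverse (norm y) *\<^sub>R y"]) auto
qed

lemma energy_ge_Delta: "energy y b \<Longrightarrow> \<Delta> * (norm y)\<^sup>2 \<le> b"
  using energy_ge[of y b \<Delta>] mu_gt less_imp_le by blast

text \<open>The direct method. Since B is bounded, a minimising sequence has bounded energy, hence a
  convergent subsequence; the energy is lower semicontinuous along it and the form of B
  continuous.\<close>

lemma exists_minimizer:
  "\<exists>x a. norm x = 1 \<and> (\<forall>i<j. x \<bullet> \<psi> i = 0) \<and> energy x a \<and> minimal \<psi> j (a + B x \<bullet> x)"
proof -
  define S where "S = {b + B y \<bullet> y |y b. norm y = 1 \<and> (\<forall>i<j. y \<bullet> \<psi> i = 0) \<and> energy y b}"
  have ne: "S \<noteq> {}" unfolding S_def using exists_unit_orthogonal[of j \<psi>] by blast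
  have S0: "0 \<le> s" if sS: "s \<in> S" for s
  proof -
    obtain y b where y: "s = b + B y \<bullet> y" "norm y = 1" "energy y b"
      using CollectD[OF sS[unfolded S_def]] by metis
    show ?thesis using energy_ge_Delta[OF y(3)] abs_B_le[of y] y by (auto simp: abs_le_iff)
  qed
  then have bb: "bdd_below S" by (intro bdd_belowI[of _ 0])
  define m where "m = Inf S"
  have "\<exists>y b. norm y = 1 \<and> (\<forall>i<j. y \<bullet> \<psi> i = 0) \<and> energy y b \<and> b + B y \<bullet> y < m + inverse (real (Suc k))" for k
  proof -
    have "Inf S < m + inverse (real (Suc k))" unfolding m_def by simp
    then obtain s where s: "s \<in> S" "s < m + inverse (real (Suc k))"
      using cInf_less_iff[OF ne bb] by blast
    then show ?thesis using CollectD[OF s(1)[unfolded S_def]] by metis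
  qed
  then obtain Y b where Y: "\<And>k. norm (Y k) = 1" "\<And>k. (\<forall>i<j. Y k \<bullet> \<psi> i = 0)" "\<And>k. energy (Y k) (b k)"
    "\<And>k. b k + B (Y k) \<bullet> Y k < m + inverse (real (Suc k))"
    by metis
  have b_le: "b k \<le> m + 1 + \<Delta>" for k
  proof -
    have "inverse (real (Suc k)) \<le> 1" by (simp add: inverse_le_1_iff)
    then show ?thesis using Y(4)[of k] abs_B_le[of "Y k"] Y(1)[of k] by (auto simp: abs_le_iff)
  qed
  have Yle: "norm (Y k) \<le> 1" for k using Y(1)[of k] by simp
  obtain x r where r: "strict_mono (r::nat\<Rightarrow>nat)" and lim: "(Y \<circ> r) \<longlonglongrightarrow> x"
    by (rule l2_compactness[OF mu_nonneg mu_lim Yle Y(3)[unfolded energy_def] b_le])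
      (rule that)
  have "(\<lambda>k. norm ((Y \<circ> r) k)) \<longlonglongrightarrow> norm x" using lim by (rule tendsto_norm)
  then have nx: "norm x = 1" using Y(1) by (simp add: LIMSEQ_const_iff)
  have xo: "x \<bullet> \<psi> i = 0" if "i < j" for i
  proof -
    have "(\<lambda>k. (Y \<circ> r) k \<bullet> \<psi> i) \<longlonglongrightarrow> x \<bullet> \<psi> i" by (intro tendsto_inner lim tendsto_const)
    then show ?thesis using Y(2) that by (simp add: LIMSEQ_const_iff)
  qed
  have mem: "b k + B (Y k) \<bullet> Y k \<in> S" for k unfolding S_def using Y by blast
  have val: "(\<lambda>k. b k + B (Y k) \<bullet> Y k) \<longlonglongrightarrow> m"
  proof (rule real_tendsto_sandwich[of "\<lambda>_. m" _ _ "\<lambda>k. m + inverse (real (Suc k))"])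
    show "(\<lambda>k. m + inverse (real (Suc k))) \<longlonglongrightarrow> m"
      using tendsto_add[OF tendsto_const LIMSEQ_inverse_real_of_nat, of m] by simp
    show "\<forall>\<^sub>F k in sequentially. m \<le> b k + B (Y k) \<bullet> Y k"
      unfolding m_def using cInf_lower[OF mem bb] by simp
    show "\<forall>\<^sub>F k in sequentially. b k + B (Y k) \<bullet> Y k \<le> m + inverse (real (Suc k))"
      using Y(4) less_imp_le by (intro always_eventually) blast
  qed simp
  have "(\<lambda>k. B ((Y \<circ> r) k) \<bullet> (Y \<circ> r) k) \<longlonglongrightarrow> B x \<bullet> x"
    by (intro tendsto_inner lim bounded_linear.tendsto[OF bounded_linear_B])
  from tendsto_diff[OF LIMSEQ_subseq_LIMSEQ[OF val r] this]
  have blim: "(b \<circ> r) \<longlonglongrightarrow> m - B x \<bullet> x" by (simp add: o_def)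
  have bsums: "(\<lambda>i. \<mu> i * (crd ((Y \<circ> r) k) i)\<^sup>2) sums (b \<circ> r) k" for k
    using Y(3)[of "r k"] by (simp add: energy_def)
  obtain a where a: "energy x a" "a \<le> m - B x \<bullet> x"
  proof (rule form_limit_le[OF mu_nonneg lim bsums blim])
    fix b' assume "(\<lambda>i. \<mu> i * (crd x i)\<^sup>2) sums b'" "b' \<le> m - B x \<bullet> x"
    then show thesis by (intro that[of b']) (simp_all add: energy_def)
  qed
  \<comment> \<open>Semicontinuity yields only one inequality; the other holds because the limit
    itself competes for the infimum.\<close>
  have "m \<le> a + B x \<bullet> x"
    unfolding m_def by (rule cInf_lower[OF _ bb]) (use nx xo a in \<open>auto simp: S_def\<close>)
  then have am: "a + B x \<bullet> x = m" using a(2) by simp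
  have "m * (norm y)\<^sup>2 \<le> c + B y \<bullet> y" if y: "energy y c" "\<forall>i<j. y \<bullet> \<psi> i = 0" for y c
  proof (cases "y = 0")
    case True
    then show ?thesis using energy_ge_Delta[OF y(1)] by simp
  next
    case False
    define t where "t = inverse (norm y)"
    have t: "t * norm y = 1" "t > 0" using False by (auto simp: t_def)
    have "t\<^sup>2 * c + B (t *\<^sub>R y) \<bullet> (t *\<^sub>R y) \<in> S"
      unfolding S_def using energy_scaleR[OF y(1), of t] t y(2) by fastforce
    then have "m \<le> t\<^sup>2 * c + B (t *\<^sub>R y) \<bullet> (t *\<^sub>R y)"
      unfolding m_def using cInf_lower[OF _ bb] by blast
    then have "m \<le> t\<^sup>2 * (c + B y \<bullet> y)"
      by (simp add: B_scaleR power2_eq_square algebra_simps)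
    then have "m * (norm y)\<^sup>2 \<le> t\<^sup>2 * (c + B y \<bullet> y) * (norm y)\<^sup>2"
      by (rule mult_right_mono) simp
    also have "\<dots> = (t * norm y)\<^sup>2 * (c + B y \<bullet> y)" by (simp add: power_mult_distrib)
    finally show ?thesis using t by simp
  qed
  then have "minimal \<psi> j (a + B x \<bullet> x)" unfolding minimal_def am by blast
  then show ?thesis using nx xo a(1) by blast
qed

lemma exists_eigensequence:
  "\<exists>\<psi> eigval. \<forall>j. norm (\<psi> j) = 1 \<and> (\<forall>i<j. \<psi> j \<bullet> \<psi> i = 0) \<and> eigenvec (\<psi> j) (eigval j) \<and> minimal \<psi> j (eigval j)"
proof -
  \<comment> \<open>Vector and eigenvalue are chosen together as a pair, and \<open>P\<close> looks
    only at pairs with smaller index, as well-founded choice requires.\<close>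
  define P where "P f j r \<longleftrightarrow> norm (fst r) = 1 \<and> (\<forall>i<j. fst r \<bullet> fst (f i) = 0) \<and> eigenvec (fst r) (snd r)
      \<and> minimal (\<lambda>i. fst (f i)) j (snd r)" for f :: "nat \<Rightarrow> l2 \<times> real" and j r
  have "\<exists>f. \<forall>j. P f j (f j)"
  proof (rule dependent_wf_choice[OF wf_less])
    show "P f x r = P g x r" if "\<And>z. (z, x) \<in> {(x, y). x < y} \<Longrightarrow> f z = g z" for f g x r
      using that unfolding P_def minimal_def by simp
    show "\<exists>r. P f j r" if H: "\<And>y. (y, j) \<in> {(x, y). x < y} \<Longrightarrow> P f y (f y)" for j f
    proof -
      define \<psi> where "\<psi> i = fst (f i)" for i
      have H': "norm (\<psi> y) = 1" "\<And>i. i < y \<Longrightarrow> \<psi> y \<bullet> \<psi> i = 0" "eigenvec (\<psi> y) (snd (f y))" if "y < j" for y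
        using H[of y] that unfolding P_def \<psi>_def by auto
      have "\<psi> i \<bullet> \<psi> k = (if i = k then 1 else 0)" if "i < j" "k < j" for i k
      proof (cases i k rule: linorder_cases)
        case less
        then show ?thesis using H'(2)[of k i] that by (simp add: inner_commute)
      next
        case equal
        then show ?thesis using H'(1)[of i] that by (simp add: norm_eq_sqrt_inner)
      next
        case greater
        then show ?thesis using H'(2)[of i k] that by simp
      qed
      moreover obtain x a where x: "norm x = 1" "\<forall>i<j. x \<bullet> \<psi> i = 0" "energy x a" "minimal \<psi> j (a + B x \<bullet> x)"
        using exists_minimizer[of j \<psi>] by blast
      ultimately have "eigenvec x (a + B x \<bullet> x)"
        using H'(3) by (intro minimizer_eigenvec[of j \<psi> "\<lambda>i. snd (f i)"]) auto
      then show ?thesis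
        using x unfolding \<psi>_def P_def by (intro exI[of _ "(x, a + B x \<bullet> x)"]) simp
    qed
  qed
  then obtain f where "\<And>j. P f j (f j)" by blast
  then show ?thesis unfolding P_def
    by (intro exI[of _ "\<lambda>i. fst (f i)"] exI[of _ "\<lambda>i. snd (f i)"]) simp
qed

end

lemma filterlim_of_inj_real_at_top:
  fixes \<mu> :: "nat \<Rightarrow> real" and \<sigma> :: "nat \<Rightarrow> nat"
  assumes "filterlim \<mu> at_top sequentially" "inj \<sigma>"
  shows "filterlim (\<lambda>j. \<mu> (\<sigma> j)) at_top sequentially"
  unfolding filterlim_at_top eventually_sequentially
proof
  fix Z
  obtain N where N: "\<And>n. n \<ge> N \<Longrightarrow> Z \<le> \<mu> n"
    using assms(1) unfolding filterlim_at_top eventually_sequentially by blast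
  have "finite (\<sigma> -` {..<N})" using assms(2) by (intro finite_vimageI) auto
  then obtain M where M: "\<And>j. j \<in> \<sigma> -` {..<N} \<Longrightarrow> j < M"
    unfolding finite_nat_set_iff_bounded by metis
  show "\<exists>M. \<forall>j\<ge>M. Z \<le> \<mu> (\<sigma> j)"
  proof (intro exI[of _ M] allI impI)
    fix j assume "j \<ge> M"
    then have "\<not> \<sigma> j < N" using M[of j] by auto
    then show "Z \<le> \<mu> (\<sigma> j)" by (intro N) simp
  qed
qed

text \<open>The diagonal interleaves two progressions and need not be monotone.
  \<open>\<sigma>\<close> lists it in nondecreasing order, so that entries of equal rank can be
  compared with the eigenvalues.\<close>

locale l2_eigensequence = l2_perturbation +
  fixes \<psi> :: "nat \<Rightarrow> l2" and eigval :: "nat \<Rightarrow> real" and \<sigma> :: "nat \<Rightarrow> nat"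
  assumes psi_norm: "norm (\<psi> j) = 1" and psi_orth': "i < j \<Longrightarrow> \<psi> j \<bullet> \<psi> i = 0"
    and psi_eigenvec: "eigenvec (\<psi> j) (eigval j)" and psi_minimal: "minimal \<psi> j (eigval j)"
    and sigma_bij: "bij \<sigma>" and sigma_mono: "mono (\<lambda>j. \<mu> (\<sigma> j))"
begin

lemma psi_inner: "\<psi> i \<bullet> \<psi> k = (if i = k then 1 else 0)"
  using psi_orth'[of i k] psi_orth'[of k i] psi_norm[of i]
  by (cases i k rule: linorder_cases) (auto simp: inner_commute norm_eq_sqrt_inner)

text \<open>The next eigenvector is itself a competitor in the preceding minimisation.\<close>

lemma eigval_mono: "mono eigval"
proof (rule mono_iff_le_Suc[THEN iffD2], rule allI)
  fix j
  have e: "energy (\<psi> (Suc j)) (\<psi> (Suc j) \<bullet> (eigval (Suc j) *\<^sub>R \<psi> (Suc j) - B (\<psi> (Suc j))))"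
    by (rule energy_diag_image) (use psi_eigenvec eigenvec_iff_diag_image in blast)
  have "eigval j * (norm (\<psi> (Suc j)))\<^sup>2 \<le> \<psi> (Suc j) \<bullet> (eigval (Suc j) *\<^sub>R \<psi> (Suc j) - B (\<psi> (Suc j))) + B (\<psi> (Suc j)) \<bullet> \<psi> (Suc j)"
    using psi_minimal[of j] e psi_inner unfolding minimal_def by simp
  then show "eigval j \<le> eigval (Suc j)"
    by (simp add: psi_norm psi_inner inner_diff_right inner_commute)
qed

lemma norm_sum_sq:
  assumes "finite I" "\<And>i k. i \<in> I \<Longrightarrow> k \<in> I \<Longrightarrow> u i \<bullet> u k = (if i = k then 1 else (0::real))"
  shows "(\<Sum>i\<in>I. a i *\<^sub>R u i) \<bullet> (\<Sum>i\<in>I. b i *\<^sub>R u i) = (\<Sum>i\<in>I. a i * b i)"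
proof -
  have "(\<Sum>i\<in>I. a i *\<^sub>R u i) \<bullet> (\<Sum>i\<in>I. b i *\<^sub>R u i) = (\<Sum>i\<in>I. \<Sum>k\<in>I. a k * b i * (u k \<bullet> u i))"
    by (simp add: inner_sum_left inner_sum_right sum_distrib_left mult_ac)
  also have "\<dots> = (\<Sum>i\<in>I. \<Sum>k\<in>I. if k = i then a i * b i else 0)"
    using assms(2) by (intro sum.cong refl) auto
  also have "\<dots> = (\<Sum>i\<in>I. a i * b i)" using assms(1) by simp
  finally show ?thesis .
qed

text \<open>
  In both comparisons a nonzero test vector exists because $j + 1$ coefficients are subject to
  $j$ linear conditions: a combination of the first $j + 1$ eigenvectors of one operator orthogonal
  to the first $j$ eigenvectors of the other.
\<close>

lemma eigval_upper:
  assumes "\<And>v a. energy v a \<Longrightarrow> a \<le> \<mu> (\<sigma> j) * (norm v)\<^sup>2 \<Longrightarrow> \<bar>B v \<bullet> v\<bar> \<le> \<eta> * (norm v)\<^sup>2"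
  shows "eigval j \<le> \<mu> (\<sigma> j) + \<eta>"
proof -
  have inj: "\<sigma> i = \<sigma> k \<longleftrightarrow> i = k" for i k using sigma_bij by (simp add: bij_is_inj inj_eq)
  obtain c where c: "\<exists>i\<in>{..j}. c i \<noteq> 0" "\<forall>k<j. (\<Sum>i\<in>{..j}. c i * crd (\<psi> k) (\<sigma> i)) = 0"
    using homogeneous_system_nontrivial[of "{..j}" j "\<lambda>i k. crd (\<psi> k) (\<sigma> i)"] by auto
  define y where "y = (\<Sum>i\<le>j. c i *\<^sub>R ket (\<sigma> i))"
  define w where "w = (\<Sum>i\<le>j. (c i * \<mu> (\<sigma> i)) *\<^sub>R ket (\<sigma> i))"
  have "diag_image y (\<Sum>i\<le>j. c i *\<^sub>R (\<mu> (\<sigma> i) *\<^sub>R ket (\<sigma> i)))"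
    unfolding y_def by (intro diag_image_sum diag_image_scaleR diag_image_ket)
  then have e: "energy y (y \<bullet> w)" unfolding w_def by (simp add: energy_diag_image)
  have ortho: "ket (\<sigma> i) \<bullet> ket (\<sigma> k) = (if i = k then 1 else 0)" for i k
    by (simp add: crd_ket inj)
  have ny: "(norm y)\<^sup>2 = (\<Sum>i\<le>j. c i * c i)"
    unfolding power2_norm_eq_inner y_def using ortho by (intro norm_sum_sq) auto
  have "y \<bullet> w = (\<Sum>i\<le>j. c i * (c i * \<mu> (\<sigma> i)))"
    unfolding y_def w_def using ortho by (intro norm_sum_sq) auto
  also have "\<dots> \<le> (\<Sum>i\<le>j. \<mu> (\<sigma> j) * (c i * c i))"
  proof (rule sum_mono)
    fix i assume "i \<in> {..j}"
    then have "\<mu> (\<sigma> i) * (c i * c i) \<le> \<mu> (\<sigma> j) * (c i * c i)"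
      using monoD[OF sigma_mono, of i j] by (intro mult_right_mono) auto
    then show "c i * (c i * \<mu> (\<sigma> i)) \<le> \<mu> (\<sigma> j) * (c i * c i)" by (simp add: mult_ac)
  qed
  also have "\<dots> = \<mu> (\<sigma> j) * (norm y)\<^sup>2" by (simp add: ny sum_distrib_left)
  finally have yw: "y \<bullet> w \<le> \<mu> (\<sigma> j) * (norm y)\<^sup>2" .
  have "y \<bullet> \<psi> k = 0" if "k < j" for k
    using c(2) that by (simp add: y_def inner_sum_left)
  then have "eigval j * (norm y)\<^sup>2 \<le> y \<bullet> w + B y \<bullet> y"
    using psi_minimal[of j] e unfolding minimal_def by blast
  also have "\<dots> \<le> (\<mu> (\<sigma> j) + \<eta>) * (norm y)\<^sup>2"
    using yw assms[OF e yw] by (auto simp: abs_le_iff algebra_simps)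
  finally have "eigval j * (norm y)\<^sup>2 \<le> (\<mu> (\<sigma> j) + \<eta>) * (norm y)\<^sup>2" .
  moreover have "0 < (norm y)\<^sup>2"
  proof -
    obtain i where "i \<le> j" "c i \<noteq> 0" using c(1) by auto
    then show ?thesis unfolding ny by (intro sum_pos2[of _ i]) (auto simp: zero_less_mult_iff)
  qed
  ultimately show ?thesis by simp
qed

lemma eigval_lower:
  assumes "\<And>v a. energy v a \<Longrightarrow> a \<le> (eigval j + \<Delta>) * (norm v)\<^sup>2 \<Longrightarrow> \<bar>B v \<bullet> v\<bar> \<le> \<eta> * (norm v)\<^sup>2"
  shows "\<mu> (\<sigma> j) - \<eta> \<le> eigval j"
proof -
  obtain c where c: "\<exists>i\<in>{..j}. c i \<noteq> 0" "\<forall>k<j. (\<Sum>i\<in>{..j}. c i * crd (\<psi> i) (\<sigma> k)) = 0"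
    using homogeneous_system_nontrivial[of "{..j}" j "\<lambda>i k. crd (\<psi> i) (\<sigma> k)"] by auto
  define y where "y = (\<Sum>i\<le>j. c i *\<^sub>R \<psi> i)"
  define w where "w = (\<Sum>i\<le>j. (c i * eigval i) *\<^sub>R \<psi> i)"
  have "diag_image y (\<Sum>i\<le>j. c i *\<^sub>R (eigval i *\<^sub>R \<psi> i - B (\<psi> i)))"
    unfolding y_def by (intro diag_image_sum diag_image_scaleR) (use psi_eigenvec eigenvec_iff_diag_image in blast)
  moreover have "(\<Sum>i\<le>j. c i *\<^sub>R (eigval i *\<^sub>R \<psi> i - B (\<psi> i))) = w - B y"
    by (simp add: w_def y_def B_sum B_scaleR sum_subtractf scaleR_diff_right)
  ultimately have e: "energy y (y \<bullet> (w - B y))" by (simp add: energy_diag_image)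
  have ny: "(norm y)\<^sup>2 = (\<Sum>i\<le>j. c i * c i)"
    unfolding power2_norm_eq_inner y_def using psi_inner by (intro norm_sum_sq) auto
  have "y \<bullet> w = (\<Sum>i\<le>j. c i * (c i * eigval i))"
    unfolding y_def w_def using psi_inner by (intro norm_sum_sq) auto
  also have "\<dots> \<le> (\<Sum>i\<le>j. eigval j * (c i * c i))"
  proof (rule sum_mono)
    fix i assume "i \<in> {..j}"
    then have "eigval i * (c i * c i) \<le> eigval j * (c i * c i)"
      using monoD[OF eigval_mono, of i j] by (intro mult_right_mono) auto
    then show "c i * (c i * eigval i) \<le> eigval j * (c i * c i)" by (simp add: mult_ac)
  qed
  also have "\<dots> = eigval j * (norm y)\<^sup>2" by (simp add: ny sum_distrib_left)
  finally have yw: "y \<bullet> (w - B y) \<le> eigval j * (norm y)\<^sup>2 - B y \<bullet> y"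
    by (simp add: inner_diff_right inner_commute)
  \<comment> \<open>The threshold in the hypothesis comes from here: on this test space the form of
    D + B is at most \<open>eigval j\<close>, and removing B costs at most
    \<open>\<Delta>\<close>.\<close>
  then have yw': "y \<bullet> (w - B y) \<le> (eigval j + \<Delta>) * (norm y)\<^sup>2"
    using abs_B_le[of y] by (auto simp: abs_le_iff algebra_simps)
  \<comment> \<open>The conditions on \<open>c\<close> remove the coordinates of the
    \<open>j\<close> smallest diagonal entries, so the energy is bounded below by the entry of rank
    \<open>j\<close>.\<close>
  have "\<mu> (\<sigma> j) * (norm y)\<^sup>2 \<le> y \<bullet> (w - B y)"
  proof (rule energy_ge[OF e])
    fix i assume i: "crd y i \<noteq> 0"
    obtain k where k: "i = \<sigma> k" using sigma_bij by (metis bij_pointE)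
    have "crd y (\<sigma> k) = 0" if "k < j" using c(2) that by (simp add: y_def)
    then have "j \<le> k" using i k by (cases "k < j") auto
    then show "\<mu> (\<sigma> j) \<le> \<mu> i" using monoD[OF sigma_mono] k by blast
  qed
  also note yw
  also have "eigval j * (norm y)\<^sup>2 - B y \<bullet> y \<le> (eigval j + \<eta>) * (norm y)\<^sup>2"
    using assms[OF e yw'] by (auto simp: abs_le_iff algebra_simps)
  finally have "\<mu> (\<sigma> j) * (norm y)\<^sup>2 \<le> (eigval j + \<eta>) * (norm y)\<^sup>2" .
  moreover have "0 < (norm y)\<^sup>2"
  proof -
    obtain i where "i \<le> j" "c i \<noteq> 0" using c(1) by auto
    then show ?thesis unfolding ny by (intro sum_pos2[of _ i]) (auto simp: zero_less_mult_iff)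
  qed
  ultimately show ?thesis by simp
qed

lemma eigval_close_Delta: "\<bar>eigval j - \<mu> (\<sigma> j)\<bar> \<le> \<Delta>"
  using eigval_upper[of j \<Delta>] eigval_lower[of j \<Delta>] abs_B_le by (auto simp: abs_le_iff)

text \<open>A bootstrap: the crude bound by \<open>\<Delta>\<close> replaces the threshold of
  \<open>eigval_lower\<close>, which contains the unknown eigenvalue, by one that depends on D alone
  and is thus the same for every coupling.\<close>

lemma eigval_close:
  assumes "\<And>v a. energy v a \<Longrightarrow> a \<le> (\<mu> (\<sigma> j) + 2 * \<Delta>) * (norm v)\<^sup>2 \<Longrightarrow> \<bar>B v \<bullet> v\<bar> \<le> \<eta> * (norm v)\<^sup>2"
  shows "\<bar>eigval j - \<mu> (\<sigma> j)\<bar> \<le> \<eta>"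
proof -
  have *: "\<bar>B v \<bullet> v\<bar> \<le> \<eta> * (norm v)\<^sup>2" if "energy v a" "a \<le> m * (norm v)\<^sup>2" "m \<le> \<mu> (\<sigma> j) + 2 * \<Delta>" for v a m
    by (rule assms[OF that(1) order_trans[OF that(2) mult_right_mono[OF that(3)]]]) simp
  have "eigval j \<le> \<mu> (\<sigma> j) + \<eta>"
    by (rule eigval_upper, erule (1) *) (simp add: Delta_nonneg)
  moreover have "eigval j + \<Delta> \<le> \<mu> (\<sigma> j) + 2 * \<Delta>"
    using eigval_close_Delta[of j] by (simp add: abs_le_iff)
  then have "\<mu> (\<sigma> j) - \<eta> \<le> eigval j"
    using * by (intro eigval_lower) blast
  ultimately show ?thesis by (auto simp: abs_le_iff)
qed

lemma eigval_at_top: "filterlim eigval at_top sequentially"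
proof -
  have "filterlim (\<lambda>j. - \<Delta> + \<mu> (\<sigma> j)) at_top sequentially"
    by (rule filterlim_tendsto_add_at_top[OF tendsto_const
        filterlim_of_inj_real_at_top[OF mu_lim bij_is_inj[OF sigma_bij]]])
  then show ?thesis
  proof (rule filterlim_at_top_mono, intro always_eventually allI)
    show "- \<Delta> + \<mu> (\<sigma> j) \<le> eigval j" for j using eigval_close_Delta[of j] by (simp add: abs_le_iff)
  qed
qed

lemma finite_eigval_eq: "finite {j. eigval j = l}"
proof -
  obtain N where "\<And>n. n \<ge> N \<Longrightarrow> l + 1 \<le> eigval n"
    using eigval_at_top unfolding filterlim_at_top eventually_sequentially by blast
  then have "j < N" if "eigval j = l" for j using that using \<open>\<And>n. n \<ge> N \<Longrightarrow> l + 1 \<le> eigval n\<close>[of j] by linarith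
  then have "{j. eigval j = l} \<subseteq> {..<N}" by blast
  then show ?thesis using finite_subset by blast
qed

text \<open>Completeness of the sequence. The remainder is again an eigenvector and is orthogonal to
  every \<open>\<psi> k\<close>, so minimality bounds each \<open>eigval j\<close> times its squared
  norm by \<open>l\<close> times the same; as the eigenvalues are unbounded, it vanishes.\<close>

lemma eigenvec_expansion:
  assumes "eigenvec x l"
  shows "x = (\<Sum>i | eigval i = l. (x \<bullet> \<psi> i) *\<^sub>R \<psi> i)"
proof -
  let ?J = "{i. eigval i = l}"
  define r where "r = x - (\<Sum>i\<in>?J. (x \<bullet> \<psi> i) *\<^sub>R \<psi> i)"
  have "diag_image r ((l *\<^sub>R x - B x) - (\<Sum>i\<in>?J. (x \<bullet> \<psi> i) *\<^sub>R (l *\<^sub>R \<psi> i - B (\<psi> i))))"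
    unfolding r_def using assms psi_eigenvec
    by (intro diag_image_diff diag_image_sum diag_image_scaleR) (auto simp: eigenvec_iff_diag_image)
  also have "(l *\<^sub>R x - B x) - (\<Sum>i\<in>?J. (x \<bullet> \<psi> i) *\<^sub>R (l *\<^sub>R \<psi> i - B (\<psi> i))) = l *\<^sub>R r - B r"
    by (simp add: r_def B_diff B_sum B_scaleR sum_subtractf algebra_simps scaleR_sum_right)
  finally have er: "eigenvec r l" by (simp add: eigenvec_iff_diag_image)
  have "r \<bullet> \<psi> k = 0" for k
  proof (cases "eigval k = l")
    case True
    have "(\<Sum>i\<in>?J. (x \<bullet> \<psi> i) * (\<psi> i \<bullet> \<psi> k)) = (\<Sum>i\<in>?J. if i = k then x \<bullet> \<psi> k else 0)"
      by (intro sum.cong) (auto simp: psi_inner)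
    then show ?thesis using True finite_eigval_eq by (simp add: r_def inner_diff_left inner_sum_left)
  next
    case False
    then show ?thesis using eigenvec_orthogonal[OF er psi_eigenvec[of k]] by simp
  qed
  moreover have "energy r (r \<bullet> (l *\<^sub>R r - B r))" using er by (simp add: eigenvec_iff_diag_image energy_diag_image)
  ultimately have "eigval j * (norm r)\<^sup>2 \<le> r \<bullet> (l *\<^sub>R r - B r) + B r \<bullet> r" for j
    using psi_minimal[of j] unfolding minimal_def by blast
  then have le: "eigval j * (norm r)\<^sup>2 \<le> l * (norm r)\<^sup>2" for j
    by (simp add: inner_diff_right inner_commute[of r "B r"] power2_norm_eq_inner)
  obtain N where "l + 1 \<le> eigval N"
    using eigval_at_top unfolding filterlim_at_top eventually_sequentially by blast
  then have "(l + 1) * (norm r)\<^sup>2 \<le> eigval N * (norm r)\<^sup>2" by (rule mult_right_mono) simp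
  then have "(norm r)\<^sup>2 \<le> 0" using le[of N] by (simp only: distrib_right mult_1)
  then have "norm r = 0" by simp
  then show ?thesis by (simp add: r_def)
qed

end

section \<open>Symmetric matrices as operators\<close>

text \<open>For a symmetric form the numerical radius is the norm. Polarisation and the
  parallelogram law bound the form by a sum of squares; scaling both vectors to unit length turns
  the sum into a product without loss in \<open>D\<close>.\<close>

lemma bilinear_bound_of_quadratic_bound:
  fixes W :: "nat \<Rightarrow> nat \<Rightarrow> real"
  assumes sym: "\<And>i j. W i j = W j i"
    and quad: "\<And>x. \<bar>\<Sum>i<K. \<Sum>j<K. x i * W i j * x j\<bar> \<le> D * (\<Sum>i<K. (x i)\<^sup>2)"
  shows "\<bar>\<Sum>i<K. \<Sum>j<K. y i * W i j * x j\<bar> \<le> D * (L2_set y {..<K} * L2_set x {..<K})"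
proof -
  define b where "b y x = (\<Sum>i<K. \<Sum>j<K. y i * W i j * x j)" for x y
  have bs: "b y x = b x y" for x y
    unfolding b_def by (subst sum.swap) (intro sum.cong refl, simp add: sym mult.commute mult.left_commute)
  have bsc: "b (\<lambda>i. s * y i) (\<lambda>i. t * x i) = s * t * b y x" for s t x y
    unfolding b_def by (simp add: sum_distrib_left mult_ac)
  have half: "2 * \<bar>b y x\<bar> \<le> D * ((\<Sum>i<K. (y i)\<^sup>2) + (\<Sum>i<K. (x i)\<^sup>2))" for x y
  proof -
    have "b (\<lambda>i. x i + y i) (\<lambda>i. x i + y i) - b (\<lambda>i. x i - y i) (\<lambda>i. x i - y i) = 2 * b x y + 2 * b y x"
      unfolding b_def by (simp add: sum_subtractf[symmetric] sum.distrib[symmetric] sum_distrib_left algebra_simps)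
    then have "4 * b y x = b (\<lambda>i. x i + y i) (\<lambda>i. x i + y i) - b (\<lambda>i. x i - y i) (\<lambda>i. x i - y i)"
      using bs[of x y] by simp
    moreover have "\<bar>b (\<lambda>i. x i + y i) (\<lambda>i. x i + y i)\<bar> \<le> D * (\<Sum>i<K. (x i + y i)\<^sup>2)"
      "\<bar>b (\<lambda>i. x i - y i) (\<lambda>i. x i - y i)\<bar> \<le> D * (\<Sum>i<K. (x i - y i)\<^sup>2)"
      unfolding b_def by (intro quad)+
    moreover have "D * (\<Sum>i<K. (x i + y i)\<^sup>2) + D * (\<Sum>i<K. (x i - y i)\<^sup>2) = 2 * (D * ((\<Sum>i<K. (y i)\<^sup>2) + (\<Sum>i<K. (x i)\<^sup>2)))"
      by (simp add: power2_sum power2_diff sum.distrib sum_subtractf sum_distrib_left algebra_simps)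
    ultimately show ?thesis by linarith
  qed
  define A where "A = L2_set y {..<K}"
  define C where "C = L2_set x {..<K}"
  have AC: "A \<ge> 0" "C \<ge> 0" by (simp_all add: A_def C_def L2_set_nonneg)
  have zero: "b y x = 0" if "A = 0 \<or> C = 0"
  proof -
    have "(\<forall>i<K. y i = 0) \<or> (\<forall>i<K. x i = 0)"
      using that by (auto simp: A_def C_def L2_set_eq_0_iff)
    then show ?thesis by (auto simp: b_def)
  qed
  have "\<bar>b y x\<bar> \<le> D * (A * C)"
  proof (cases "A = 0 \<or> C = 0")
    case False
    then have p: "A > 0" "C > 0" using AC by auto
    have n1: "(\<Sum>i<K. (inverse A * y i)\<^sup>2) = 1" "(\<Sum>i<K. (inverse C * x i)\<^sup>2) = 1"
      using p real_sqrt_pow2[of "\<Sum>i<K. (y i)\<^sup>2"] real_sqrt_pow2[of "\<Sum>i<K. (x i)\<^sup>2"]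
      by (simp_all add: power_mult_distrib sum_distrib_left[symmetric] A_def C_def L2_set_def sum_nonneg)
        (simp_all add: field_simps)
    have "2 * \<bar>inverse A * inverse C * b y x\<bar> \<le> D * (1 + 1)"
      using half[of "\<lambda>i. inverse A * y i" "\<lambda>i. inverse C * x i"] unfolding bsc n1 .
    then show ?thesis using p by (simp add: abs_mult field_simps)
  qed (use zero in auto)
  then show ?thesis by (simp add: b_def A_def C_def)
qed

lemma L2_set_crd_le: "L2_set (crd x) {..<K} \<le> norm x"
proof -
  have "(\<Sum>i<K. (crd x i)\<^sup>2) \<le> (norm x)\<^sup>2"
    using sum_le_suminf[OF summable_crd_sq, of "{..<K}" x] norm_l2_sums[of x] by (simp add: sums_iff)
  then show ?thesis unfolding L2_set_def using real_le_lsqrt by (simp add: sum_nonneg)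
qed

text \<open>Passage from uniform bounds on finite sections to an operator whose coordinates are the
  row sums.\<close>

theorem symmetric_matrix_operator:
  fixes W :: "nat \<Rightarrow> nat \<Rightarrow> real"
  assumes sym: "\<And>i j. W i j = W j i" and D: "D \<ge> 0"
    and quad: "\<And>K x. \<bar>\<Sum>i<K. \<Sum>j<K. x i * W i j * x j\<bar> \<le> D * (\<Sum>i<K. (x i)\<^sup>2)"
  obtains B :: "l2 \<Rightarrow> l2" where "linear B" "\<And>x. norm (B x) \<le> D * norm x" "\<And>x y. B x \<bullet> y = x \<bullet> B y"
    "\<And>x i. (\<lambda>j. W i j * crd x j) sums crd (B x) i"
proof -
  note bil = bilinear_bound_of_quadratic_bound[OF sym quad]
  \<comment> \<open>Testing with the unit vector at \<open>i\<close> and the truncated row itself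
    gives S^2 at most D S for the norm S of that truncation. \<open>K\<close> is large enough to
    contain both \<open>i\<close> and \<open>n\<close>.\<close>
  have row: "summable (\<lambda>j. (W i j)\<^sup>2)" for i
  proof (rule bounded_imp_summable)
    show "(\<Sum>j\<le>n. (W i j)\<^sup>2) \<le> D\<^sup>2" for n
    proof -
      define K where "K = Suc (max i n)"
      define S where "S = L2_set (W i) {..<K}"
      have S: "S \<ge> 0" "S\<^sup>2 = (\<Sum>j<K. (W i j)\<^sup>2)" by (simp_all add: S_def L2_set_nonneg) (simp add: L2_set_def sum_nonneg)
      have "(\<Sum>k<K. \<Sum>j<K. (if k = i then 1 else 0) * W k j * W i j) = (\<Sum>k<K. if k = i then S\<^sup>2 else 0)"
        unfolding S by (intro sum.cong refl) (simp add: power2_eq_square)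
      also have "\<dots> = S\<^sup>2" by (simp add: K_def)
      finally have "S\<^sup>2 \<le> D * (L2_set (\<lambda>k. if k = i then 1 else 0) {..<K} * S)"
        using bil[where y = "\<lambda>k. if k = i then 1 else 0" and K = K and x = "W i"] unfolding S_def by simp
      also have "L2_set (\<lambda>k. if k = i then 1 else 0::real) {..<K} = 1"
        by (simp add: L2_set_def if_distrib[of "\<lambda>x. x\<^sup>2"] K_def cong: if_cong)
      finally have "S * S \<le> D * S" by (simp add: power2_eq_square)
      then have "S \<le> D" using S(1) D by (cases "S = 0") auto
      then have "S\<^sup>2 \<le> D\<^sup>2" using S(1) by (intro power_mono)
      moreover have "(\<Sum>j\<le>n. (W i j)\<^sup>2) \<le> S\<^sup>2" unfolding S by (intro sum_mono2) (auto simp: K_def)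
      ultimately show ?thesis by simp
    qed
  qed simp
  define f where "f x i = (\<Sum>j. W i j * crd x j)" for x i
  have f_sums: "(\<lambda>j. W i j * crd x j) sums f x i" for x i
    unfolding f_def by (intro summable_sums summable_mult_of_sq row summable_crd_sq)
  \<comment> \<open>Duality: the first \<open>K\<close> entries of \<open>f x\<close> serve as their
    own test vector, and the sections of size \<open>M\<close> pass to the limit.\<close>
  have f_bound: "L2_set (f x) {..<K} \<le> D * norm x" for x K
  proof -
    define S where "S = L2_set (f x) {..<K}"
    have S: "S \<ge> 0" "S\<^sup>2 = (\<Sum>j<K. (f x j)\<^sup>2)" by (simp_all add: S_def L2_set_nonneg) (simp add: L2_set_def sum_nonneg)
    have "(\<lambda>M. \<Sum>i<K. f x i * (\<Sum>j<M. W i j * crd x j)) \<longlonglongrightarrow> (\<Sum>i<K. f x i * f x i)"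
      using f_sums unfolding sums_def by (intro tendsto_sum tendsto_mult tendsto_const) auto
    moreover have "\<forall>\<^sub>F M in sequentially. (\<Sum>i<K. f x i * (\<Sum>j<M. W i j * crd x j)) \<le> D * (S * norm x)"
      unfolding eventually_sequentially
    proof (intro exI[of _ K] allI impI)
      fix M assume KM: "K \<le> M"
      define y where "y i = (if i < K then f x i else 0)" for i
      have "(\<Sum>i<K. f x i * (\<Sum>j<M. W i j * crd x j)) = (\<Sum>i<M. \<Sum>j<M. y i * W i j * crd x j)"
        by (rule sum.mono_neutral_cong_left) (use KM in \<open>auto simp: y_def sum_distrib_left mult.assoc\<close>)
      also have "\<dots> \<le> D * (L2_set y {..<M} * L2_set (crd x) {..<M})" using bil[where y = y and K = M and x = "crd x"] by simp
      also have "L2_set y {..<M} = S"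
        unfolding S_def L2_set_def
        by (rule arg_cong[of _ _ sqrt], rule sum.mono_neutral_cong_right) (use KM in \<open>auto simp: y_def\<close>)
      also have "D * (S * L2_set (crd x) {..<M}) \<le> D * (S * norm x)"
        by (intro mult_left_mono L2_set_crd_le S D)
      finally show "(\<Sum>i<K. f x i * (\<Sum>j<M. W i j * crd x j)) \<le> D * (S * norm x)" .
    qed
    ultimately have "(\<Sum>i<K. f x i * f x i) \<le> D * (S * norm x)" by (rule tendsto_upperbound) simp
    then have "S * S \<le> (D * norm x) * S" using S(2) by (simp add: power2_eq_square mult_ac)
    then show ?thesis using S(1) D unfolding S_def[symmetric] by (cases "S = 0") auto
  qed
  have f_sq: "(\<Sum>i<K. (f x i)\<^sup>2) \<le> (D * norm x)\<^sup>2" for x K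
  proof -
    have "(L2_set (f x) {..<K})\<^sup>2 \<le> (D * norm x)\<^sup>2" by (intro power_mono f_bound L2_set_nonneg)
    then show ?thesis by (simp add: L2_set_def sum_nonneg)
  qed
  have f_sum: "summable (\<lambda>i. (f x i)\<^sup>2)" for x
    using f_sq by (intro summableI_nonneg_bounded[of _ "(D * norm x)\<^sup>2"]) auto
  define B where "B x = Abs_l2 (f x)" for x
  have crdB: "crd (B x) i = f x i" for x i unfolding B_def using f_sum by (simp add: Abs_l2_inverse)
  have lin: "linear B"
  proof (rule linearI)
    show "B (x + y) = B x + B y" for x y
    proof (rule l2_eqI)
      fix i
      show "crd (B (x + y)) i = crd (B x + B y) i"
        using sums_add[OF f_sums[of i x] f_sums[of i y]] f_sums[of i "x + y"]
        by (simp add: crdB algebra_simps sums_unique2)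
    qed
    show "B (r *\<^sub>R x) = r *\<^sub>R B x" for r x
    proof (rule l2_eqI)
      fix i
      show "crd (B (r *\<^sub>R x)) i = crd (r *\<^sub>R B x) i"
        using sums_mult[OF f_sums[of i x], of r] f_sums[of i "r *\<^sub>R x"]
        by (simp add: crdB algebra_simps sums_unique2)
    qed
  qed
  have bdd: "norm (B x) \<le> D * norm x" for x
  proof -
    have "(\<lambda>i. (f x i)\<^sup>2) sums (norm (B x))\<^sup>2"
      using norm_l2_sums[of "B x"] unfolding crdB .
    then have "(norm (B x))\<^sup>2 = (\<Sum>i. (f x i)\<^sup>2)" by (rule sums_unique)
    also have "\<dots> \<le> (D * norm x)\<^sup>2" by (rule suminf_le_const[OF f_sum f_sq])
    finally have "(norm (B x))\<^sup>2 \<le> (D * norm x)\<^sup>2" .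
    then show ?thesis by (rule power2_le_imp_le) (simp add: D)
  qed
  have bl: "bounded_linear B"
  proof (rule bounded_linear_intro)
    show "norm (B x) \<le> norm x * D" for x using bdd[of x] by (simp only: mult.commute)
  qed (simp_all add: linear_add[OF lin] linear_scale[OF lin])
  \<comment> \<open>On truncations both pairings are finite double sums, where the symmetry of
    \<open>W\<close> applies; continuity of \<open>B\<close> carries it to the limit.\<close>
  have Bt: "B (trunc M x) \<bullet> trunc M y = (\<Sum>i<M. \<Sum>j<M. crd y i * W i j * crd x j)" for M x y
  proof -
    have "f (trunc M x) i = (\<Sum>j<M. W i j * crd x j)" for i
      unfolding f_def by (subst suminf_finite[of "{..<M}"]) (auto simp: crd_trunc)
    then show ?thesis
      unfolding trunc_def[of M y] by (simp add: inner_sum_right crdB sum_distrib_left mult_ac)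
  qed
  have "B x \<bullet> y = x \<bullet> B y" for x y
  proof -
    have "(\<lambda>M. B (trunc M x) \<bullet> trunc M y) \<longlonglongrightarrow> B x \<bullet> y" "(\<lambda>M. B (trunc M y) \<bullet> trunc M x) \<longlonglongrightarrow> B y \<bullet> x"
      by (intro tendsto_inner bounded_linear.tendsto[OF bl] trunc_tendsto)+
    moreover have "B (trunc M x) \<bullet> trunc M y = B (trunc M y) \<bullet> trunc M x" for M
      unfolding Bt by (subst sum.swap) (intro sum.cong refl, simp add: sym mult.commute mult.left_commute)
    ultimately show ?thesis by (simp add: LIMSEQ_unique inner_commute[of x])
  qed
  then show ?thesis using that[OF lin bdd] f_sums crdB by simp
qed

section \<open>Hermite functions\<close>

text \<open>The class contains polynomials, is closed under products, translations and
  antiderivatives, and has integrable products with continuous functions of rapid decay when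
  continuous itself. Solutions can be placed in it before anything is known about their
  decay.\<close>

definition exp_bounded :: "(real \<Rightarrow> real) \<Rightarrow> bool" where
  "exp_bounded f \<longleftrightarrow> (\<exists>C k. \<forall>x. \<bar>f x\<bar> \<le> C * exp (k * \<bar>x\<bar>))"

definition rapid_decay :: "(real \<Rightarrow> real) \<Rightarrow> bool" where
  "rapid_decay f \<longleftrightarrow> (\<forall>k. \<exists>C. \<forall>x. \<bar>f x\<bar> \<le> C * exp (- k * \<bar>x\<bar>))"

lemma exp_boundedI: "(\<And>x. \<bar>f x\<bar> \<le> C * exp (k * \<bar>x\<bar>)) \<Longrightarrow> exp_bounded f"
  unfolding exp_bounded_def by blast

lemma exp_boundedE:
  assumes "exp_bounded f"
  obtains C k where "C \<ge> 0" "k \<ge> 0" "\<And>x. \<bar>f x\<bar> \<le> C * exp (k * \<bar>x\<bar>)"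
proof -
  obtain C k where C: "\<And>x. \<bar>f x\<bar> \<le> C * exp (k * \<bar>x\<bar>)"
    using assms unfolding exp_bounded_def by blast
  have "\<bar>f x\<bar> \<le> \<bar>C\<bar> * exp (\<bar>k\<bar> * \<bar>x\<bar>)" for x
  proof -
    have "C * exp (k * \<bar>x\<bar>) \<le> \<bar>C\<bar> * exp (\<bar>k\<bar> * \<bar>x\<bar>)"
      by (intro mult_mono) (auto intro: mult_right_mono)
    then show ?thesis using C[of x] by linarith
  qed
  then show ?thesis using that[of "\<bar>C\<bar>" "\<bar>k\<bar>"] by simp
qed

lemma exp_bounded_const [simp, intro]: "exp_bounded (\<lambda>_. c)"
  by (rule exp_boundedI[of _ "\<bar>c\<bar>" 0]) simp

lemma abs_le_exp_abs: "\<bar>x\<bar> \<le> exp \<bar>x::real\<bar>"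
  using exp_ge_add_one_self[of "\<bar>x\<bar>"] by linarith

lemma exp_bounded_ident [simp, intro]: "exp_bounded (\<lambda>x. x)"
  using abs_le_exp_abs by (intro exp_boundedI[of _ 1 1]) simp

lemma exp_bounded_add [intro]:
  assumes "exp_bounded f" "exp_bounded g"
  shows "exp_bounded (\<lambda>x. f x + g x)"
proof -
  obtain C k where C: "C \<ge> 0" "k \<ge> 0" "\<And>x. \<bar>f x\<bar> \<le> C * exp (k * \<bar>x\<bar>)"
    using exp_boundedE[OF assms(1)] by metis
  obtain D l where D: "D \<ge> 0" "l \<ge> 0" "\<And>x. \<bar>g x\<bar> \<le> D * exp (l * \<bar>x\<bar>)"
    using exp_boundedE[OF assms(2)] by metis
  show ?thesis
  proof (rule exp_boundedI)
    fix x :: real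
    have "C * exp (k * \<bar>x\<bar>) \<le> C * exp ((k + l) * \<bar>x\<bar>)" "D * exp (l * \<bar>x\<bar>) \<le> D * exp ((k + l) * \<bar>x\<bar>)"
      using C D by (intro mult_left_mono; simp add: mult_right_mono)+
    then show "\<bar>f x + g x\<bar> \<le> (C + D) * exp ((k + l) * \<bar>x\<bar>)"
      using C(3)[of x] D(3)[of x] abs_triangle_ineq[of "f x" "g x"] unfolding distrib_right[of C D] by linarith
  qed
qed

lemma exp_bounded_mult [intro]:
  assumes "exp_bounded f" "exp_bounded g"
  shows "exp_bounded (\<lambda>x. f x * g x)"
proof -
  obtain C k where C: "C \<ge> 0" "k \<ge> 0" "\<And>x. \<bar>f x\<bar> \<le> C * exp (k * \<bar>x\<bar>)"
    using exp_boundedE[OF assms(1)] by metis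
  obtain D l where D: "D \<ge> 0" "l \<ge> 0" "\<And>x. \<bar>g x\<bar> \<le> D * exp (l * \<bar>x\<bar>)"
    using exp_boundedE[OF assms(2)] by metis
  show ?thesis
  proof (rule exp_boundedI)
    fix x :: real
    have "\<bar>f x * g x\<bar> \<le> (C * exp (k * \<bar>x\<bar>)) * (D * exp (l * \<bar>x\<bar>))"
      unfolding abs_mult using C D by (intro mult_mono) auto
    then show "\<bar>f x * g x\<bar> \<le> (C * D) * exp ((k + l) * \<bar>x\<bar>)"
      by (simp only: distrib_right[of k l] exp_add mult.assoc mult.left_commute[of D])
  qed
qed

lemma exp_bounded_uminus [intro]: "exp_bounded f \<Longrightarrow> exp_bounded (\<lambda>x. - f x)"
  unfolding exp_bounded_def by simp

lemma exp_bounded_diff [intro]: "exp_bounded f \<Longrightarrow> exp_bounded g \<Longrightarrow> exp_bounded (\<lambda>x. f x - g x)"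
  using exp_bounded_add[OF _ exp_bounded_uminus, of f g] by simp

lemma exp_bounded_power2 [intro]: "exp_bounded f \<Longrightarrow> exp_bounded (\<lambda>x. (f x)\<^sup>2)"
  unfolding power2_eq_square by (rule exp_bounded_mult)

lemma exp_bounded_divide [intro]: "exp_bounded f \<Longrightarrow> exp_bounded (\<lambda>x. f x / c)"
  using exp_bounded_mult[OF exp_bounded_const[of "inverse c"], of f] by (simp add: field_simps)

lemma exp_bounded_shift [intro]:
  assumes "exp_bounded f"
  shows "exp_bounded (\<lambda>x. f (x + c))"
proof -
  obtain C k where C: "C \<ge> 0" "k \<ge> 0" "\<And>x. \<bar>f x\<bar> \<le> C * exp (k * \<bar>x\<bar>)"
    using exp_boundedE[OF assms] by metis
  show ?thesis
  proof (rule exp_boundedI)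
    fix x
    have "\<bar>f (x + c)\<bar> \<le> C * exp (k * \<bar>x + c\<bar>)" by (rule C)
    also have "\<dots> \<le> C * exp (k * (\<bar>x\<bar> + \<bar>c\<bar>))"
      using C by (intro mult_left_mono) (auto intro: mult_left_mono)
    also have "\<dots> = (C * exp (k * \<bar>c\<bar>)) * exp (k * \<bar>x\<bar>)" by (simp add: distrib_left exp_add)
    finally show "\<bar>f (x + c)\<bar> \<le> (C * exp (k * \<bar>c\<bar>)) * exp (k * \<bar>x\<bar>)" .
  qed
qed

lemma rapid_decayE:
  assumes "rapid_decay f"
  obtains C where "C \<ge> 0" "\<And>x. \<bar>f x\<bar> \<le> C * exp (- k * \<bar>x\<bar>)"
proof -
  obtain C where C: "\<And>x. \<bar>f x\<bar> \<le> C * exp (- k * \<bar>x\<bar>)"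
    using assms unfolding rapid_decay_def by blast
  have "0 \<le> C" using C[of 0] by simp
  then show ?thesis using that C by blast
qed

lemma rapid_decay_add [intro]:
  assumes "rapid_decay f" "rapid_decay g"
  shows "rapid_decay (\<lambda>x. f x + g x)"
  unfolding rapid_decay_def
proof
  fix k
  obtain C where C: "\<And>x. \<bar>f x\<bar> \<le> C * exp (- k * \<bar>x\<bar>)" using rapid_decayE[OF assms(1)] by metis
  obtain D where D: "\<And>x. \<bar>g x\<bar> \<le> D * exp (- k * \<bar>x\<bar>)" using rapid_decayE[OF assms(2)] by metis
  have "\<bar>f x + g x\<bar> \<le> (C + D) * exp (- k * \<bar>x\<bar>)" for x
    using C[of x] D[of x] abs_triangle_ineq[of "f x" "g x"] unfolding distrib_right[of C D] by linarith
  then show "\<exists>C. \<forall>x. \<bar>f x + g x\<bar> \<le> C * exp (- k * \<bar>x\<bar>)" by blast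
qed

lemma rapid_decay_mult [intro]:
  assumes "exp_bounded f" "rapid_decay g"
  shows "rapid_decay (\<lambda>x. f x * g x)"
  unfolding rapid_decay_def
proof
  fix k
  obtain C l where C: "C \<ge> 0" "l \<ge> 0" "\<And>x. \<bar>f x\<bar> \<le> C * exp (l * \<bar>x\<bar>)"
    using exp_boundedE[OF assms(1)] by metis
  obtain D where D: "D \<ge> 0" "\<And>x. \<bar>g x\<bar> \<le> D * exp (- (k + l) * \<bar>x\<bar>)"
    using rapid_decayE[OF assms(2)] by metis
  have "\<bar>f x * g x\<bar> \<le> (C * D) * exp (- k * \<bar>x\<bar>)" for x
  proof -
    have "\<bar>f x * g x\<bar> \<le> (C * exp (l * \<bar>x\<bar>)) * (D * exp (- (k + l) * \<bar>x\<bar>))"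
      unfolding abs_mult using C D by (intro mult_mono) auto
    also have "\<dots> = (C * D) * (exp (l * \<bar>x\<bar>) * exp (- (k + l) * \<bar>x\<bar>))" by simp
    also have "exp (l * \<bar>x\<bar>) * exp (- (k + l) * \<bar>x\<bar>) = exp (- k * \<bar>x\<bar>)"
      by (simp add: exp_add[symmetric] algebra_simps)
    finally show ?thesis .
  qed
  then show "\<exists>C. \<forall>x. \<bar>f x * g x\<bar> \<le> C * exp (- k * \<bar>x\<bar>)" by blast
qed

lemma rapid_decay_zero [simp, intro]: "rapid_decay (\<lambda>_. 0)"
  unfolding rapid_decay_def by (auto intro: exI[of _ 0])

lemma rapid_decay_uminus [intro]: "rapid_decay f \<Longrightarrow> rapid_decay (\<lambda>x. - f x)"
  unfolding rapid_decay_def by simp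

lemma rapid_decay_diff [intro]: "rapid_decay f \<Longrightarrow> rapid_decay g \<Longrightarrow> rapid_decay (\<lambda>x. f x - g x)"
  using rapid_decay_add[OF _ rapid_decay_uminus, of f g] by simp

lemma rapid_decay_divide [intro]: "rapid_decay f \<Longrightarrow> rapid_decay (\<lambda>x. f x / c)"
  using rapid_decay_mult[OF exp_bounded_const[of "inverse c"], of f] by (simp add: field_simps)

lemma rapid_imp_exp_bounded: "rapid_decay f \<Longrightarrow> exp_bounded f"
  unfolding rapid_decay_def exp_bounded_def by (metis)

lemma rapid_decay_shift [intro]:
  assumes "rapid_decay f"
  shows "rapid_decay (\<lambda>x. f (x + c))"
  unfolding rapid_decay_def
proof
  fix k :: real
  obtain C where C: "C \<ge> 0" "\<And>x. \<bar>f x\<bar> \<le> C * exp (- \<bar>k\<bar> * \<bar>x\<bar>)" using rapid_decayE[OF assms] by metis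
  have "\<bar>f (x + c)\<bar> \<le> (C * exp (\<bar>k\<bar> * \<bar>c\<bar>)) * exp (- k * \<bar>x\<bar>)" for x
  proof -
    have "\<bar>f (x + c)\<bar> \<le> C * exp (- \<bar>k\<bar> * \<bar>x + c\<bar>)" by (rule C)
    also have "\<dots> \<le> C * exp (\<bar>k\<bar> * \<bar>c\<bar> + - k * \<bar>x\<bar>)"
    proof -
      have "\<bar>k\<bar> * \<bar>x\<bar> \<le> \<bar>k\<bar> * (\<bar>x + c\<bar> + \<bar>c\<bar>)" by (intro mult_left_mono) auto
      moreover have "k * \<bar>x\<bar> \<le> \<bar>k\<bar> * \<bar>x\<bar>" by (intro mult_right_mono) auto
      ultimately show ?thesis using C(1) by (intro mult_left_mono) (auto simp: distrib_left)
    qed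
    also have "\<dots> = (C * exp (\<bar>k\<bar> * \<bar>c\<bar>)) * exp (- k * \<bar>x\<bar>)" by (simp only: exp_add mult.assoc)
    finally show ?thesis .
  qed
  then show "\<exists>C. \<forall>x. \<bar>f (x + c)\<bar> \<le> C * exp (- k * \<bar>x\<bar>)" by blast
qed

lemma integrable_inverse_1_plus_sq: "integrable lborel (\<lambda>x::real. inverse (1 + x\<^sup>2))"
  using integrable_inverse_1_plus_square by (simp add: set_integrable_def einterval_def)

lemma exp_minus_abs_le: "exp (- \<bar>x\<bar>) \<le> 2 * inverse (1 + (x::real)\<^sup>2)"
proof -
  have "(1 + x\<^sup>2) / 2 \<le> exp \<bar>x\<bar>"
    using exp_lower_Taylor_quadratic[of "\<bar>x\<bar>"] by (simp add: field_simps)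
  moreover have "0 < 1 + x\<^sup>2" by (simp add: add_pos_nonneg)
  ultimately show ?thesis by (simp add: exp_minus field_simps)
qed

lemma integrable_exp_minus_abs: "integrable lborel (\<lambda>x::real. exp (- \<bar>x\<bar>))"
  by (rule Bochner_Integration.integrable_bound[OF integrable_mult_right[OF integrable_inverse_1_plus_sq, of 2]])
     (use exp_minus_abs_le in auto)

lemma rapid_decay_integrable:
  assumes "rapid_decay f" "continuous_on UNIV f"
  shows "integrable lborel f"
proof -
  obtain C where C: "C \<ge> 0" "\<And>x. \<bar>f x\<bar> \<le> C * exp (- 1 * \<bar>x\<bar>)" using rapid_decayE[OF assms(1)] by metis
  show ?thesis
  proof (rule Bochner_Integration.integrable_bound[OF integrable_mult_right[OF integrable_exp_minus_abs, of C]])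
    show "f \<in> borel_measurable lborel"
      using assms(2) by (simp add: borel_measurable_continuous_onI)
    show "AE x in lborel. norm (f x) \<le> norm (C * exp (- \<bar>x\<bar>))" using C by auto
  qed
qed

lemma rapid_decay_tendsto:
  assumes "rapid_decay f"
  shows "(f \<longlongrightarrow> 0) at_top" "(f \<longlongrightarrow> 0) at_bot"
proof -
  obtain C where C: "C \<ge> 0" "\<And>x. \<bar>f x\<bar> \<le> C * exp (- 1 * \<bar>x\<bar>)" using rapid_decayE[OF assms(1)] by metis
  have l: "((\<lambda>x. C * exp (- 1 * \<bar>x\<bar>)) \<longlongrightarrow> 0) at_top" "((\<lambda>x. C * exp (- 1 * \<bar>x\<bar>)) \<longlongrightarrow> 0) at_bot"
    by real_asymp+
  have b: "\<forall>\<^sub>F x in F. norm (f x) \<le> C * exp (- 1 * \<bar>x\<bar>)" for F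
    using C(2) by (intro always_eventually) simp
  show "(f \<longlongrightarrow> 0) at_top" "(f \<longlongrightarrow> 0) at_bot"
    by (rule Lim_null_comparison[OF b l(1)], rule Lim_null_comparison[OF b l(2)])
qed

text \<open>Integration by parts without boundary terms, in the form in which it is used
  throughout.\<close>

lemma integral_derivative_rapid_decay:
  fixes F f :: "real \<Rightarrow> real"
  assumes "\<And>x. (F has_real_derivative f x) (at x)" "continuous_on UNIV f" "rapid_decay f" "rapid_decay F"
  shows "integral\<^sup>L lborel f = 0"
proof -
  have int: "integrable lborel f" using assms by (intro rapid_decay_integrable)
  have "(LBINT x=-\<infinity>..\<infinity>. f x) = 0 - 0"
  proof (rule interval_integral_FTC_integrable)
    show "(F has_vector_derivative f x) (at x)" for x
      using assms(1) by (simp add: has_real_derivative_iff_has_vector_derivative)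
    show "isCont f x" for x using assms(2) by (simp add: continuous_on_eq_continuous_at)
    show "set_integrable lborel (einterval (- \<infinity>) \<infinity>) f"
      using int by (simp add: set_integrable_def einterval_def)
    show "((F \<circ> real_of_ereal) \<longlongrightarrow> 0) (at_right (- \<infinity>))" "((F \<circ> real_of_ereal) \<longlongrightarrow> 0) (at_left \<infinity>)"
      using rapid_decay_tendsto[OF assms(4)] by (simp_all add: ereal_tendsto_simps)
  qed simp
  then show ?thesis by (simp add: interval_lebesgue_integral_def set_lebesgue_integral_def einterval_def)
qed

section \<open>Hermite functions: recurrence, ladder relations, orthonormality, size\<close>

text \<open>The normalised Hermite functions by their three-term recurrence. At n = 0 the truncated
  index \<open>n - 1\<close> repeats 0, but its factor \<open>sqrt n\<close> vanishes.\<close>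

fun herm :: "nat \<Rightarrow> real \<Rightarrow> real" where
  "herm 0 x = exp (- x\<^sup>2 / 2) / sqrt (sqrt pi)"
| "herm (Suc n) x = (sqrt 2 * x * herm n x - sqrt n * herm (n - 1) x) / sqrt (real (Suc n))"

declare herm.simps [simp del]

lemma herm_Suc: "sqrt (real (Suc n)) * herm (Suc n) x = sqrt 2 * x * herm n x - sqrt n * herm (n - 1) x"
  by (simp add: herm.simps)

text \<open>The lowering relation serves as the definition of the derivative, so that
  differentiation becomes algebra in the functions \<open>herm\<close>.\<close>

definition dherm :: "nat \<Rightarrow> real \<Rightarrow> real" where
  "dherm n x = sqrt (2 * real n) * herm (n - 1) x - x * herm n x"

lemma DERIV_herm: "(herm n has_real_derivative dherm n x) (at x)"
proof (induction n rule: less_induct)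
  case (less n)
  show ?case
  proof (cases n)
    case 0
    have eq: "herm 0 = (\<lambda>x. inverse (sqrt (sqrt pi)) * exp (- x\<^sup>2 / 2))"
      by (auto simp: herm.simps field_simps)
    have "((\<lambda>x. inverse (sqrt (sqrt pi)) * exp (- x\<^sup>2 / 2)) has_real_derivative
        inverse (sqrt (sqrt pi)) * (exp (- x\<^sup>2 / 2) * - x)) (at x)"
      by (rule DERIV_cmult) (auto intro!: derivative_eq_intros)
    then show ?thesis unfolding 0 dherm_def eq by (simp add: mult_ac)
  next
    case (Suc m)
    have d: "(herm m has_real_derivative dherm m x) (at x)" "(herm (m - 1) has_real_derivative dherm (m - 1) x) (at x)"
      using less[of m] less[of "m - 1"] Suc by auto
    have eq: "herm (Suc m) = (\<lambda>x. inverse (sqrt (real (Suc m))) * (sqrt 2 * x * herm m x - sqrt m * herm (m - 1) x))"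
      by (auto simp: herm.simps field_simps)
    have "((\<lambda>x. sqrt 2 * x * herm m x - sqrt m * herm (m - 1) x) has_real_derivative
        (sqrt 2 * herm m x + sqrt 2 * x * dherm m x - sqrt m * dherm (m - 1) x)) (at x)"
      by (rule derivative_eq_intros d refl | simp)+
    then have "(herm (Suc m) has_real_derivative inverse (sqrt (real (Suc m))) *
        (sqrt 2 * herm m x + sqrt 2 * x * dherm m x - sqrt m * dherm (m - 1) x)) (at x)"
      unfolding eq by (rule DERIV_cmult)
    moreover have "(sqrt 2 * herm m x + sqrt 2 * x * dherm m x - sqrt m * dherm (m - 1) x) = sqrt (real (Suc m)) * dherm (Suc m) x"
    proof -
      have r1: "sqrt (real (Suc m)) * (sqrt (2 * real (Suc m)) * herm m x) = sqrt 2 * (real m + 1) * herm m x"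
      proof -
        have "sqrt (real (Suc m)) * (sqrt (2 * real (Suc m)) * herm m x) = sqrt 2 * (sqrt (real (Suc m)) * sqrt (real (Suc m))) * herm m x"
          unfolding real_sqrt_mult[of 2] by (simp only: mult_ac)
        also have "sqrt (real (Suc m)) * sqrt (real (Suc m)) = real m + 1" by simp
        finally show ?thesis .
      qed
      have r2: "sqrt (real (Suc m)) * (x * herm (Suc m) x) = x * (sqrt 2 * x * herm m x - sqrt m * herm (m - 1) x)"
        unfolding herm_Suc[symmetric] by (simp add: algebra_simps)
      have r3: "sqrt m * (sqrt (2 * real (m - 1)) * herm (m - 1 - 1) x) = sqrt 2 * sqrt m * (sqrt 2 * x * herm (m - 1) x - sqrt m * herm m x)"
      proof (cases m)
        case (Suc k)
        then show ?thesis using herm_Suc[of k x] by (simp add: real_sqrt_mult)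
      qed simp
      have e1: "sqrt (real (Suc m)) * dherm (Suc m) x
        = sqrt 2 * (real m + 1) * herm m x - x * (sqrt 2 * x * herm m x - sqrt m * herm (m - 1) x)"
        unfolding dherm_def right_diff_distrib r2 using r1 by simp
      have e2: "sqrt m * dherm (m - 1) x = sqrt 2 * sqrt m * (sqrt 2 * x * herm (m - 1) x - sqrt m * herm m x) - sqrt m * (x * herm (m - 1) x)"
        unfolding dherm_def right_diff_distrib r3 by simp
      have e3: "dherm m x = sqrt 2 * sqrt m * herm (m - 1) x - x * herm m x"
        by (simp add: dherm_def real_sqrt_mult)
      \<comment> \<open>Used with q = \<open>sqrt 2\<close> and a = \<open>sqrt m\<close>. As a
        polynomial identity it spares the simplifier any arithmetic of square roots.\<close>
      have aux: "q * h + q * x * (q * a * g - x * h) - (q * a * (q * x * g - a * h) - a * (x * g))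
          = q * (a * a + 1) * h - x * (q * x * h - a * g)" for q a h g x :: real
        by (simp add: algebra_simps)
      have m: "real m = sqrt m * sqrt m" by simp
      show ?thesis unfolding e1 e2 e3 using aux[of "sqrt 2" "herm m x" x "sqrt m" "herm (m - 1) x"]
        unfolding m[symmetric] .
    qed
    ultimately have "(herm (Suc m) has_real_derivative
        inverse (sqrt (real (Suc m))) * (sqrt (real (Suc m)) * dherm (Suc m) x)) (at x)"
      by (simp only:)
    also have "inverse (sqrt (real (Suc m))) * (sqrt (real (Suc m)) * dherm (Suc m) x) = dherm (Suc m) x"
      by (simp del: of_nat_Suc)
    finally show ?thesis unfolding Suc .
  qed
qed

lemma dherm_alt: "dherm n x = x * herm n x - sqrt (2 * real (Suc n)) * herm (Suc n) x"
proof -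
  have "sqrt (2 * real (Suc n)) * herm (Suc n) x = sqrt 2 * (sqrt (real (Suc n)) * herm (Suc n) x)"
    by (simp only: real_sqrt_mult[of 2] mult.assoc)
  also have "\<dots> = 2 * x * herm n x - sqrt (2 * real n) * herm (n - 1) x"
    unfolding herm_Suc by (simp add: real_sqrt_mult algebra_simps)
  finally show ?thesis by (simp add: dherm_def)
qed

text \<open>The oscillator equation, obtained by differentiating the lowering relation and then
  applying the raising form \<open>dherm_alt\<close> at the index below.\<close>

lemma DERIV_dherm: "(dherm n has_real_derivative (x\<^sup>2 - (2 * real n + 1)) * herm n x) (at x)"
proof -
  have d: "(dherm n has_real_derivative sqrt (2 * real n) * dherm (n - 1) x - (herm n x + x * dherm n x)) (at x)"
  proof -
    have eq: "dherm n = (\<lambda>x. sqrt (2 * real n) * herm (n - 1) x - x * herm n x)"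
      by (auto simp: dherm_def)
    show ?thesis by (subst eq) (rule derivative_eq_intros DERIV_herm refl | simp)+
  qed
  moreover have "sqrt (2 * real n) * dherm (n - 1) x = sqrt (2 * real n) * (x * herm (n - 1) x) - 2 * real n * herm n x"
    by (cases n) (simp_all add: dherm_alt right_diff_distrib)
  ultimately have "sqrt (2 * real n) * dherm (n - 1) x - (herm n x + x * dherm n x) = (x\<^sup>2 - (2 * real n + 1)) * herm n x"
    by (simp add: dherm_def[of n] algebra_simps power2_eq_square)
  with d show ?thesis by simp
qed

lemma rapid_decay_herm: "rapid_decay (herm n)"
proof (induction n rule: less_induct)
  case (less n)
  show ?case
  proof (cases n)
    case 0
    show ?thesis unfolding rapid_decay_def
    proof
      fix k :: real
      have "\<bar>herm 0 x\<bar> \<le> (exp (k\<^sup>2 / 2) / sqrt (sqrt pi)) * exp (- k * \<bar>x\<bar>)" for x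
      proof -
        \<comment> \<open>Completing the square in the exponent; this is the origin of the constant
          exp (k^2 / 2).\<close>
        have "0 \<le> (k - \<bar>x\<bar>)\<^sup>2" by simp
        then have "- x\<^sup>2 / 2 \<le> k\<^sup>2 / 2 + - k * \<bar>x\<bar>" by (simp add: power2_diff)
        then have "exp (- x\<^sup>2 / 2) \<le> exp (k\<^sup>2 / 2) * exp (- k * \<bar>x\<bar>)"
          by (simp only: exp_add[symmetric] exp_le_cancel_iff)
        then show ?thesis by (simp add: herm.simps divide_right_mono)
      qed
      then show "\<exists>C. \<forall>x. \<bar>herm n x\<bar> \<le> C * exp (- k * \<bar>x\<bar>)" unfolding 0 by blast
    qed
  next
    case (Suc m)
    have "rapid_decay (herm m)" "rapid_decay (herm (m - 1))" using less[of m] less[of "m - 1"] Suc by auto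
    then have "rapid_decay (\<lambda>x. (sqrt 2 * x * herm m x - sqrt m * herm (m - 1) x) / sqrt (real (Suc m)))"
      by (intro rapid_decay_divide rapid_decay_diff rapid_decay_mult exp_bounded_mult) auto
    then show ?thesis unfolding Suc by (simp add: herm.simps)
  qed
qed

lemma continuous_herm: "continuous_on A (herm n)"
  using DERIV_herm by (meson DERIV_continuous continuous_at_imp_continuous_on)

lemma rapid_decay_dherm: "rapid_decay (dherm n)"
  unfolding dherm_def by (intro rapid_decay_diff rapid_decay_mult rapid_decay_herm) auto

lemma continuous_dherm: "continuous_on A (dherm n)"
  using DERIV_dherm by (meson DERIV_continuous continuous_at_imp_continuous_on)

lemma exp_bounded_herm: "exp_bounded (herm n)"
  by (intro rapid_imp_exp_bounded rapid_decay_herm)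

lemma integrable_mult_herm:
  assumes "continuous_on UNIV f" "exp_bounded f"
  shows "integrable lborel (\<lambda>x. f x * herm n x)"
  using assms by (intro rapid_decay_integrable rapid_decay_mult rapid_decay_herm continuous_intros continuous_herm)

text \<open>Green's identity on the line: v h' - v' h has rapid decay, so its derivative integrates
  to 0. Exponential growth of \<open>v\<close> and its derivatives is enough.\<close>

lemma herm_weak_second_derivative:
  fixes v v' v'' :: "real \<Rightarrow> real"
  assumes "\<And>x. (v has_real_derivative v' x) (at x)" "\<And>x. (v' has_real_derivative v'' x) (at x)"
    and "continuous_on UNIV v''" "exp_bounded v" "exp_bounded v'" "exp_bounded v''"
  shows "(LBINT x. v x * ((x\<^sup>2 - (2 * real n + 1)) * herm n x)) = (LBINT x. v'' x * herm n x)"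
proof -
  have cv: "continuous_on UNIV v" using assms(1) by (meson DERIV_continuous continuous_at_imp_continuous_on)
  have "integral\<^sup>L lborel (\<lambda>x. v x * ((x\<^sup>2 - (2 * real n + 1)) * herm n x) - v'' x * herm n x) = 0"
  proof (rule integral_derivative_rapid_decay)
    show "((\<lambda>x. v x * dherm n x - v' x * herm n x) has_real_derivative
        v x * ((x\<^sup>2 - (2 * real n + 1)) * herm n x) - v'' x * herm n x) (at x)" for x
      by (rule derivative_eq_intros assms(1,2) DERIV_herm DERIV_dherm refl | simp)+
    show "rapid_decay (\<lambda>x. v x * dherm n x - v' x * herm n x)"
      by (intro rapid_decay_diff rapid_decay_mult assms rapid_decay_herm rapid_decay_dherm)
    show "rapid_decay (\<lambda>x. v x * ((x\<^sup>2 - (2 * real n + 1)) * herm n x) - v'' x * herm n x)"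
      by (intro rapid_decay_diff rapid_decay_mult assms rapid_decay_herm exp_bounded_diff exp_bounded_power2) auto
    show "continuous_on UNIV (\<lambda>x. v x * ((x\<^sup>2 - (2 * real n + 1)) * herm n x) - v'' x * herm n x)"
      by (intro continuous_intros cv assms continuous_herm)
  qed
  moreover have "integrable lborel (\<lambda>x. (v x * (x\<^sup>2 - (2 * real n + 1))) * herm n x)"
    by (intro integrable_mult_herm continuous_intros cv exp_bounded_mult assms exp_bounded_diff exp_bounded_power2) auto
  ultimately show ?thesis
    using integrable_mult_herm[OF assms(3,6), of n] by (simp add: mult.assoc)
qed

lemma integrable_herm_mult: "integrable lborel (\<lambda>x. herm m x * herm n x)"
  by (intro integrable_mult_herm continuous_herm exp_bounded_herm)

text \<open>Green's identity between two eigenfunctions of the oscillator with different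
  eigenvalues.\<close>

lemma herm_orthogonal:
  assumes "m \<noteq> n"
  shows "(LBINT x. herm m x * herm n x) = 0"
proof -
  have e: "exp_bounded (dherm m)" "exp_bounded (\<lambda>x. (x\<^sup>2 - (2 * real m + 1)) * herm m x)"
    using rapid_imp_exp_bounded[OF rapid_decay_dherm]
    by (auto intro!: exp_bounded_mult exp_bounded_diff exp_bounded_power2 exp_bounded_herm)
  have c: "continuous_on UNIV (\<lambda>x. (x\<^sup>2 - (2 * real m + 1)) * herm m x)"
    by (intro continuous_intros continuous_herm)
  have i: "integrable lborel (\<lambda>x. (x\<^sup>2 * herm m x) * herm n x)"
    by (intro integrable_mult_herm continuous_intros continuous_herm exp_bounded_mult exp_bounded_power2 exp_bounded_herm) auto
  have "(LBINT x. herm m x * ((x\<^sup>2 - (2 * real n + 1)) * herm n x)) = (LBINT x. ((x\<^sup>2 - (2 * real m + 1)) * herm m x) * herm n x)"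
    by (rule herm_weak_second_derivative[OF DERIV_herm DERIV_dherm c exp_bounded_herm e])
  moreover have "(LBINT x. herm m x * ((x\<^sup>2 - (2 * real n + 1)) * herm n x))
      = (LBINT x. (x\<^sup>2 * herm m x) * herm n x - (2 * real n + 1) * (herm m x * herm n x))"
    by (intro Bochner_Integration.integral_cong) (auto simp: algebra_simps)
  moreover have "(LBINT x. ((x\<^sup>2 - (2 * real m + 1)) * herm m x) * herm n x)
      = (LBINT x. (x\<^sup>2 * herm m x) * herm n x - (2 * real m + 1) * (herm m x * herm n x))"
    by (intro Bochner_Integration.integral_cong) (auto simp: algebra_simps)
  ultimately have "(2 * real n + 1) * (LBINT x. herm m x * herm n x) = (2 * real m + 1) * (LBINT x. herm m x * herm n x)"
    using i integrable_herm_mult[of m n] by simp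
  then show ?thesis using assms by simp
qed

text \<open>Up to the factor sqrt (n + 1), the squared norm of h_(n+1) is the pairing of sqrt 2 x
  h_n with h_(n+1); letting x act on the other factor returns the squared norm of h_n with the same
  factor. The square of h_0 is the normal density of variance 1/2.\<close>

lemma herm_norm: "(LBINT x. herm n x * herm n x) = 1"
proof (induction n)
  case 0
  have "herm 0 x * herm 0 x = normal_density 0 (1 / sqrt 2) x" for x
    by (simp add: herm.simps normal_density_def exp_add[symmetric] power_divide real_sqrt_mult)
  then show ?case by simp
next
  case (Suc n)
  have i: "integrable lborel (\<lambda>x. (x * herm n x) * herm (Suc n) x)"
    by (intro integrable_mult_herm continuous_intros continuous_herm exp_bounded_mult exp_bounded_herm) auto
  have "sqrt (real (Suc n)) * (LBINT x. herm (Suc n) x * herm (Suc n) x)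
     = (LBINT x. (sqrt (real (Suc n)) * herm (Suc n) x) * herm (Suc n) x)" by (simp add: mult.assoc)
  also have "\<dots> = (LBINT x. sqrt 2 * ((x * herm n x) * herm (Suc n) x) - sqrt n * (herm (n - 1) x * herm (Suc n) x))"
    unfolding herm_Suc by (simp add: algebra_simps)
  also have "\<dots> = (LBINT x. sqrt 2 * ((x * herm n x) * herm (Suc n) x))"
    using i integrable_herm_mult herm_orthogonal[of "n - 1" "Suc n"] by simp
  also have "\<dots> = (LBINT x. sqrt (real (Suc (Suc n))) * (herm n x * herm (Suc (Suc n)) x) + sqrt (real (Suc n)) * (herm n x * herm n x))"
  proof (intro Bochner_Integration.integral_cong refl)
    fix x
    have "sqrt 2 * x * herm (Suc n) x = sqrt (real (Suc (Suc n))) * herm (Suc (Suc n)) x + sqrt (real (Suc n)) * herm n x"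
      using herm_Suc[of "Suc n" x] by simp
    then have "herm n x * (sqrt 2 * x * herm (Suc n) x) = herm n x * (sqrt (real (Suc (Suc n))) * herm (Suc (Suc n)) x + sqrt (real (Suc n)) * herm n x)"
      by (rule arg_cong)
    then show "sqrt 2 * ((x * herm n x) * herm (Suc n) x) = sqrt (real (Suc (Suc n))) * (herm n x * herm (Suc (Suc n)) x) + sqrt (real (Suc n)) * (herm n x * herm n x)"
      by (simp only: distrib_left mult_ac)
  qed
  also have "\<dots> = sqrt (real (Suc n))"
    using integrable_herm_mult Suc herm_orthogonal[of n "Suc (Suc n)"] by simp
  finally show ?case by simp
qed

lemma herm_inner: "(LBINT x. herm m x * herm n x) = (if m = n then 1 else 0)"
  using herm_norm herm_orthogonal by simp

text \<open>The mean of the lowering and raising forms. The term in x drops out, leaving orthogonal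
  summands from which the norm can be read off.\<close>

lemma dherm_ladder: "dherm n x = sqrt (real n / 2) * herm (n - 1) x - sqrt (real (Suc n) / 2) * herm (Suc n) x"
proof -
  have s: "sqrt (2 * a) = 2 * sqrt (a / 2)" for a :: real
  proof -
    have "sqrt (2 * a) = sqrt (4 * (a / 2))" by simp
    also have "\<dots> = 2 * sqrt (a / 2)" by (simp only: real_sqrt_mult real_sqrt_four)
    finally show ?thesis .
  qed
  have "2 * dherm n x = (sqrt (2 * real n) * herm (n - 1) x - x * herm n x) + (x * herm n x - sqrt (2 * real (Suc n)) * herm (Suc n) x)"
    unfolding dherm_def[of n x, symmetric] dherm_alt[of n x, symmetric] by simp
  then show ?thesis unfolding s by simp
qed

lemma dherm_norm: "(LBINT x. (dherm n x)\<^sup>2) = real n + 1 / 2"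
proof -
  have "(LBINT x. (dherm n x)\<^sup>2) = (LBINT x. real n / 2 * (herm (n - 1) x * herm (n - 1) x)
      + real (Suc n) / 2 * (herm (Suc n) x * herm (Suc n) x)
      - 2 * (sqrt (real n / 2) * sqrt (real (Suc n) / 2)) * (herm (n - 1) x * herm (Suc n) x))"
  proof (intro Bochner_Integration.integral_cong refl)
    fix x
    have "(dherm n x)\<^sup>2 = (sqrt (real n / 2) * herm (n - 1) x)\<^sup>2 + (sqrt (real (Suc n) / 2) * herm (Suc n) x)\<^sup>2
      - 2 * (sqrt (real n / 2) * herm (n - 1) x) * (sqrt (real (Suc n) / 2) * herm (Suc n) x)"
      unfolding dherm_ladder by (rule power2_diff)
    also have "(sqrt (real n / 2) * herm (n - 1) x)\<^sup>2 = real n / 2 * (herm (n - 1) x * herm (n - 1) x)"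
      unfolding power_mult_distrib by (simp add: power2_eq_square)
    also have "(sqrt (real (Suc n) / 2) * herm (Suc n) x)\<^sup>2 = real (Suc n) / 2 * (herm (Suc n) x * herm (Suc n) x)"
      unfolding power_mult_distrib by (simp add: power2_eq_square)
    finally show "(dherm n x)\<^sup>2 = real n / 2 * (herm (n - 1) x * herm (n - 1) x)
      + real (Suc n) / 2 * (herm (Suc n) x * herm (Suc n) x)
      - 2 * (sqrt (real n / 2) * sqrt (real (Suc n) / 2)) * (herm (n - 1) x * herm (Suc n) x)"
      by (simp only: mult.assoc mult.left_commute)
  qed
  also have "\<dots> = real n / 2 + real (Suc n) / 2"
    using integrable_herm_mult herm_orthogonal[of "n - 1" "Suc n"] by (simp add: herm_norm)
  finally show ?thesis by (simp add: field_simps)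
qed

text \<open>A Sobolev inequality on the line: the square is the integral of its derivative from
  minus infinity, estimated through the squared norms 1 and n + 1/2 of \<open>herm n\<close> and
  \<open>dherm n\<close>.\<close>

lemma herm_sq_le: "(herm n x)\<^sup>2 \<le> 2 * sqrt (real n + 1)"
proof -
  define s where "s = sqrt (real n + 1)"
  have s: "s > 0" "s * s = real n + 1" by (auto simp: s_def)
  have int: "integrable lborel (\<lambda>x. s * (herm n x * herm n x) + (dherm n x)\<^sup>2 / s)"
    by (intro Bochner_Integration.integrable_add integrable_mult_right integrable_herm_mult integrable_divide rapid_decay_integrable)
       (auto simp: power2_eq_square intro!: rapid_decay_mult rapid_decay_dherm rapid_imp_exp_bounded continuous_intros continuous_dherm)
  have tot: "(LBINT x. s * (herm n x * herm n x) + (dherm n x)\<^sup>2 / s) \<le> 2 * s"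
  proof -
    have i2: "integrable lborel (\<lambda>x. (dherm n x)\<^sup>2)"
      by (intro rapid_decay_integrable)
       (auto simp: power2_eq_square intro!: rapid_decay_mult rapid_decay_dherm rapid_imp_exp_bounded continuous_intros continuous_dherm)
    have "(LBINT x. s * (herm n x * herm n x) + (dherm n x)\<^sup>2 / s) = s + (real n + 1 / 2) / s"
      using i2 integrable_herm_mult[of n n] by (simp add: herm_inner dherm_norm)
    also have "\<dots> \<le> s + s * s / s" using s by (intro add_left_mono divide_right_mono) auto
    also have "s * s / s = s" using s(1) by simp
    finally show ?thesis by simp
  qed
  (* 2 h h' <= s h^2 + h'^2 / s; weighting by s gains over s = 1 the power of n that makes the
     expansions in weighted_series converge uniformly *)
  have step: "(herm n x)\<^sup>2 - (herm n y)\<^sup>2 \<le> 2 * s" if "y \<le> x" for y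
  proof -
    have "((\<lambda>t. 2 * herm n t * dherm n t) has_integral ((herm n x)\<^sup>2 - (herm n y)\<^sup>2)) {y..x}"
      using that
    proof (rule fundamental_theorem_of_calculus)
      fix t
      have "((\<lambda>t. (herm n t)\<^sup>2) has_real_derivative 2 * herm n t * dherm n t) (at t)"
        by (rule derivative_eq_intros DERIV_herm refl | simp)+
      then show "((\<lambda>t. (herm n t)\<^sup>2) has_vector_derivative 2 * herm n t * dherm n t) (at t within {y..x})"
        by (simp add: has_real_derivative_iff_has_vector_derivative has_vector_derivative_at_within)
    qed
    note i1 = this
    have i2: "((\<lambda>t. s * (herm n t * herm n t) + (dherm n t)\<^sup>2 / s) has_integral
       (LBINT t. s * (herm n t * herm n t) + (dherm n t)\<^sup>2 / s)) UNIV"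
      by (rule has_integral_integral_lborel[OF int])
    have nn: "0 \<le> s * (herm n t * herm n t) + (dherm n t)\<^sup>2 / s" for t using s by simp
    have le: "2 * herm n t * dherm n t \<le> s * (herm n t * herm n t) + (dherm n t)\<^sup>2 / s" for t
    proof -
      have "0 \<le> (s * herm n t - dherm n t)\<^sup>2 / s" using s by simp
      also have "\<dots> = s * (herm n t * herm n t) + (dherm n t)\<^sup>2 / s - 2 * herm n t * dherm n t"
        using s by (simp add: power2_eq_square field_simps)
      finally show ?thesis by simp
    qed
    have "(\<lambda>t. s * (herm n t * herm n t) + (dherm n t)\<^sup>2 / s) integrable_on {y..x}"
      using s by (intro integrable_continuous_real continuous_intros continuous_herm continuous_dherm) auto
    then obtain j where j: "((\<lambda>t. s * (herm n t * herm n t) + (dherm n t)\<^sup>2 / s) has_integral j) {y..x}"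
      by blast
    have "(herm n x)\<^sup>2 - (herm n y)\<^sup>2 \<le> j" by (rule has_integral_le[OF i1 j le])
    also have "j \<le> (LBINT t. s * (herm n t * herm n t) + (dherm n t)\<^sup>2 / s)"
      by (rule has_integral_subset_le[OF subset_UNIV j i2]) (use nn in auto)
    finally show ?thesis using tot by simp
  qed
  have "((\<lambda>y. (herm n x)\<^sup>2 - (herm n y)\<^sup>2) \<longlongrightarrow> (herm n x)\<^sup>2 - 0\<^sup>2) at_bot"
    by (intro tendsto_intros rapid_decay_tendsto rapid_decay_herm)
  moreover have "\<forall>\<^sub>F y in at_bot. (herm n x)\<^sup>2 - (herm n y)\<^sup>2 \<le> 2 * s"
    by (rule eventually_mono[OF eventually_le_at_bot[of x] step])
  ultimately have "(herm n x)\<^sup>2 - 0\<^sup>2 \<le> 2 * s"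
    by (rule tendsto_upperbound) simp
  then show ?thesis by (simp add: s_def)
qed

section \<open>Completeness of the Hermite functions\<close>

text \<open>By the recurrence, multiplication by x keeps the linear span of the Hermite functions,
  so orthogonality to all of them survives each factor x.\<close>

lemma herm_moments:
  assumes "continuous_on UNIV f" "exp_bounded f" "\<And>n. (LBINT x. f x * herm n x) = 0"
  shows "(LBINT x. (x ^ k * f x) * herm n x) = 0"
proof (induction k arbitrary: n)
  case (Suc k)
  have eb: "exp_bounded (\<lambda>x. x ^ j * f x)" for j
    by (induction j) (auto simp: mult.assoc intro!: assms exp_bounded_mult)
  have i: "integrable lborel (\<lambda>x. (x ^ j * f x) * herm m x)" for j m
    by (intro integrable_mult_herm continuous_intros assms eb)
  have "sqrt 2 * (LBINT x. (x ^ Suc k * f x) * herm n x)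
      = (LBINT x. (x ^ k * f x) * (sqrt 2 * x * herm n x))"
    by (subst Bochner_Integration.integral_mult_right_zero[symmetric]) (simp add: mult_ac)
  also have "\<dots> = (LBINT x. sqrt (real (Suc n)) * ((x ^ k * f x) * herm (Suc n) x) + sqrt n * ((x ^ k * f x) * herm (n - 1) x))"
  proof (intro Bochner_Integration.integral_cong refl)
    fix x
    have "sqrt 2 * x * herm n x = sqrt (real (Suc n)) * herm (Suc n) x + sqrt n * herm (n - 1) x"
      using herm_Suc[of n x] by simp
    then show "(x ^ k * f x) * (sqrt 2 * x * herm n x) = sqrt (real (Suc n)) * ((x ^ k * f x) * herm (Suc n) x) + sqrt n * ((x ^ k * f x) * herm (n - 1) x)"
      by (simp only: distrib_left mult_ac)
  qed
  also have "\<dots> = 0" using i Suc by simp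
  finally show ?case by simp
qed (use assms in simp)

text \<open>
  The product of $f$ with a Gaussian has vanishing moments, hence vanishing Fourier transform; by
  the L\'evy uniqueness theorem its positive and negative parts have the same distribution.
\<close>

theorem herm_complete:
  assumes cf: "continuous_on UNIV f" and eb: "exp_bounded f" and orth: "\<And>n. (LBINT x. f x * herm n x) = 0"
  shows "f x = 0"
proof -
  define F where "F x = f x * herm 0 x" for x
  have rF: "rapid_decay F" unfolding F_def by (intro rapid_decay_mult eb rapid_decay_herm)
  have cF: "continuous_on UNIV F" unfolding F_def by (intro continuous_intros cf continuous_herm)
  have iF: "integrable lborel F" by (intro rapid_decay_integrable rF cF)
  have mF: "F \<in> borel_measurable borel" using cF by (simp add: borel_measurable_continuous_onI)
  have mom: "(LBINT x. x ^ k * F x) = 0" for k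
    using herm_moments[OF cf eb orth, of k 0] by (simp add: F_def mult.assoc)
  have ipow: "integrable lborel (\<lambda>x. x ^ k * F x)" for k
  proof -
    have "exp_bounded (\<lambda>x. x ^ k)" by (induction k) (auto intro!: exp_bounded_mult)
    then show ?thesis by (intro rapid_decay_integrable rapid_decay_mult rF continuous_intros cF)
  qed
  \<comment> \<open>Each Taylor section of the exponential integrates to 0 by the moments, and exp
    (|t| |x|) |F x| dominates all sections.\<close>
  have four: "(CLBINT x. iexp (t * x) * F x) = 0" for t :: real
  proof -
    define S where "S N x = (\<Sum>n<N. (\<i> * t * x) ^ n /\<^sub>R fact n) * complex_of_real (F x)" for N and x :: real
    have Sn: "S N x = (\<Sum>n<N. ((\<i> * t) ^ n / fact n) * complex_of_real (x ^ n * F x))" for N x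
      unfolding S_def sum_distrib_right
      by (intro sum.cong refl) (simp add: scaleR_conv_of_real power_mult_distrib field_simps)
    have "(CLBINT x. S N x) = 0" for N
    proof -
      have "(CLBINT x. S N x) = (\<Sum>n<N. (CLBINT x. ((\<i> * t) ^ n / fact n) * complex_of_real (x ^ n * F x)))"
        unfolding Sn by (intro Bochner_Integration.integral_sum integrable_mult_right integrable_of_real ipow)
      also have "\<dots> = 0"
        using mom by (simp only: integral_mult_right_zero integral_complex_of_real) simp
      finally show ?thesis .
    qed
    moreover have "(\<lambda>N. CLBINT x. S N x) \<longlonglongrightarrow> (CLBINT x. iexp (t * x) * F x)"
    proof (rule integral_dominated_convergence)
      have "rapid_decay (\<lambda>x. exp (\<bar>t\<bar> * \<bar>x\<bar>) * \<bar>F x\<bar>)"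
        using rF by (intro rapid_decay_mult exp_boundedI[of _ 1 "\<bar>t\<bar>"]) (auto simp: rapid_decay_def)
      then show "integrable lborel (\<lambda>x. exp (\<bar>t\<bar> * \<bar>x\<bar>) * \<bar>F x\<bar>)"
        by (intro rapid_decay_integrable continuous_intros cF)
      show "(\<lambda>x. iexp (t * x) * F x) \<in> borel_measurable lborel" using mF by measurable
      show "S N \<in> borel_measurable lborel" for N unfolding S_def[abs_def] using mF by measurable
      show "AE x in lborel. (\<lambda>N. S N x) \<longlonglongrightarrow> iexp (t * x) * F x"
      proof (intro AE_I2)
        fix x :: real
        have "(\<lambda>n. (\<i> * t * x) ^ n /\<^sub>R fact n) sums exp (\<i> * t * x)" by (rule exp_converges)
        then show "(\<lambda>N. S N x) \<longlonglongrightarrow> iexp (t * x) * F x"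
          unfolding S_def sums_def by (intro tendsto_mult tendsto_const) (simp add: mult.assoc)
      qed
      show "AE x in lborel. norm (S N x) \<le> exp (\<bar>t\<bar> * \<bar>x\<bar>) * \<bar>F x\<bar>" for N
      proof (intro AE_I2)
        fix x :: real
        have "norm (\<Sum>n<N. (\<i> * t * x) ^ n /\<^sub>R fact n) \<le> (\<Sum>n<N. (\<bar>t\<bar> * \<bar>x\<bar>) ^ n /\<^sub>R fact n)"
          by (rule sum_norm_le) (simp add: norm_mult norm_power abs_mult)
        also have "\<dots> \<le> exp (\<bar>t\<bar> * \<bar>x\<bar>)"
          unfolding exp_def by (rule sum_le_suminf[OF summable_exp_generic]) auto
        finally show "norm (S N x) \<le> exp (\<bar>t\<bar> * \<bar>x\<bar>) * \<bar>F x\<bar>"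
          unfolding S_def norm_mult norm_of_real by (rule mult_right_mono) simp
      qed
    qed
    ultimately show ?thesis by (simp add: LIMSEQ_const_iff)
  qed
  define P where "P x = max 0 (F x)" for x
  define Q where "Q x = max 0 (- F x)" for x
  have FPQ: "F x = P x - Q x" for x by (simp add: P_def Q_def max_def)
  have mPQ: "P \<in> borel_measurable borel" "Q \<in> borel_measurable borel"
    unfolding P_def[abs_def] Q_def[abs_def] using mF by measurable
  have iPQ: "integrable lborel P" "integrable lborel Q"
    unfolding P_def[abs_def] Q_def[abs_def] using iF by (intro integrable_max; simp)+
  have nn: "0 \<le> P x" "0 \<le> Q x" for x by (simp_all add: P_def Q_def)
  define m where "m = integral\<^sup>L lborel P"
  have mQ: "m = integral\<^sup>L lborel Q"
    using mom[of 0] iPQ unfolding m_def by (simp add: FPQ[abs_def])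
  have "m = 0"
  proof (rule ccontr)
    assume m: "m \<noteq> 0"
    have "0 \<le> m" unfolding m_def by (rule integral_nonneg_AE) (simp add: P_def)
    then have mp: "m > 0" using m by simp
    define M1 where "M1 = density lborel (\<lambda>x. ennreal (P x / m))"
    define M2 where "M2 = density lborel (\<lambda>x. ennreal (Q x / m))"
    have rd: "real_distribution (density lborel (\<lambda>x. ennreal (R x / m)))"
      if "R \<in> borel_measurable borel" "integrable lborel R" "\<And>x. 0 \<le> R x" "integral\<^sup>L lborel R = m" for R
    proof (rule real_distribution.intro)
      show "prob_space (density lborel (\<lambda>x. ennreal (R x / m)))"
      proof (rule prob_spaceI)
        have "(\<integral>\<^sup>+ x. ennreal (R x / m) \<partial>lborel) = ennreal (LBINT x. R x / m)"
          using that mp by (intro nn_integral_eq_integral) auto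
        also have "(LBINT x. R x / m) = 1" using that mp by simp
        finally show "emeasure (density lborel (\<lambda>x. ennreal (R x / m))) (space (density lborel (\<lambda>x. ennreal (R x / m)))) = 1"
          using that by (simp add: emeasure_density)
      qed
      show "real_distribution_axioms (density lborel (\<lambda>x. ennreal (R x / m)))"
        by (rule real_distribution_axioms.intro) simp_all
    qed
    have rd1: "real_distribution M1" unfolding M1_def by (rule rd[OF mPQ(1) iPQ(1) nn(1) m_def[symmetric]])
    have rd2: "real_distribution M2" unfolding M2_def by (rule rd[OF mPQ(2) iPQ(2) nn(2) mQ[symmetric]])
    have ch: "char (density lborel (\<lambda>x. ennreal (R x / m))) t = (CLBINT x. iexp (t * x) * R x) / m"
      if "R \<in> borel_measurable borel" "\<And>x. 0 \<le> R x" for R t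
    proof -
      have "char (density lborel (\<lambda>x. ennreal (R x / m))) t = (CLBINT x. (R x / m) *\<^sub>R iexp (t * x))"
        unfolding char_def using that mp by (intro integral_density) auto
      also have "\<dots> = (CLBINT x. iexp (t * x) * R x / m)"
        by (simp add: scaleR_conv_of_real mult_ac)
      finally show ?thesis by simp
    qed
    have ii: "integrable lborel (\<lambda>x. iexp (t * x) * complex_of_real (R x))"
      if "R \<in> borel_measurable borel" "integrable lborel R" for R t
      by (rule Bochner_Integration.integrable_bound[OF that(2)]) (use that(1) in \<open>auto simp: norm_mult\<close>)
    have "char M1 = char M2"
    proof
      fix t
      have "(CLBINT x. iexp (t * x) * P x) - (CLBINT x. iexp (t * x) * Q x) = (CLBINT x. iexp (t * x) * F x)"
        using ii[OF mPQ(1) iPQ(1), of t] ii[OF mPQ(2) iPQ(2), of t]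
        by (subst Bochner_Integration.integral_diff[symmetric]) (auto simp: FPQ algebra_simps)
      then show "char M1 t = char M2 t"
        unfolding M1_def M2_def ch[OF mPQ(1) nn(1)] ch[OF mPQ(2) nn(2)] using four[of t] by simp
    qed
    then have M: "M1 = M2" by (rule Levy_uniqueness[OF rd1 rd2])
    \<comment> \<open>The set where \<open>F\<close> is positive separates the two laws: it has mass
      1 under \<open>M1\<close> and mass 0 under \<open>M2\<close>.\<close>
    define A where "A = {x. 0 < F x}"
    have A: "A \<in> sets borel" unfolding A_def using mF by measurable
    have "emeasure M1 A = (\<integral>\<^sup>+ x. ennreal (P x / m) * indicator A x \<partial>lborel)"
      unfolding M1_def using mPQ A by (intro emeasure_density) auto
    also have "\<dots> = (\<integral>\<^sup>+ x. ennreal (P x / m) \<partial>lborel)"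
      by (intro nn_integral_cong) (auto simp: A_def P_def indicator_def)
    also have "\<dots> = emeasure M1 (space M1)"
      unfolding M1_def using mPQ by (simp add: emeasure_density)
    also have "\<dots> = 1" using rd1 by (simp add: prob_space.emeasure_space_1 real_distribution_def)
    finally have "emeasure M1 A = 1" .
    moreover have "emeasure M2 A = (\<integral>\<^sup>+ x. ennreal (Q x / m) * indicator A x \<partial>lborel)"
      unfolding M2_def using mPQ A by (intro emeasure_density) auto
    then have "emeasure M2 A = (\<integral>\<^sup>+ x. 0 \<partial>(lborel :: real measure))"
      by (simp only:) (intro nn_integral_cong, auto simp: A_def Q_def indicator_def)
    ultimately show False using M by simp
  qed
  then have "integral\<^sup>L lborel P = 0" "integral\<^sup>L lborel Q = 0" using mQ m_def by simp_all
  then have "AE x in lborel. P x = 0" "AE x in lborel. Q x = 0"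
    using integral_nonneg_eq_0_iff_AE[OF iPQ(1)] integral_nonneg_eq_0_iff_AE[OF iPQ(2)] nn by simp_all
  then have "AE x in lborel. F x = 0" by eventually_elim (simp add: FPQ)
  \<comment> \<open>Continuity turns almost everywhere into everywhere: a closed set containing
    almost every point is the whole line.\<close>
  then have "AE x in lebesgue. x \<in> {x. F x = 0}" by (intro AE_completion) simp
  moreover have "closed {x. F x = 0}" by (intro closed_Collect_eq cF continuous_intros)
  ultimately have "F x = 0" using mem_closed_if_AE_lebesgue by blast
  then show ?thesis by (simp add: F_def herm.simps)
qed

section \<open>Regularity of weak solutions\<close>

text \<open>By the mean value inequality the increment gains at most a factor |x|, which one more
  unit in the exponential rate absorbs.\<close>

lemma exp_bounded_antiderivative:
  assumes "\<And>x. (F has_real_derivative f x) (at x)" "exp_bounded f"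
  shows "exp_bounded F"
proof -
  obtain C k where C: "C \<ge> 0" "k \<ge> 0" "\<And>x. \<bar>f x\<bar> \<le> C * exp (k * \<bar>x\<bar>)"
    using exp_boundedE[OF assms(2)] by metis
  show ?thesis
  proof (rule exp_boundedI)
    fix x :: real
    have "norm (F x - F 0) \<le> (C * exp (k * \<bar>x\<bar>)) * norm (x - 0)"
    proof (rule field_differentiable_bound[where S = "{-\<bar>x\<bar>..\<bar>x\<bar>}" and f' = f])
      show "(F has_field_derivative f z) (at z within {-\<bar>x\<bar>..\<bar>x\<bar>})" for z
        using assms(1) by (rule has_field_derivative_at_within)
      show "norm (f z) \<le> C * exp (k * \<bar>x\<bar>)" if "z \<in> {-\<bar>x\<bar>..\<bar>x\<bar>}" for z
      proof -
        have "\<bar>z\<bar> \<le> \<bar>x\<bar>" using that by auto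
        then have "C * exp (k * \<bar>z\<bar>) \<le> C * exp (k * \<bar>x\<bar>)"
          using C by (intro mult_left_mono) (auto intro: mult_left_mono)
        then show ?thesis using C(3)[of z] by simp
      qed
    qed auto
    also have "\<dots> \<le> (C * exp (k * \<bar>x\<bar>)) * exp \<bar>x\<bar>"
      using C abs_le_exp_abs[of x] by (intro mult_left_mono) auto
    also have "\<dots> = C * exp ((k + 1) * \<bar>x\<bar>)" by (simp only: distrib_right exp_add mult_1_left mult.assoc)
    finally have "\<bar>F x\<bar> \<le> \<bar>F 0\<bar> + C * exp ((k + 1) * \<bar>x\<bar>)" by simp
    also have "\<dots> \<le> (\<bar>F 0\<bar> + C) * exp ((k + 1) * \<bar>x\<bar>)"
      using C mult_left_mono[of 1 "exp ((k + 1) * \<bar>x\<bar>)" "\<bar>F 0\<bar>"] by (simp add: distrib_right)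
    finally show "\<bar>F x\<bar> \<le> (\<bar>F 0\<bar> + C) * exp ((k + 1) * \<bar>x\<bar>)" .
  qed
qed

text \<open>The recurrence applied twice; it connects only indices of equal parity. For n < 2 the
  truncated index \<open>n - 2\<close> is harmless because its coefficient is 0.\<close>

lemma sq_mult_herm:
  "2 * (x\<^sup>2 * herm n x) = sqrt (real (Suc n)) * sqrt (real (Suc (Suc n))) * herm (Suc (Suc n)) x
     + (2 * real n + 1) * herm n x + sqrt (real n) * sqrt (real (n - 1)) * herm (n - 2) x"
proof -
  have a: "sqrt 2 * x * herm m x = sqrt (real (Suc m)) * herm (Suc m) x + sqrt m * herm (m - 1) x" for m
    using herm_Suc[of m x] by simp
  have "2 * (x\<^sup>2 * herm n x) = sqrt 2 * x * (sqrt 2 * x * herm n x)"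
    by (simp add: power2_eq_square)
  also have "\<dots> = sqrt (real (Suc n)) * (sqrt 2 * x * herm (Suc n) x) + sqrt n * (sqrt 2 * x * herm (n - 1) x)"
    unfolding a[of n] by (simp add: algebra_simps)
  also have "sqrt (real (Suc n)) * (sqrt 2 * x * herm (Suc n) x)
      = sqrt (real (Suc n)) * sqrt (real (Suc (Suc n))) * herm (Suc (Suc n)) x + (sqrt (real (Suc n)) * sqrt (real (Suc n))) * herm n x"
    unfolding a by (simp only: distrib_left mult.assoc diff_Suc_1)
  also have "sqrt n * (sqrt 2 * x * herm (n - 1) x) = real n * herm n x + sqrt (real n) * sqrt (real (n - 1)) * herm (n - 2) x"
  proof (cases n)
    case (Suc k)
    have "sqrt n * (sqrt 2 * x * herm (n - 1) x) = (sqrt n * sqrt n) * herm n x + sqrt (real n) * sqrt (real (n - 1)) * herm (n - 2) x"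
      unfolding Suc diff_Suc_1 a by (simp only: distrib_left mult.assoc) (simp add: numeral_2_eq_2)
    then show ?thesis by simp
  qed simp
  finally show ?thesis by (simp add: algebra_simps)
qed

text \<open>The condition \<open>weak\<close> says r'' = 0 in the weak sense, so \<open>r\<close>
  ought to be affine. By \<open>sq_mult_herm\<close> its coefficients obey a recursion of step two,
  which the two base values annihilate on both parities; completeness finishes.\<close>

lemma weakly_affine_eq_zero:
  assumes cr: "continuous_on UNIV r" and er: "exp_bounded r"
    and weak: "\<And>n. (LBINT x. r x * ((x\<^sup>2 - (2 * real n + 1)) * herm n x)) = 0"
    and base: "(LBINT x. r x * herm 0 x) = 0" "(LBINT x. r x * herm 1 x) = 0"
  shows "r x = 0"
proof -
  have i: "integrable lborel (\<lambda>x. r x * herm n x)" for n by (intro integrable_mult_herm cr er)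
  have rec: "(2 * real n + 1) * (LBINT x. r x * herm n x) = sqrt (real (Suc n)) * sqrt (real (Suc (Suc n))) * (LBINT x. r x * herm (Suc (Suc n)) x)
      + sqrt (real n) * sqrt (real (n - 1)) * (LBINT x. r x * herm (n - 2) x)" for n
  proof -
    have "0 = (LBINT x. 2 * (r x * ((x\<^sup>2 - (2 * real n + 1)) * herm n x)))" using weak[of n] by simp
    also have "\<dots> = (LBINT x. sqrt (real (Suc n)) * sqrt (real (Suc (Suc n))) * (r x * herm (Suc (Suc n)) x)
      + sqrt (real n) * sqrt (real (n - 1)) * (r x * herm (n - 2) x) - (2 * real n + 1) * (r x * herm n x))"
    proof (intro Bochner_Integration.integral_cong refl)
      fix x
      have "2 * (r x * ((x\<^sup>2 - (2 * real n + 1)) * herm n x)) = r x * (2 * (x\<^sup>2 * herm n x)) - 2 * (2 * real n + 1) * (r x * herm n x)"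
        by (simp add: algebra_simps)
      then show "2 * (r x * ((x\<^sup>2 - (2 * real n + 1)) * herm n x)) = sqrt (real (Suc n)) * sqrt (real (Suc (Suc n))) * (r x * herm (Suc (Suc n)) x)
        + sqrt (real n) * sqrt (real (n - 1)) * (r x * herm (n - 2) x) - (2 * real n + 1) * (r x * herm n x)"
        unfolding sq_mult_herm by (simp add: algebra_simps)
    qed
    finally show ?thesis using i by simp
  qed
  have "(LBINT x. r x * herm n x) = 0" for n
  proof (induction n rule: less_induct)
    case (less n)
    consider "n = 0" | "n = 1" | k where "n = Suc (Suc k)"
      by (metis One_nat_def not0_implies_Suc)
    then show ?case
    proof cases
      case 3
      have "(LBINT x. r x * herm k x) = 0" "(LBINT x. r x * herm (k - 2) x) = 0"
        using less[of k] less[of "k - 2"] 3 by auto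
      then show ?thesis using rec[of k] 3 by (simp del: of_nat_Suc)
    qed (use base in auto)
  qed
  then show ?thesis by (rule herm_complete[OF cr er])
qed

text \<open>
  Subtract from $u$ a double antiderivative of $k$ and a suitable affine function: the remainder is
  orthogonal to every Hermite function by a two-step recursion.
\<close>

theorem weak_solution_regular:
  fixes u k :: "real \<Rightarrow> real"
  assumes cu: "continuous_on UNIV u" and ck: "continuous_on UNIV k" and eu: "exp_bounded u" and ek: "exp_bounded k"
    and weak: "\<And>n. (LBINT x. u x * ((x\<^sup>2 - (2 * real n + 1)) * herm n x)) = (LBINT x. k x * herm n x)"
  shows "\<exists>u'. \<forall>x. (u has_real_derivative u' x) (at x) \<and> (u' has_real_derivative k x) (at x)"
proof -
  have anti: "\<exists>F. \<forall>x. (F has_real_derivative f x) (at x)" if "continuous_on UNIV f" for f :: "real \<Rightarrow> real"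
    using einterval_antiderivative[of "-\<infinity>" "\<infinity>" f] that
    by (simp add: continuous_on_eq_continuous_at has_real_derivative_iff_has_vector_derivative)
  obtain v' where v': "\<And>x. (v' has_real_derivative k x) (at x)" using anti[OF ck] by blast
  have "continuous_on UNIV v'" using v' by (meson DERIV_continuous continuous_at_imp_continuous_on)
  then obtain v where v: "\<And>x. (v has_real_derivative v' x) (at x)" using anti by blast
  have cv: "continuous_on UNIV v" using v by (meson DERIV_continuous continuous_at_imp_continuous_on)
  have ev': "exp_bounded v'" by (rule exp_bounded_antiderivative[OF v' ek])
  have ev: "exp_bounded v" by (rule exp_bounded_antiderivative[OF v ev'])
  have ih: "integrable lborel (\<lambda>x. f x * ((x\<^sup>2 - (2 * real n + 1)) * herm n x))"
    if "continuous_on UNIV f" "exp_bounded f" for f n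
  proof -
    have "integrable lborel (\<lambda>x. (f x * (x\<^sup>2 - (2 * real n + 1))) * herm n x)"
      by (intro integrable_mult_herm continuous_intros that exp_bounded_mult exp_bounded_diff exp_bounded_power2) auto
    then show ?thesis by (simp add: mult.assoc)
  qed
  have affine: "(LBINT x. (a + b * x) * ((x\<^sup>2 - (2 * real n + 1)) * herm n x)) = 0" for a b n
  proof -
    have "(LBINT x. (a + b * x) * ((x\<^sup>2 - (2 * real n + 1)) * herm n x)) = (LBINT x. 0 * herm n x)"
    proof (rule herm_weak_second_derivative)
      show "((\<lambda>x. a + b * x) has_real_derivative b) (at x)" for x by (auto intro!: derivative_eq_intros)
      show "((\<lambda>x. b) has_real_derivative 0) (at x)" for x by simp
    qed (auto intro!: exp_bounded_add exp_bounded_mult)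
    then show ?thesis by simp
  qed
  define I0 where "I0 = (LBINT x. herm 0 x)"
  have ig: "integrable lborel (herm n)" for n by (intro rapid_decay_integrable rapid_decay_herm continuous_herm)
  have x0: "(LBINT x. x * herm 0 x) = 0"
  proof -
    have "integral\<^sup>L lborel (dherm 0) = 0"
      by (rule integral_derivative_rapid_decay[OF DERIV_herm continuous_dherm rapid_decay_dherm rapid_decay_herm])
    then show ?thesis by (simp add: dherm_def[abs_def])
  qed
  have h1: "herm 1 x = sqrt 2 * (x * herm 0 x)" for x by (simp add: herm.simps)
  have i1: "(LBINT x. herm 1 x) = 0" unfolding h1 using x0 by simp
  \<comment> \<open>Were it 0, the constant function 1 would satisfy every hypothesis of
    \<open>weakly_affine_eq_zero\<close>.\<close>
  have I0: "I0 \<noteq> 0"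
  proof
    assume "I0 = 0"
    then have "(1::real) = 0"
      using affine[of 1 0] i1 by (intro weakly_affine_eq_zero[of "\<lambda>_. 1"]) (auto simp: I0_def)
    then show False by simp
  qed
  have x1: "(LBINT x. x * herm 1 x) = sqrt 2 * I0"
  proof -
    have i2: "integrable lborel (\<lambda>x. x\<^sup>2 * herm 0 x)"
      by (intro integrable_mult_herm continuous_intros exp_bounded_power2 exp_bounded_ident)
    have "0 = (LBINT x. x\<^sup>2 * herm 0 x - herm 0 x)" using affine[of 1 0 0] by (simp add: left_diff_distrib)
    then have "(LBINT x. x\<^sup>2 * herm 0 x) = I0" unfolding I0_def using i2 ig by simp
    moreover have "(LBINT x. x * herm 1 x) = (LBINT x. sqrt 2 * (x\<^sup>2 * herm 0 x))"
      unfolding h1 by (simp add: power2_eq_square mult_ac)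
    ultimately show ?thesis by simp
  qed
  define r where "r x = u x - v x" for x
  have cr: "continuous_on UNIV r" and er: "exp_bounded r"
    unfolding r_def[abs_def] by (intro continuous_intros cu cv, intro exp_bounded_diff eu ev)
  have wr: "(LBINT x. r x * ((x\<^sup>2 - (2 * real n + 1)) * herm n x)) = 0" for n
    using herm_weak_second_derivative[OF v v' ck ev ev' ek, of n] weak[of n] ih[OF cu eu, of n] ih[OF cv ev, of n]
    by (simp add: r_def left_diff_distrib)
  \<comment> \<open>The affine correction must match \<open>r\<close> against \<open>herm 0\<close>
    and \<open>herm 1\<close>. The integrals of \<open>herm 1\<close> and of x \<open>herm 0\<close>
    vanish, so this system is diagonal, with entries \<open>I0\<close> and
    \<open>sqrt 2 * I0\<close>.\<close>
  define a where "a = (LBINT x. r x * herm 0 x) / I0"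
  define b where "b = (LBINT x. r x * herm 1 x) / (sqrt 2 * I0)"
  have ia: "continuous_on UNIV (\<lambda>x. a + b * x)" "exp_bounded (\<lambda>x. a + b * x)"
    by (auto intro!: continuous_intros exp_bounded_add exp_bounded_mult)
  have "integrable lborel (\<lambda>x. x * herm n x)" for n by (intro integrable_mult_herm continuous_intros exp_bounded_ident)
  then have aff_int: "(LBINT x. (a + b * x) * herm n x) = a * (LBINT x. herm n x) + b * (LBINT x. x * herm n x)" for n
    using ig by (simp add: distrib_right mult.assoc)
  have rz: "r x - (a + b * x) = 0" for x
  proof (rule weakly_affine_eq_zero[of "\<lambda>x. r x - (a + b * x)"])
    show "continuous_on UNIV (\<lambda>x. r x - (a + b * x))" by (intro continuous_on_diff cr ia)
    show "exp_bounded (\<lambda>x. r x - (a + b * x))" by (intro exp_bounded_diff er ia)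
    show "(LBINT x. (r x - (a + b * x)) * ((x\<^sup>2 - (2 * real n + 1)) * herm n x)) = 0" for n
      using wr[of n] affine[of a b n] ih[OF cr er, of n] ih[OF ia, of n]
      by (simp only: left_diff_distrib[of "r _"] Bochner_Integration.integral_diff diff_self)
    have d: "(LBINT x. (r x - (a + b * x)) * herm n x) = (LBINT x. r x * herm n x) - (LBINT x. (a + b * x) * herm n x)" for n
      using integrable_mult_herm[OF cr er, of n] integrable_mult_herm[OF ia, of n]
      by (simp only: left_diff_distrib[of "r _"] Bochner_Integration.integral_diff)
    show "(LBINT x. (r x - (a + b * x)) * herm 0 x) = 0"
      unfolding d aff_int x0 I0_def[symmetric] using I0 by (simp add: a_def)
    show "(LBINT x. (r x - (a + b * x)) * herm 1 x) = 0"
      unfolding d aff_int x1 i1 using I0 by (simp add: b_def)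
  qed
  have u: "u = (\<lambda>x. v x + (a + b * x))"
  proof
    show "u x = v x + (a + b * x)" for x using rz[of x] by (simp add: r_def)
  qed
  have "(u has_real_derivative v' x + b) (at x)" "((\<lambda>x. v' x + b) has_real_derivative k x) (at x)" for x
    unfolding u by (auto intro!: derivative_eq_intros v v')
  then show ?thesis by (intro exI[of _ "\<lambda>x. v' x + b"]) simp
qed

section \<open>The displaced basis\<close>

lemma lborel_integral_shift: "(LBINT x. f (x + c)) = (LBINT x. f (x::real) :: real)"
  using lborel_integral_real_affine[of 1 f c] by (simp add: add.commute)

lemma integral_sum_mult_sum:
  fixes f g :: "nat \<Rightarrow> real \<Rightarrow> real"
  assumes "\<And>i j. integrable lborel (\<lambda>x. f i x * g j x)"
  shows "(LBINT x. (\<Sum>i<K. a i * f i x) * (\<Sum>j<K. b j * g j x)) = (\<Sum>i<K. \<Sum>j<K. a i * b j * (LBINT x. f i x * g j x))"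
    and "integrable lborel (\<lambda>x. (\<Sum>i<K. a i * f i x) * (\<Sum>j<K. b j * g j x))"
proof -
  have eq: "(\<Sum>i<K. a i * f i x) * (\<Sum>j<K. b j * g j x) = (\<Sum>i<K. \<Sum>j<K. a i * b j * (f i x * g j x))" for x
    by (simp add: sum_product mult_ac)
  show "integrable lborel (\<lambda>x. (\<Sum>i<K. a i * f i x) * (\<Sum>j<K. b j * g j x))"
    unfolding eq using assms by (intro Bochner_Integration.integrable_sum integrable_mult_right)
  show "(LBINT x. (\<Sum>i<K. a i * f i x) * (\<Sum>j<K. b j * g j x)) = (\<Sum>i<K. \<Sum>j<K. a i * b j * (LBINT x. f i x * g j x))"
    unfolding eq using assms by (simp add: Bochner_Integration.integral_sum integrable_mult_right)
qed

text \<open>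
  The orthonormal basis of pairs of functions adapted to the two wells: index $2n$ stands for
  $(h_n(x + c), 0)$ and index $2n + 1$ for $(0, h_n(x - c))$; \<open>left_fun\<close> and \<open>right_fun\<close> are the two
  components.
\<close>

definition left_fun :: "real \<Rightarrow> nat \<Rightarrow> real \<Rightarrow> real" where
  "left_fun c i x = (if even i then herm (i div 2) (x + c) else 0)"

definition right_fun :: "real \<Rightarrow> nat \<Rightarrow> real \<Rightarrow> real" where
  "right_fun c i x = (if even i then 0 else herm (i div 2) (x - c))"

lemma rapid_decay_left_fun: "rapid_decay (left_fun c i)" and rapid_decay_right_fun: "rapid_decay (right_fun c i)"
proof -
  have "rapid_decay (\<lambda>x. herm n (x + d))" for n d by (intro rapid_decay_shift rapid_decay_herm)
  from this[of _ c] this[of _ "- c"] show "rapid_decay (left_fun c i)" "rapid_decay (right_fun c i)"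
    unfolding left_fun_def[abs_def] right_fun_def[abs_def] by (cases "even i"; simp)+
qed

lemma continuous_left_fun: "continuous_on A (left_fun c i)" and continuous_right_fun: "continuous_on A (right_fun c i)"
proof -
  have "continuous_on A (\<lambda>x. herm n (x + d))" for n d
    by (rule continuous_on_compose2[OF continuous_herm[of UNIV]]) (auto intro!: continuous_intros)
  from this[of _ c] this[of _ "- c"] show "continuous_on A (left_fun c i)" "continuous_on A (right_fun c i)"
    unfolding left_fun_def[abs_def] right_fun_def[abs_def] by (cases "even i"; simp)+
qed

lemma exp_bounded_left_fun: "exp_bounded (left_fun c i)" and exp_bounded_right_fun: "exp_bounded (right_fun c i)"
  by (simp_all add: rapid_imp_exp_bounded rapid_decay_left_fun rapid_decay_right_fun)

lemma integrable_exp_rapid: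
  "continuous_on UNIV u \<Longrightarrow> exp_bounded u \<Longrightarrow> continuous_on UNIV v \<Longrightarrow> rapid_decay v \<Longrightarrow> integrable lborel (\<lambda>x. u x * v x)"
  by (intro rapid_decay_integrable rapid_decay_mult continuous_intros)

lemmas integrable_basis =
  integrable_exp_rapid[OF _ _ continuous_left_fun rapid_decay_left_fun]
  integrable_exp_rapid[OF _ _ continuous_right_fun rapid_decay_right_fun]
  integrable_exp_rapid[OF continuous_left_fun exp_bounded_left_fun continuous_left_fun rapid_decay_left_fun]
  integrable_exp_rapid[OF continuous_left_fun exp_bounded_left_fun continuous_right_fun rapid_decay_right_fun]
  integrable_exp_rapid[OF continuous_right_fun exp_bounded_right_fun continuous_left_fun rapid_decay_left_fun]
  integrable_exp_rapid[OF continuous_right_fun exp_bounded_right_fun continuous_right_fun rapid_decay_right_fun]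

lemma herm_shift_inner: "(LBINT x. herm m (x + c) * herm n (x + c)) = (if m = n then 1 else 0)"
  using lborel_integral_shift[of "\<lambda>x. herm m x * herm n x" c] by (simp add: herm_inner)

lemma basis_orthonormal:
  "(LBINT x. left_fun c i x * left_fun c j x) + (LBINT x. right_fun c i x * right_fun c j x) = (if i = j then 1 else 0)"
proof -
  have "i = j \<longleftrightarrow> even i = even j \<and> i div 2 = j div 2"
    by (metis even_two_times_div_two odd_two_times_div_two_succ)
  then show ?thesis
    using herm_shift_inner[of "i div 2" c "j div 2"] herm_shift_inner[of "i div 2" "- c" "j div 2"]
    by (cases "even i"; cases "even j") (auto simp: left_fun_def right_fun_def)
qed

lemma basis_sq_le: "(left_fun c i x)\<^sup>2 \<le> 2 * sqrt (real i + 1)" "(right_fun c i x)\<^sup>2 \<le> 2 * sqrt (real i + 1)"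
proof -
  have "(herm (i div 2) y)\<^sup>2 \<le> 2 * sqrt (real i + 1)" for y
  proof -
    have "(herm (i div 2) y)\<^sup>2 \<le> 2 * sqrt (real (i div 2) + 1)" by (rule herm_sq_le)
    also have "\<dots> \<le> 2 * sqrt (real i + 1)" by simp
    finally show ?thesis .
  qed
  then show "(left_fun c i x)\<^sup>2 \<le> 2 * sqrt (real i + 1)" "(right_fun c i x)\<^sup>2 \<le> 2 * sqrt (real i + 1)"
    by (simp_all add: left_fun_def right_fun_def)
qed

section \<open>Coefficients in the displaced basis\<close>

text \<open>The components are separate arguments so that the coupling can be expressed by
  exchanging them.\<close>

definition displaced_coef :: "real \<Rightarrow> (real \<Rightarrow> real) \<Rightarrow> (real \<Rightarrow> real) \<Rightarrow> nat \<Rightarrow> real" where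
  "displaced_coef c u v i = (LBINT x. u x * left_fun c i x) + (LBINT x. v x * right_fun c i x)"

lemma displaced_coef_even: "displaced_coef c u v (2 * n) = (LBINT x. u x * herm n (x + c))"
  by (simp add: displaced_coef_def left_fun_def right_fun_def)

lemma displaced_coef_odd: "displaced_coef c u v (Suc (2 * n)) = (LBINT x. v x * herm n (x - c))"
  by (simp add: displaced_coef_def left_fun_def right_fun_def)

lemma herm_shift_complete:
  assumes "continuous_on UNIV u" "exp_bounded u" "\<And>n. (LBINT x. u x * herm n (x + c)) = 0"
  shows "u x = 0"
proof -
  have "u ((x + c) - c) = 0"
  proof (rule herm_complete[of "\<lambda>x. u (x - c)"])
    show "continuous_on UNIV (\<lambda>x. u (x - c))"
      by (rule continuous_on_compose2[OF assms(1)]) (auto intro!: continuous_intros)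
    show "exp_bounded (\<lambda>x. u (x - c))" using exp_bounded_shift[OF assms(2), of "- c"] by simp
    show "(LBINT x. u (x - c) * herm n x) = 0" for n
      using lborel_integral_shift[of "\<lambda>x. u x * herm n (x + c)" "- c"] assms(3)[of n] by simp
  qed
  then show ?thesis by simp
qed

lemma displaced_coef_eq_zero_imp:
  assumes "continuous_on UNIV u" "exp_bounded u" "continuous_on UNIV v" "exp_bounded v" "\<And>i. displaced_coef c u v i = 0"
  shows "u x = 0" "v x = 0"
proof -
  show "u x = 0"
    by (rule herm_shift_complete[OF assms(1,2), of c]) (use assms(5)[of "2 * n" for n] in \<open>simp add: displaced_coef_even\<close>)
  show "v x = 0"
    by (rule herm_shift_complete[OF assms(3,4), of "- c"]) (use assms(5)[of "Suc (2 * n)" for n] in \<open>simp add: displaced_coef_odd\<close>)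
qed

lemma partial_sum_norm:
  fixes a :: "nat \<Rightarrow> real" and K :: nat and c :: real
  defines "S \<equiv> \<lambda>x. \<Sum>i<K. a i * left_fun c i x" and "T \<equiv> \<lambda>x. \<Sum>i<K. a i * right_fun c i x"
  shows "(LBINT x. (S x)\<^sup>2 + (T x)\<^sup>2) = (\<Sum>i<K. (a i)\<^sup>2)"
    and "integrable lborel (\<lambda>x. (S x)\<^sup>2)" "integrable lborel (\<lambda>x. (T x)\<^sup>2)"
proof -
  show iS: "integrable lborel (\<lambda>x. (S x)\<^sup>2)"
    unfolding S_def power2_eq_square by (intro integral_sum_mult_sum integrable_basis)
  show iT: "integrable lborel (\<lambda>x. (T x)\<^sup>2)"
    unfolding T_def power2_eq_square by (intro integral_sum_mult_sum integrable_basis)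
  have "(LBINT x. (S x)\<^sup>2 + (T x)\<^sup>2) = (LBINT x. (S x)\<^sup>2) + (LBINT x. (T x)\<^sup>2)" using iS iT by simp
  also have "(LBINT x. (S x)\<^sup>2) = (\<Sum>i<K. \<Sum>j<K. a i * a j * (LBINT x. left_fun c i x * left_fun c j x))"
    unfolding S_def power2_eq_square by (intro integral_sum_mult_sum integrable_basis)
  also have "(LBINT x. (T x)\<^sup>2) = (\<Sum>i<K. \<Sum>j<K. a i * a j * (LBINT x. right_fun c i x * right_fun c j x))"
    unfolding T_def power2_eq_square by (intro integral_sum_mult_sum integrable_basis)
  also have "(\<Sum>i<K. \<Sum>j<K. a i * a j * (LBINT x. left_fun c i x * left_fun c j x)) + (\<Sum>i<K. \<Sum>j<K. a i * a j * (LBINT x. right_fun c i x * right_fun c j x))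
     = (\<Sum>i<K. \<Sum>j<K. a i * a j * ((LBINT x. left_fun c i x * left_fun c j x) + (LBINT x. right_fun c i x * right_fun c j x)))"
    by (simp add: sum.distrib distrib_left)
  also have "\<dots> = (\<Sum>i<K. \<Sum>j<K. if j = i then a i * a i else 0)"
    unfolding basis_orthonormal by (intro sum.cong refl) auto
  also have "\<dots> = (\<Sum>i<K. (a i)\<^sup>2)" by (intro sum.cong refl) (auto simp: power2_eq_square)
  finally show "(LBINT x. (S x)\<^sup>2 + (T x)\<^sup>2) = (\<Sum>i<K. (a i)\<^sup>2)" .
qed

lemma bessel:
  assumes cu: "continuous_on UNIV u" and eu: "exp_bounded u" and cv: "continuous_on UNIV v" and ev: "exp_bounded v"
    and iu: "integrable lborel (\<lambda>x. (u x)\<^sup>2)" and iv: "integrable lborel (\<lambda>x. (v x)\<^sup>2)"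
  shows "summable (\<lambda>i. (displaced_coef c u v i)\<^sup>2)"
proof (rule summableI_nonneg_bounded)
  fix K
  let ?a = "displaced_coef c u v"
  define S where "S x = (\<Sum>i<K. ?a i * left_fun c i x)" for x
  define T where "T x = (\<Sum>i<K. ?a i * right_fun c i x)" for x
  note ps = partial_sum_norm[where a = ?a and K = K and c = c, folded S_def T_def]
  have rS: "integrable lborel (\<lambda>x. u x * S x)" "integrable lborel (\<lambda>x. v x * T x)"
    and us: "(LBINT x. u x * S x) = (\<Sum>i<K. ?a i * (LBINT x. u x * left_fun c i x))"
    and vt: "(LBINT x. v x * T x) = (\<Sum>i<K. ?a i * (LBINT x. v x * right_fun c i x))"
  proof -
    have eq: "u x * S x = (\<Sum>i<K. ?a i * (u x * left_fun c i x))" "v x * T x = (\<Sum>i<K. ?a i * (v x * right_fun c i x))" for x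
      by (simp_all add: S_def T_def sum_distrib_left mult_ac)
    note i = integrable_basis(1)[OF cu eu, of c] integrable_basis(2)[OF cv ev, of c]
    show "integrable lborel (\<lambda>x. u x * S x)" "integrable lborel (\<lambda>x. v x * T x)"
      unfolding eq using i by (intro Bochner_Integration.integrable_sum integrable_mult_right; simp)+
    show "(LBINT x. u x * S x) = (\<Sum>i<K. ?a i * (LBINT x. u x * left_fun c i x))"
      "(LBINT x. v x * T x) = (\<Sum>i<K. ?a i * (LBINT x. v x * right_fun c i x))"
      unfolding eq using i by (simp_all add: Bochner_Integration.integral_sum integrable_mult_right)
  qed
  have "0 \<le> (LBINT x. (u x - S x)\<^sup>2 + (v x - T x)\<^sup>2)" by (rule Bochner_Integration.integral_nonneg) simp
  also have "\<dots> = (LBINT x. ((u x)\<^sup>2 + (v x)\<^sup>2) - 2 * (u x * S x) - 2 * (v x * T x) + ((S x)\<^sup>2 + (T x)\<^sup>2))"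
    by (simp add: power2_diff algebra_simps)
  also have "\<dots> = (LBINT x. (u x)\<^sup>2 + (v x)\<^sup>2) - 2 * (LBINT x. u x * S x) - 2 * (LBINT x. v x * T x) + (LBINT x. (S x)\<^sup>2 + (T x)\<^sup>2)"
    using iu iv rS ps(2,3) by simp
  also have "(LBINT x. u x * S x) = (\<Sum>i<K. (?a i)\<^sup>2) - (LBINT x. v x * T x)"
    unfolding us vt by (simp add: sum_subtractf[symmetric] displaced_coef_def power2_eq_square algebra_simps)
  finally show "(\<Sum>i<K. (?a i)\<^sup>2) \<le> (LBINT x. (u x)\<^sup>2 + (v x)\<^sup>2)" unfolding ps(1) by simp
qed simp

section \<open>Synthesis of functions from coefficients\<close>

text \<open>The weight is bounded by a multiple of the diagonal, so the domain of D is contained in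
  this class, while the condition itself mentions no parameters. It is strong enough for uniform
  convergence of the expansions.\<close>

definition weighted_summable :: "l2 \<Rightarrow> bool" where
  "weighted_summable x \<longleftrightarrow> summable (\<lambda>i. ((real i + 1) * crd x i)\<^sup>2)"

definition synth_left :: "real \<Rightarrow> l2 \<Rightarrow> real \<Rightarrow> real" where "synth_left c x t = (\<Sum>i. crd x i * left_fun c i t)"
definition synth_right :: "real \<Rightarrow> l2 \<Rightarrow> real \<Rightarrow> real" where "synth_right c x t = (\<Sum>i. crd x i * right_fun c i t)"

lemma weighted_series:
  assumes x: "weighted_summable x" and b: "\<And>i t. (b i t)\<^sup>2 \<le> 2 * sqrt (real i + 1)"
    and cb: "\<And>i. continuous_on UNIV (b i)"
  defines "S \<equiv> \<lambda>t::real. \<Sum>i. crd x i * b i t"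
  shows "continuous_on UNIV S" "\<exists>M. \<forall>t K. \<bar>\<Sum>i<K. crd x i * b i t\<bar> \<le> M \<and> \<bar>S t\<bar> \<le> M"
    "(\<lambda>i. crd x i * b i t) sums S t"
proof -
  \<comment> \<open>Splitting a term as (r x)(b / r) with r = i + 1, the arithmetic-geometric mean
    inequality leaves the weighted square and b^2 / r^2, which is at most 2 r^(-3/2).\<close>
  define m where "m i = (((real i + 1) * crd x i)\<^sup>2 + 2 * (real i + 1) powr (- 3 / 2)) / 2" for i
  have "summable (\<lambda>i. real (i + 1) powr (- 3 / 2))"
    by (subst summable_iff_shift) (simp add: summable_real_powr_iff)
  then have sm: "summable m"
    unfolding m_def using x unfolding weighted_summable_def
    by (intro summable_divide summable_add summable_mult) (simp_all add: add.commute)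
  have le: "norm (crd x i * b i t) \<le> m i" for i t
  proof -
    define r where "r = real i + 1"
    have r: "r > 0" by (simp add: r_def)
    have "(b i t / r)\<^sup>2 \<le> 2 * sqrt r / r\<^sup>2"
      using b[of i t] unfolding r_def power_divide by (intro divide_right_mono) auto
    also have "sqrt r / r\<^sup>2 = r powr (- 3 / 2)"
    proof -
      have "sqrt r / r\<^sup>2 = r powr (1 / 2) / r powr 2"
        using r by (simp add: powr_half_sqrt powr_numeral)
      also have "\<dots> = r powr (- 3 / 2)" by (simp add: powr_diff[symmetric])
      finally show ?thesis .
    qed
    then have "2 * sqrt r / r\<^sup>2 = 2 * r powr (- 3 / 2)" by simp
    finally have b2: "(b i t / r)\<^sup>2 \<le> 2 * r powr (- 3 / 2)" .
    have "0 \<le> (\<bar>r * crd x i\<bar> - \<bar>b i t / r\<bar>)\<^sup>2" by simp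
    then have "2 * (\<bar>r * crd x i\<bar> * \<bar>b i t / r\<bar>) \<le> (r * crd x i)\<^sup>2 + (b i t / r)\<^sup>2"
      unfolding power2_diff power2_abs by simp
    moreover have "\<bar>r * crd x i\<bar> * \<bar>b i t / r\<bar> = \<bar>crd x i * b i t\<bar>"
      using r by (simp add: abs_mult)
    ultimately show ?thesis using b2 unfolding m_def r_def[symmetric] by simp
  qed
  show sums: "(\<lambda>i. crd x i * b i t) sums S t" for t
    unfolding S_def by (intro summable_sums summable_comparison_test'[OF sm le])
  have ul: "uniform_limit UNIV (\<lambda>K t. \<Sum>i<K. crd x i * b i t) S sequentially"
    unfolding S_def by (rule Weierstrass_m_test[OF le sm])
  show "continuous_on UNIV S"
    by (rule uniform_limit_theorem[OF _ ul]) (auto intro!: always_eventually continuous_intros cb)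
  have part: "\<bar>\<Sum>i<K. crd x i * b i t\<bar> \<le> suminf m" for K t
  proof -
    have "\<bar>\<Sum>i<K. crd x i * b i t\<bar> \<le> (\<Sum>i<K. m i)" using le by (intro sum_norm_le[of _ "\<lambda>i. crd x i * b i t", simplified]) auto
    also have "\<dots> \<le> suminf m" by (intro sum_le_suminf sm) (simp_all add: m_def)
    finally show ?thesis .
  qed
  moreover have "\<bar>S t\<bar> \<le> suminf m" for t
  proof (rule tendsto_upperbound)
    show "(\<lambda>K. \<bar>\<Sum>i<K. crd x i * b i t\<bar>) \<longlonglongrightarrow> \<bar>S t\<bar>" using sums unfolding sums_def by (intro tendsto_rabs)
  qed (use part in auto)
  ultimately show "\<exists>M. \<forall>t K. \<bar>\<Sum>i<K. crd x i * b i t\<bar> \<le> M \<and> \<bar>S t\<bar> \<le> M" by blast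
qed

text \<open>Dominated convergence: partial sums are bounded uniformly in the point and in their
  length, and the test function supplies integrability.\<close>

lemma weighted_series_integral:
  assumes x: "weighted_summable x" and b: "\<And>i t. (b i t)\<^sup>2 \<le> 2 * sqrt (real i + 1)"
    and cb: "\<And>i. continuous_on UNIV (b i)" and phi: "continuous_on UNIV \<phi>" "rapid_decay \<phi>"
  shows "(\<lambda>i. crd x i * (LBINT t. b i t * \<phi> t)) sums (LBINT t. (\<Sum>i. crd x i * b i t) * \<phi> t)"
proof -
  obtain M where M: "\<And>t K. \<bar>\<Sum>i<K. crd x i * b i t\<bar> \<le> M"
    using weighted_series(2)[OF x b cb] by blast
  have eb: "exp_bounded (b i)" for i
  proof (rule exp_boundedI)
    fix t
    have "\<bar>b i t\<bar> \<le> sqrt (2 * sqrt (real i + 1))" using b[of i t] by (rule real_le_rsqrt[of "\<bar>b i t\<bar>", simplified])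
    then show "\<bar>b i t\<bar> \<le> sqrt (2 * sqrt (real i + 1)) * exp (0 * \<bar>t\<bar>)" by simp
  qed
  have i: "integrable lborel (\<lambda>t. b i t * \<phi> t)" for i by (intro integrable_exp_rapid cb eb phi)
  have iphi: "integrable lborel \<phi>" using phi by (intro rapid_decay_integrable)
  have "(\<lambda>K. LBINT t. (\<Sum>i<K. crd x i * b i t) * \<phi> t) \<longlonglongrightarrow> (LBINT t. (\<Sum>i. crd x i * b i t) * \<phi> t)"
  proof (rule integral_dominated_convergence)
    have m: "f \<in> borel_measurable lborel" if "continuous_on UNIV f" for f :: "real \<Rightarrow> real"
      using that by (simp add: borel_measurable_continuous_onI)
    show "(\<lambda>t. (\<Sum>i. crd x i * b i t) * \<phi> t) \<in> borel_measurable lborel"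
      by (intro m continuous_intros phi weighted_series(1)[OF x b cb])
    show "(\<lambda>t. (\<Sum>i<K. crd x i * b i t) * \<phi> t) \<in> borel_measurable lborel" for K
      by (intro m continuous_intros phi cb)
    show "integrable lborel (\<lambda>t. M * \<bar>\<phi> t\<bar>)" using iphi by (intro integrable_mult_right integrable_abs)
    show "AE t in lborel. (\<lambda>K. (\<Sum>i<K. crd x i * b i t) * \<phi> t) \<longlonglongrightarrow> (\<Sum>i. crd x i * b i t) * \<phi> t"
      using weighted_series(3)[OF x b cb] unfolding sums_def by (intro AE_I2 tendsto_mult tendsto_const)
    show "AE t in lborel. norm ((\<Sum>i<K. crd x i * b i t) * \<phi> t) \<le> M * \<bar>\<phi> t\<bar>" for K
      using M by (intro AE_I2) (simp add: abs_mult mult_right_mono)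
  qed
  moreover have "(LBINT t. (\<Sum>i<K. crd x i * b i t) * \<phi> t) = (\<Sum>i<K. crd x i * (LBINT t. b i t * \<phi> t))" for K
    using i by (simp add: sum_distrib_right mult.assoc Bochner_Integration.integral_sum)
  ultimately show ?thesis unfolding sums_def by simp
qed

lemma synth_props:
  assumes "weighted_summable x"
  shows "continuous_on UNIV (synth_left c x)" "exp_bounded (synth_left c x)" "continuous_on UNIV (synth_right c x)" "exp_bounded (synth_right c x)"
    and "(\<lambda>i. crd x i * left_fun c i t) sums synth_left c x t" "(\<lambda>i. crd x i * right_fun c i t) sums synth_right c x t"
proof -
  note u = weighted_series[OF assms basis_sq_le(1)[where c = c] continuous_left_fun]
  note v = weighted_series[OF assms basis_sq_le(2)[where c = c] continuous_right_fun]
  show "continuous_on UNIV (synth_left c x)" "continuous_on UNIV (synth_right c x)"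
    and "(\<lambda>i. crd x i * left_fun c i t) sums synth_left c x t" "(\<lambda>i. crd x i * right_fun c i t) sums synth_right c x t"
    using u v by (simp_all add: synth_left_def[abs_def] synth_right_def[abs_def])
  obtain M M' where "\<And>t. \<bar>synth_left c x t\<bar> \<le> M" "\<And>t. \<bar>synth_right c x t\<bar> \<le> M'"
    using u(2) v(2) unfolding synth_left_def synth_right_def by blast
  then show "exp_bounded (synth_left c x)" "exp_bounded (synth_right c x)"
    by (auto intro: exp_boundedI[of _ M 0] exp_boundedI[of _ M' 0])
qed

lemma synth_integral:
  assumes "weighted_summable x" "continuous_on UNIV \<phi>" "rapid_decay \<phi>" "continuous_on UNIV \<rho>" "rapid_decay \<rho>"
  shows "(\<lambda>i. crd x i * ((LBINT t. left_fun c i t * \<phi> t) + (LBINT t. right_fun c i t * \<rho> t))) sums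
     ((LBINT t. synth_left c x t * \<phi> t) + (LBINT t. synth_right c x t * \<rho> t))"
  unfolding synth_left_def synth_right_def distrib_left using assms
  by (intro sums_add weighted_series_integral basis_sq_le continuous_left_fun continuous_right_fun)

lemma displaced_coef_synth:
  assumes "weighted_summable x"
  shows "displaced_coef c (synth_left c x) (synth_right c x) j = crd x j"
proof -
  have "(\<lambda>i. crd x i * ((LBINT t. left_fun c i t * left_fun c j t) + (LBINT t. right_fun c i t * right_fun c j t))) sums displaced_coef c (synth_left c x) (synth_right c x) j"
    unfolding displaced_coef_def by (intro synth_integral assms continuous_left_fun continuous_right_fun rapid_decay_left_fun rapid_decay_right_fun)
  moreover have "(\<lambda>i. crd x i * ((LBINT t. left_fun c i t * left_fun c j t) + (LBINT t. right_fun c i t * right_fun c j t))) sums crd x j"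
    unfolding basis_orthonormal using sums_single[of j "crd x"] by (simp add: if_distrib[of "(*) _"] cong: if_cong)
  ultimately show ?thesis by (rule sums_unique2)
qed

text \<open>The difference has exponential growth at most and vanishing coefficients, so
  completeness applies and the identification is pointwise.\<close>

lemma expansion_unique:
  assumes "continuous_on UNIV u" "exp_bounded u" "continuous_on UNIV v" "exp_bounded v"
    and "weighted_summable x" "\<And>i. displaced_coef c u v i = crd x i"
  shows "u t = synth_left c x t" "v t = synth_right c x t"
proof -
  note U = synth_props[OF assms(5)]
  have z: "displaced_coef c (\<lambda>t. u t - synth_left c x t) (\<lambda>t. v t - synth_right c x t) i = 0" for i
  proof -
    have "displaced_coef c (\<lambda>t. u t - synth_left c x t) (\<lambda>t. v t - synth_right c x t) i = displaced_coef c u v i - displaced_coef c (synth_left c x) (synth_right c x) i"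
      unfolding displaced_coef_def left_diff_distrib
      using integrable_basis(1)[OF assms(1,2)] integrable_basis(1)[OF U(1,2)]
        integrable_basis(2)[OF assms(3,4)] integrable_basis(2)[OF U(3,4)] by simp
    then show ?thesis using assms(6) displaced_coef_synth[OF assms(5)] by simp
  qed
  have "u t - synth_left c x t = 0" "v t - synth_right c x t = 0"
    by (rule displaced_coef_eq_zero_imp[of "\<lambda>t. u t - synth_left c x t" "\<lambda>t. v t - synth_right c x t" c];
        intro continuous_intros exp_bounded_diff assms(1-4) U z)+
  then show "u t = synth_left c x t" "v t = synth_right c x t" by simp_all
qed

text \<open>Fatou's lemma: the partial sums converge pointwise, and by orthonormality their squared
  norms are at most that of \<open>x\<close>.\<close>

lemma synth_square_integrable:
  assumes "weighted_summable x"
  shows "integrable lborel (\<lambda>t. (synth_left c x t)\<^sup>2)" "integrable lborel (\<lambda>t. (synth_right c x t)\<^sup>2)"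
proof -
  note U = synth_props[OF assms, where c = c]
  define S where "S K t = (\<Sum>i<K. crd x i * left_fun c i t)" for K t
  define T where "T K t = (\<Sum>i<K. crd x i * right_fun c i t)" for K t
  have m: "f \<in> borel_measurable borel" if "continuous_on UNIV f" for f :: "real \<Rightarrow> real"
    using that by (simp add: borel_measurable_continuous_onI)
  have cS: "continuous_on UNIV (S K)" "continuous_on UNIV (T K)" for K
    unfolding S_def[abs_def] T_def[abs_def] by (intro continuous_intros continuous_left_fun continuous_right_fun)+
  note mm[measurable] = m[OF U(1)] m[OF U(3)] m[OF cS(1)] m[OF cS(2)]
  have lim: "(\<lambda>K. ennreal ((S K t)\<^sup>2 + (T K t)\<^sup>2)) \<longlonglongrightarrow> ennreal ((synth_left c x t)\<^sup>2 + (synth_right c x t)\<^sup>2)" for t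
    using U(5,6)[of t] unfolding sums_def S_def T_def by (intro tendsto_ennrealI tendsto_intros)
  have bound: "(\<integral>\<^sup>+ t. ennreal ((S K t)\<^sup>2 + (T K t)\<^sup>2) \<partial>lborel) \<le> ennreal ((norm x)\<^sup>2)" for K
  proof -
    note ps = partial_sum_norm[where a = "crd x" and K = K and c = c, folded S_def T_def]
    have "(\<integral>\<^sup>+ t. ennreal ((S K t)\<^sup>2 + (T K t)\<^sup>2) \<partial>lborel) = ennreal (LBINT t. (S K t)\<^sup>2 + (T K t)\<^sup>2)"
      using ps by (intro nn_integral_eq_integral) auto
    also have "(LBINT t. (S K t)\<^sup>2 + (T K t)\<^sup>2) \<le> (norm x)\<^sup>2"
      unfolding ps(1) sums_unique[OF norm_l2_sums] by (intro sum_le_suminf summable_crd_sq) auto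
    finally show ?thesis by (simp add: ennreal_leI)
  qed
  have "(\<integral>\<^sup>+ t. ennreal ((synth_left c x t)\<^sup>2 + (synth_right c x t)\<^sup>2) \<partial>lborel)
      = (\<integral>\<^sup>+ t. liminf (\<lambda>K. ennreal ((S K t)\<^sup>2 + (T K t)\<^sup>2)) \<partial>lborel)"
    by (intro nn_integral_cong lim_imp_Liminf[symmetric] lim trivial_limit_sequentially)
  also have "\<dots> \<le> liminf (\<lambda>K. \<integral>\<^sup>+ t. ennreal ((S K t)\<^sup>2 + (T K t)\<^sup>2) \<partial>lborel)"
    by (intro nn_integral_liminf) measurable
  also have "\<dots> \<le> ennreal ((norm x)\<^sup>2)"
    using bound by (intro order_trans[OF Liminf_le_Limsup] Limsup_bounded) auto
  finally have fin: "(\<integral>\<^sup>+ t. ennreal ((synth_left c x t)\<^sup>2 + (synth_right c x t)\<^sup>2) \<partial>lborel) < \<infinity>"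
    using le_less_trans ennreal_less_top by fastforce
  have i: "integrable lborel (\<lambda>t. (synth_left c x t)\<^sup>2 + (synth_right c x t)\<^sup>2)"
    using mm fin by (intro integrableI_nonneg) (auto intro!: borel_measurable_add borel_measurable_power)
  show "integrable lborel (\<lambda>t. (synth_left c x t)\<^sup>2)"
    by (rule Bochner_Integration.integrable_bound[OF i]) (use mm in auto)
  show "integrable lborel (\<lambda>t. (synth_right c x t)\<^sup>2)"
    by (rule Bochner_Integration.integrable_bound[OF i]) (use mm in auto)
qed

lemma synth_sum:
  assumes "\<And>k. k \<in> A \<Longrightarrow> weighted_summable (f k)"
  shows "synth_left c (\<Sum>k\<in>A. a k *\<^sub>R f k) t = (\<Sum>k\<in>A. a k * synth_left c (f k) t)" "synth_right c (\<Sum>k\<in>A. a k *\<^sub>R f k) t = (\<Sum>k\<in>A. a k * synth_right c (f k) t)"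
proof -
  have "(\<lambda>i. \<Sum>k\<in>A. a k * (crd (f k) i * left_fun c i t)) sums (\<Sum>k\<in>A. a k * synth_left c (f k) t)"
    "(\<lambda>i. \<Sum>k\<in>A. a k * (crd (f k) i * right_fun c i t)) sums (\<Sum>k\<in>A. a k * synth_right c (f k) t)"
    using assms by (intro sums_sum sums_mult synth_props; simp)+
  then show "synth_left c (\<Sum>k\<in>A. a k *\<^sub>R f k) t = (\<Sum>k\<in>A. a k * synth_left c (f k) t)" "synth_right c (\<Sum>k\<in>A. a k *\<^sub>R f k) t = (\<Sum>k\<in>A. a k * synth_right c (f k) t)"
    unfolding synth_left_def[of c "\<Sum>k\<in>A. a k *\<^sub>R f k"] synth_right_def[of c "\<Sum>k\<in>A. a k *\<^sub>R f k"]
    by (simp_all add: sum_distrib_right mult.assoc sums_iff)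
qed

section \<open>The eigenvalue equation in the displaced basis\<close>

text \<open>The matrix of \<open>\<Delta>\<close> times the exchange (u, v) -> (v, u), which is what
  \<Delta> sigma_z becomes in the sum and difference of the spinor components.\<close>

definition coupling_matrix :: "real \<Rightarrow> real \<Rightarrow> nat \<Rightarrow> nat \<Rightarrow> real" where
  "coupling_matrix \<Delta> c i j = \<Delta> * ((LBINT t. left_fun c j t * right_fun c i t) + (LBINT t. right_fun c j t * left_fun c i t))"

lemma coupling_matrix_sym: "coupling_matrix \<Delta> c i j = coupling_matrix \<Delta> c j i"
  unfolding coupling_matrix_def by (simp add: mult.commute add.commute)

text \<open>For a finite combination with components S and T the form is \<open>\<Delta>\<close>
  times the integral of 2 S T. The pointwise bound by S^2 + T^2 and orthonormality give the
  constant.\<close>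

lemma coupling_matrix_quadratic_bound:
  assumes "\<Delta> \<ge> 0"
  shows "\<bar>\<Sum>i<K. \<Sum>j<K. x i * coupling_matrix \<Delta> c i j * x j\<bar> \<le> \<Delta> * (\<Sum>i<K. (x i)\<^sup>2)"
proof -
  define S where "S t = (\<Sum>i<K. x i * left_fun c i t)" for t
  define T where "T t = (\<Sum>i<K. x i * right_fun c i t)" for t
  note ps = partial_sum_norm[where a = x and K = K and c = c, folded S_def T_def]
  have st: "(LBINT t. S t * T t) = (\<Sum>i<K. \<Sum>j<K. x i * x j * (LBINT t. left_fun c i t * right_fun c j t))"
    and ts: "(LBINT t. T t * S t) = (\<Sum>i<K. \<Sum>j<K. x i * x j * (LBINT t. right_fun c i t * left_fun c j t))"
    and i: "integrable lborel (\<lambda>t. S t * T t)"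
    unfolding S_def T_def by (intro integral_sum_mult_sum integrable_basis)+
  have "(\<Sum>i<K. \<Sum>j<K. x i * coupling_matrix \<Delta> c i j * x j) = \<Delta> * ((LBINT t. S t * T t) + (LBINT t. T t * S t))"
  proof -
    have "x i * coupling_matrix \<Delta> c i j * x j = \<Delta> * (x i * x j * (LBINT t. left_fun c i t * right_fun c j t)) + \<Delta> * (x i * x j * (LBINT t. right_fun c i t * left_fun c j t))" for i j
      unfolding coupling_matrix_sym[of \<Delta> c i j] coupling_matrix_def by (simp only: distrib_left distrib_right mult_ac)
    then show ?thesis unfolding st ts by (simp only: sum.distrib sum_distrib_left distrib_left)
  qed
  also have "(LBINT t. T t * S t) = (LBINT t. S t * T t)" by (simp only: mult.commute)
  also have "\<Delta> * ((LBINT t. S t * T t) + (LBINT t. S t * T t)) = \<Delta> * (LBINT t. 2 * (S t * T t))" by simp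
  finally have eq: "(\<Sum>i<K. \<Sum>j<K. x i * coupling_matrix \<Delta> c i j * x j) = \<Delta> * (LBINT t. 2 * (S t * T t))" .
  have "\<bar>LBINT t. 2 * (S t * T t)\<bar> \<le> (LBINT t. \<bar>2 * (S t * T t)\<bar>)"
    by (rule integral_abs_bound)
  also have "\<dots> \<le> (LBINT t. (S t)\<^sup>2 + (T t)\<^sup>2)"
  proof (rule integral_mono)
    show "integrable lborel (\<lambda>t. \<bar>2 * (S t * T t)\<bar>)" using i by simp
    show "integrable lborel (\<lambda>t. (S t)\<^sup>2 + (T t)\<^sup>2)" using ps by simp
    show "\<bar>2 * (S t * T t)\<bar> \<le> (S t)\<^sup>2 + (T t)\<^sup>2" for t
    proof -
      have "0 \<le> (\<bar>S t\<bar> - \<bar>T t\<bar>)\<^sup>2" by simp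
      then show ?thesis unfolding power2_diff power2_abs by (simp add: abs_mult)
    qed
  qed
  finally show ?thesis unfolding eq ps(1) using assms by (simp add: abs_mult mult_left_mono)
qed

definition uncoupled_eigval :: "real \<Rightarrow> real \<Rightarrow> nat \<Rightarrow> real" where
  "uncoupled_eigval N \<epsilon> i = real (i div 2) + (if even i then N + \<epsilon> else N - \<epsilon>)"

text \<open>With n = i div 2 and d the gap, i + 1 is at most 2 n + 2, hence at most (2 + 2 / d)(n +
  d). The value b = 0 serves for the domain of D and for the limiting series, b = \<Delta> for the
  majorant of the zeta series.\<close>

lemma index_le_uncoupled_eigval:
  assumes "\<bar>\<epsilon>\<bar> + b < N" "0 \<le> b"
  shows "real i + 1 \<le> (2 + 2 / (N - \<bar>\<epsilon>\<bar> - b)) * (uncoupled_eigval N \<epsilon> i - b)"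
proof -
  define d where "d = N - \<bar>\<epsilon>\<bar> - b"
  have d: "d > 0" using assms by (simp add: d_def)
  have m: "real (i div 2) + d \<le> uncoupled_eigval N \<epsilon> i - b" by (auto simp: uncoupled_eigval_def d_def)
  have "i + 1 \<le> 2 * (i div 2) + 2" by simp
  then have "real (i + 1) \<le> real (2 * (i div 2) + 2)" by (rule of_nat_mono)
  then have "real i + 1 \<le> 2 * real (i div 2) + 2" by simp
  also have "\<dots> \<le> (2 + 2 / d) * (real (i div 2) + d)"
    using d by (simp add: field_simps)
  also have "\<dots> \<le> (2 + 2 / d) * (uncoupled_eigval N \<epsilon> i - b)" using m d by (intro mult_left_mono) auto
  finally show ?thesis by (simp add: d_def)
qed

section \<open>Translation between differential equation and coefficient equation\<close>

lemma continuous_exp_bounded_shift: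
  assumes "continuous_on UNIV u" "exp_bounded u"
  shows "continuous_on UNIV (\<lambda>x. u (x - c))" "exp_bounded (\<lambda>x. u (x - (c::real)))"
proof -
  have "continuous_on UNIV (\<lambda>x. x - c)" by (intro continuous_intros)
  then show "continuous_on UNIV (\<lambda>x. u (x - c))" by (rule continuous_on_compose2[OF assms(1)]) auto
  show "exp_bounded (\<lambda>x. u (x - c))" using exp_bounded_shift[OF assms(2), of "- c"] by simp
qed

lemma continuous_rapid_decay_herm_shift: "continuous_on UNIV (\<lambda>x. herm n (x + c))" "rapid_decay (\<lambda>x. herm n (x + c))"
proof -
  have "continuous_on UNIV (\<lambda>x. x + c)" by (intro continuous_intros)
  then show "continuous_on UNIV (\<lambda>x. herm n (x + c))" by (rule continuous_on_compose2[OF continuous_herm[of UNIV]]) auto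
qed (rule rapid_decay_shift[OF rapid_decay_herm])

text \<open>Writing y^2 - 1 as (y^2 - (2 n + 1)) + 2 n splits the paired equation into the part
  governed by Green's identity and an algebraic relation among coefficients. Both directions of the
  translation rest on this splitting.\<close>

lemma oscillator_integrals:
  assumes cu: "continuous_on UNIV u" and eu: "exp_bounded u" and cv: "continuous_on UNIV v" and ev: "exp_bounded v"
  shows "(LBINT x. 2 * ((((x + c)\<^sup>2 - 1) / 2 + m - l) * u x + \<Delta> * v x) * herm n (x + c))
     = (LBINT x. u x * (((x + c)\<^sup>2 - (2 * real n + 1)) * herm n (x + c)))
       + 2 * ((real n + m - l) * (LBINT x. u x * herm n (x + c)) + \<Delta> * (LBINT x. v x * herm n (x + c)))"
proof -
  have "integrable lborel (\<lambda>x. (u x * ((x + c)\<^sup>2 - (2 * real n + 1))) * herm n (x + c))"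
    by (intro integrable_exp_rapid continuous_rapid_decay_herm_shift continuous_intros cu exp_bounded_mult eu exp_bounded_diff exp_bounded_power2 exp_bounded_add) auto
  then have i: "integrable lborel (\<lambda>x. u x * (((x + c)\<^sup>2 - (2 * real n + 1)) * herm n (x + c)))"
    by (simp add: mult.assoc)
  have "(LBINT x. 2 * ((((x + c)\<^sup>2 - 1) / 2 + m - l) * u x + \<Delta> * v x) * herm n (x + c))
     = (LBINT x. u x * (((x + c)\<^sup>2 - (2 * real n + 1)) * herm n (x + c))
       + (2 * (real n + m - l) * (u x * herm n (x + c)) + 2 * \<Delta> * (v x * herm n (x + c))))"
    by (intro Bochner_Integration.integral_cong refl) (simp add: field_simps)
  also have "\<dots> = (LBINT x. u x * (((x + c)\<^sup>2 - (2 * real n + 1)) * herm n (x + c)))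
       + 2 * ((real n + m - l) * (LBINT x. u x * herm n (x + c)) + \<Delta> * (LBINT x. v x * herm n (x + c)))"
    using i integrable_exp_rapid[OF cu eu continuous_rapid_decay_herm_shift] integrable_exp_rapid[OF cv ev continuous_rapid_decay_herm_shift]
    by (simp add: distrib_left)
  finally show ?thesis .
qed

text \<open>After translation to the centre of the well, Green's identity cancels the oscillator
  part and only the algebraic relation remains.\<close>

lemma component_equation_imp_coef:
  assumes u: "\<And>x. (u has_real_derivative u' x) (at x)" "\<And>x. (u' has_real_derivative u'' x) (at x)"
    and eq: "\<And>x. u'' x = 2 * ((((x + c)\<^sup>2 - 1) / 2 + m - l) * u x + \<Delta> * v x)"
    and cv: "continuous_on UNIV v" and eb: "exp_bounded u" "exp_bounded u'" "exp_bounded v"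
  shows "(real n + m - l) * (LBINT x. u x * herm n (x + c)) + \<Delta> * (LBINT x. v x * herm n (x + c)) = 0"
proof -
  have cu: "continuous_on UNIV u" using u(1) by (meson DERIV_continuous continuous_at_imp_continuous_on)
  have cu'': "continuous_on UNIV u''" unfolding eq by (intro continuous_intros cu cv) auto
  have eu'': "exp_bounded u''" unfolding eq[abs_def]
    by (intro exp_bounded_mult exp_bounded_add exp_bounded_diff exp_bounded_divide exp_bounded_power2 eb) auto
  have d: "((\<lambda>x. u (x - c)) has_real_derivative u' (x - c)) (at x)" "((\<lambda>x. u' (x - c)) has_real_derivative u'' (x - c)) (at x)" for x
    using u(1)[of "x + - c"] u(2)[of "x + - c"] unfolding DERIV_shift by simp_all
  have "(LBINT x. u (x - c) * ((x\<^sup>2 - (2 * real n + 1)) * herm n x)) = (LBINT x. u'' (x - c) * herm n x)"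
    by (rule herm_weak_second_derivative[OF d]) (intro continuous_exp_bounded_shift cu'' eu'' exp_bounded_shift[of _ "- c", simplified] eb)+
  then have "(LBINT x. u x * (((x + c)\<^sup>2 - (2 * real n + 1)) * herm n (x + c))) = (LBINT x. u'' x * herm n (x + c))"
    using lborel_integral_shift[of "\<lambda>x. u (x - c) * ((x\<^sup>2 - (2 * real n + 1)) * herm n x)" c]
      lborel_integral_shift[of "\<lambda>x. u'' (x - c) * herm n x" c] by simp
  also have "\<dots> = (LBINT x. u x * (((x + c)\<^sup>2 - (2 * real n + 1)) * herm n (x + c)))
       + 2 * ((real n + m - l) * (LBINT x. u x * herm n (x + c)) + \<Delta> * (LBINT x. v x * herm n (x + c)))"
    unfolding eq by (rule oscillator_integrals[OF cu eb(1) cv eb(3)])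
  finally show ?thesis by simp
qed

text \<open>The coefficient relation states that the required second derivative \<open>k\<close> is
  the weak one; \<open>weak_solution_regular\<close> makes it classical.\<close>

lemma coef_imp_component_equation:
  assumes cu: "continuous_on UNIV u" and eu: "exp_bounded u" and cv: "continuous_on UNIV v" and ev: "exp_bounded v"
    and displaced_coef: "\<And>n. (real n + m - l) * (LBINT x. u x * herm n (x + c)) + \<Delta> * (LBINT x. v x * herm n (x + c)) = 0"
  shows "\<exists>u'. \<forall>x. (u has_real_derivative u' x) (at x) \<and>
     (u' has_real_derivative 2 * ((((x + c)\<^sup>2 - 1) / 2 + m - l) * u x + \<Delta> * v x)) (at x)"
proof -
  define k where "k x = 2 * ((((x + c)\<^sup>2 - 1) / 2 + m - l) * u x + \<Delta> * v x)" for x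
  have ck: "continuous_on UNIV k" unfolding k_def[abs_def] by (intro continuous_intros cu cv) auto
  have ek: "exp_bounded k" unfolding k_def[abs_def]
    by (intro exp_bounded_mult exp_bounded_add exp_bounded_diff exp_bounded_divide exp_bounded_power2 eu ev) auto
  have "\<exists>w'. \<forall>x. ((\<lambda>x. u (x - c)) has_real_derivative w' x) (at x) \<and> (w' has_real_derivative k (x - c)) (at x)"
  proof (rule weak_solution_regular)
    fix n
    have "(LBINT x. u x * (((x + c)\<^sup>2 - (2 * real n + 1)) * herm n (x + c))) = (LBINT x. k x * herm n (x + c))"
      unfolding k_def oscillator_integrals[OF cu eu cv ev] displaced_coef by simp
    then show "(LBINT x. u (x - c) * ((x\<^sup>2 - (2 * real n + 1)) * herm n x)) = (LBINT x. k (x - c) * herm n x)"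
      using lborel_integral_shift[of "\<lambda>x. u (x - c) * ((x\<^sup>2 - (2 * real n + 1)) * herm n x)" c]
        lborel_integral_shift[of "\<lambda>x. k (x - c) * herm n x" c] by simp
  qed (intro continuous_exp_bounded_shift cu eu ck ek)+
  then obtain w' where w: "\<And>x. ((\<lambda>x. u (x - c)) has_real_derivative w' x) (at x)" "\<And>x. (w' has_real_derivative k (x - c)) (at x)"
    by blast
  have "(u has_real_derivative w' (x + c)) (at x)" "((\<lambda>x. w' (x + c)) has_real_derivative k x) (at x)" for x
    using w(1)[of "x + c"] w(2)[of "x + c"] unfolding DERIV_shift by simp_all
  then show ?thesis unfolding k_def[symmetric] by (intro exI[of _ "\<lambda>x. w' (x + c)"]) simp
qed

text \<open>
  Applied to the derivative of a solution; estimating $|u| \le 1 + u^2$ makes the right-hand side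
  of the equation locally integrable with polynomial growth.
\<close>

lemma exp_bounded_of_square_integrable:
  fixes f f' u v :: "real \<Rightarrow> real"
  assumes d: "\<And>x. (f has_real_derivative f' x) (at x)" and K: "K \<ge> 0"
    and b: "\<And>t. \<bar>f' t\<bar> \<le> K * (1 + t\<^sup>2) * (2 + (u t)\<^sup>2 + (v t)\<^sup>2)"
    and cu: "continuous_on UNIV u" and cv: "continuous_on UNIV v"
    and iu: "integrable lborel (\<lambda>t. (u t)\<^sup>2)" and iv: "integrable lborel (\<lambda>t. (v t)\<^sup>2)"
  shows "exp_bounded f"
proof -
  define I where "I = (LBINT t. (u t)\<^sup>2 + (v t)\<^sup>2)"
  have I: "((\<lambda>t. (u t)\<^sup>2 + (v t)\<^sup>2) has_integral I) UNIV"
    unfolding I_def using iu iv by (intro has_integral_integral_lborel) simp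
  have step: "\<bar>f q - f p\<bar> \<le> K * (1 + X\<^sup>2) * (2 * (q - p) + I)" if pq: "p \<le> q" "\<bar>p\<bar> \<le> X" "\<bar>q\<bar> \<le> X" for p q X
  proof -
    have f: "(f' has_integral (f q - f p)) {p..q}"
      using pq(1) d by (intro fundamental_theorem_of_calculus)
        (auto simp: has_real_derivative_iff_has_vector_derivative intro: has_vector_derivative_at_within)
    have "(\<lambda>t. (u t)\<^sup>2 + (v t)\<^sup>2) integrable_on {p..q}"
      by (intro integrable_continuous_real continuous_intros continuous_on_subset[OF cu] continuous_on_subset[OF cv]) auto
    then obtain j where j: "((\<lambda>t. (u t)\<^sup>2 + (v t)\<^sup>2) has_integral j) {p..q}" by blast
    have jI: "j \<le> I" by (rule has_integral_subset_le[OF subset_UNIV j I]) simp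
    have "((\<lambda>t. 2 + ((u t)\<^sup>2 + (v t)\<^sup>2)) has_integral (2 * (q - p) + j)) {p..q}"
      using has_integral_add[OF has_integral_const_real[of 2 p q] j] pq(1) by (simp add: mult.commute)
    from has_integral_mult_right[OF this, of "K * (1 + X\<^sup>2)"]
    have g: "((\<lambda>t. K * (1 + X\<^sup>2) * (2 + ((u t)\<^sup>2 + (v t)\<^sup>2))) has_integral K * (1 + X\<^sup>2) * (2 * (q - p) + j)) {p..q}" .
    have le: "\<bar>f' t\<bar> \<le> K * (1 + X\<^sup>2) * (2 + ((u t)\<^sup>2 + (v t)\<^sup>2))" if "t \<in> {p..q}" for t
    proof -
      have "\<bar>t\<bar> \<le> \<bar>X\<bar>" using that pq by auto
      then have "t\<^sup>2 \<le> X\<^sup>2" by (simp add: abs_le_square_iff)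
      then have "K * (1 + t\<^sup>2) * (2 + (u t)\<^sup>2 + (v t)\<^sup>2) \<le> K * (1 + X\<^sup>2) * (2 + (u t)\<^sup>2 + (v t)\<^sup>2)"
        using K by (intro mult_right_mono mult_left_mono) auto
      then show ?thesis using b[of t] by (simp add: add.assoc)
    qed
    have "f q - f p \<le> K * (1 + X\<^sup>2) * (2 * (q - p) + j)"
      by (rule has_integral_le[OF f g]) (use le in \<open>auto simp: abs_le_iff\<close>)
    moreover have "- (f q - f p) \<le> K * (1 + X\<^sup>2) * (2 * (q - p) + j)"
      by (rule has_integral_le[OF has_integral_neg[OF f] g]) (use le in \<open>auto simp: abs_le_iff\<close>)
    moreover have "K * (1 + X\<^sup>2) * (2 * (q - p) + j) \<le> K * (1 + X\<^sup>2) * (2 * (q - p) + I)"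
      using K jI by (intro mult_left_mono) auto
    ultimately show ?thesis by linarith
  qed
  have bound: "\<bar>f x\<bar> \<le> \<bar>f 0\<bar> + K * (1 + x\<^sup>2) * (2 * \<bar>x\<bar> + I)" for x
    using step[of 0 x "\<bar>x\<bar>"] step[of x 0 "\<bar>x\<bar>"] by (cases "0 \<le> x") auto
  have ea: "exp_bounded (\<lambda>x::real. \<bar>x\<bar>)" using exp_bounded_ident unfolding exp_bounded_def by simp
  have "exp_bounded (\<lambda>x. \<bar>f 0\<bar> + K * (1 + x\<^sup>2) * (2 * \<bar>x\<bar> + I))"
    by (intro exp_bounded_add exp_bounded_mult exp_bounded_power2 ea exp_bounded_const exp_bounded_ident)
  then obtain C k where C: "\<And>x. \<bar>\<bar>f 0\<bar> + K * (1 + x\<^sup>2) * (2 * \<bar>x\<bar> + I)\<bar> \<le> C * exp (k * \<bar>x\<bar>)"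
    unfolding exp_bounded_def by blast
  show ?thesis
  proof (rule exp_boundedI)
    show "\<bar>f x\<bar> \<le> C * exp (k * \<bar>x\<bar>)" for x using bound[of x] C[of x] by linarith
  qed
qed

text \<open>
  The eigenvalue equation in the variables $u = \psi_1 + \psi_2$ and $v = \psi_1 - \psi_2$, with
  $c = \sqrt 2 g$, $m = N + \varepsilon$, $m' = N - \varepsilon$ and $l = E + g^2 + N$.
\<close>

definition sector_solution :: "real \<Rightarrow> real \<Rightarrow> real \<Rightarrow> real \<Rightarrow> real \<Rightarrow> (real \<Rightarrow> real) \<Rightarrow> (real \<Rightarrow> real) \<Rightarrow> bool" where
  "sector_solution \<Delta> c m m' l u v \<longleftrightarrow> (\<exists>u' v'. \<forall>x. (u has_real_derivative u' x) (at x) \<and> (v has_real_derivative v' x) (at x) \<and>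
     (u' has_real_derivative 2 * ((((x + c)\<^sup>2 - 1) / 2 + m - l) * u x + \<Delta> * v x)) (at x) \<and>
     (v' has_real_derivative 2 * ((((x - c)\<^sup>2 - 1) / 2 + m' - l) * v x + \<Delta> * u x)) (at x))
   \<and> integrable lborel (\<lambda>x. (u x)\<^sup>2) \<and> integrable lborel (\<lambda>x. (v x)\<^sup>2)"

text \<open>The right-hand side is shaped to fit the growth hypothesis of
  \<open>exp_bounded_of_square_integrable\<close>.\<close>

lemma potential_bound:
  fixes a b :: real
  shows "\<bar>2 * ((((x + c)\<^sup>2 - 1) / 2 + m) * a + \<Delta> * b)\<bar> \<le> 2 * (1 + c\<^sup>2 + \<bar>m\<bar> + \<bar>\<Delta>\<bar>) * (1 + x\<^sup>2) * (2 + a\<^sup>2 + b\<^sup>2)"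
proof -
  have ab: "\<bar>a\<bar> \<le> 2 + a\<^sup>2 + b\<^sup>2" "\<bar>b\<bar> \<le> 2 + a\<^sup>2 + b\<^sup>2"
  proof -
    have "\<bar>y\<bar> \<le> 1 + y\<^sup>2" for y :: real
    proof -
      have "0 \<le> (\<bar>y\<bar> - 1)\<^sup>2" by simp
      then show ?thesis unfolding power2_diff power2_abs by simp
    qed
    from this[of a] this[of b] show "\<bar>a\<bar> \<le> 2 + a\<^sup>2 + b\<^sup>2" "\<bar>b\<bar> \<le> 2 + a\<^sup>2 + b\<^sup>2"
      using zero_le_power2[of a] zero_le_power2[of b] by linarith+
  qed
  have q: "\<bar>((x + c)\<^sup>2 - 1) / 2 + m\<bar> \<le> (1 + c\<^sup>2 + \<bar>m\<bar>) * (1 + x\<^sup>2)"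
  proof -
    have "(x + c)\<^sup>2 \<le> 2 * x\<^sup>2 + 2 * c\<^sup>2"
      using zero_le_power2[of "x - c"] by (simp add: power2_sum power2_diff)
    moreover have "0 \<le> (x + c)\<^sup>2" by simp
    moreover have "\<bar>(y - 1) / 2 + m\<bar> \<le> 1 + C + \<bar>m\<bar> + X"
      if "y \<le> 2 * X + 2 * C" "0 \<le> y" "0 \<le> X" "0 \<le> C" for y X C :: real
      using that by (auto simp: abs_if field_simps)
    ultimately have "\<bar>((x + c)\<^sup>2 - 1) / 2 + m\<bar> \<le> 1 + c\<^sup>2 + \<bar>m\<bar> + x\<^sup>2" by simp
    also have "\<dots> \<le> (1 + c\<^sup>2 + \<bar>m\<bar>) * (1 + x\<^sup>2)" by (simp add: algebra_simps)
    finally show ?thesis .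
  qed
  have "\<bar>(((x + c)\<^sup>2 - 1) / 2 + m) * a + \<Delta> * b\<bar> \<le> \<bar>((x + c)\<^sup>2 - 1) / 2 + m\<bar> * \<bar>a\<bar> + \<bar>\<Delta>\<bar> * \<bar>b\<bar>"
    by (metis abs_mult abs_triangle_ineq)
  also have "\<dots> \<le> ((1 + c\<^sup>2 + \<bar>m\<bar>) * (1 + x\<^sup>2)) * (2 + a\<^sup>2 + b\<^sup>2) + (\<bar>\<Delta>\<bar> * (1 + x\<^sup>2)) * (2 + a\<^sup>2 + b\<^sup>2)"
    by (intro add_mono mult_mono q ab) (auto simp: algebra_simps)
  also have "\<dots> = (1 + c\<^sup>2 + \<bar>m\<bar> + \<bar>\<Delta>\<bar>) * (1 + x\<^sup>2) * (2 + a\<^sup>2 + b\<^sup>2)" by (simp only: distrib_right)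
  finally show ?thesis unfolding abs_mult abs_numeral mult.assoc by simp
qed

text \<open>The equation bounds the second derivatives, so the first derivatives grow at most
  exponentially, and then so do the functions as their antiderivatives. No decay at infinity has to
  be extracted.\<close>

lemma sector_solutionE:
  assumes "sector_solution \<Delta> c m m' l u v"
  obtains u' v' where
    "\<And>x. (u has_real_derivative u' x) (at x)"
    "\<And>x. (v has_real_derivative v' x) (at x)"
    "\<And>x. (u' has_real_derivative 2 * ((((x + c)\<^sup>2 - 1) / 2 + m - l) * u x + \<Delta> * v x)) (at x)"
    "\<And>x. (v' has_real_derivative 2 * ((((x - c)\<^sup>2 - 1) / 2 + m' - l) * v x + \<Delta> * u x)) (at x)"
    "integrable lborel (\<lambda>x. (u x)\<^sup>2)" "integrable lborel (\<lambda>x. (v x)\<^sup>2)"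
    "exp_bounded u" "exp_bounded v" "exp_bounded u'" "exp_bounded v'"
    "continuous_on UNIV u" "continuous_on UNIV v"
proof -
  obtain u' v' where d: "\<And>x. (u has_real_derivative u' x) (at x)" "\<And>x. (v has_real_derivative v' x) (at x)"
    "\<And>x. (u' has_real_derivative 2 * ((((x + c)\<^sup>2 - 1) / 2 + m - l) * u x + \<Delta> * v x)) (at x)"
    "\<And>x. (v' has_real_derivative 2 * ((((x - c)\<^sup>2 - 1) / 2 + m' - l) * v x + \<Delta> * u x)) (at x)"
    using assms unfolding sector_solution_def by blast
  have i: "integrable lborel (\<lambda>x. (u x)\<^sup>2)" "integrable lborel (\<lambda>x. (v x)\<^sup>2)" using assms unfolding sector_solution_def by auto
  have cont: "continuous_on UNIV u" "continuous_on UNIV v"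
    using d(1,2) by (meson DERIV_continuous continuous_at_imp_continuous_on)+
  have eu': "exp_bounded u'"
  proof (rule exp_bounded_of_square_integrable[OF d(3) _ _ cont i])
    show "\<bar>2 * ((((t + c)\<^sup>2 - 1) / 2 + m - l) * u t + \<Delta> * v t)\<bar> \<le> 2 * (1 + c\<^sup>2 + \<bar>m - l\<bar> + \<bar>\<Delta>\<bar>) * (1 + t\<^sup>2) * (2 + (u t)\<^sup>2 + (v t)\<^sup>2)" for t
      using potential_bound[of t c "m - l" "u t" \<Delta> "v t"] by (simp add: add_diff_eq)
  qed simp
  have ev': "exp_bounded v'"
  proof (rule exp_bounded_of_square_integrable[OF d(4) _ _ cont(2,1) i(2,1)])
    show "\<bar>2 * ((((t - c)\<^sup>2 - 1) / 2 + m' - l) * v t + \<Delta> * u t)\<bar> \<le> 2 * (1 + c\<^sup>2 + \<bar>m' - l\<bar> + \<bar>\<Delta>\<bar>) * (1 + t\<^sup>2) * (2 + (v t)\<^sup>2 + (u t)\<^sup>2)" for t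
      using potential_bound[of t "- c" "m' - l" "v t" \<Delta> "u t"] by (simp add: add_diff_eq)
  qed simp
  show ?thesis
    by (rule that[OF d i exp_bounded_antiderivative[OF d(1) eu'] exp_bounded_antiderivative[OF d(2) ev'] eu' ev' cont])
qed

locale aqrm_matrix =
  fixes \<Delta> c N \<epsilon> :: real and B :: "l2 \<Rightarrow> l2" and \<sigma> :: "nat \<Rightarrow> nat" and \<psi> :: "nat \<Rightarrow> l2" and eigval :: "nat \<Rightarrow> real"
  assumes N: "\<Delta> + \<bar>\<epsilon>\<bar> < N" and BW: "(\<lambda>j. coupling_matrix \<Delta> c i j * crd x j) sums crd (B x) i"
    and spec: "l2_eigensequence (uncoupled_eigval N \<epsilon>) B \<Delta> \<psi> eigval \<sigma>"
begin

sublocale l2_eigensequence "uncoupled_eigval N \<epsilon>" B \<Delta> \<psi> eigval \<sigma>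
  by (rule spec)

lemma weighted_summable_of_diag_image:
  assumes "summable (\<lambda>i. (uncoupled_eigval N \<epsilon> i * crd x i)\<^sup>2)"
  shows "weighted_summable x"
  unfolding weighted_summable_def
proof (rule summable_comparison_test'[OF summable_mult[OF assms, of "(2 + 2 / (N - \<bar>\<epsilon>\<bar>))\<^sup>2"]])
  fix i
  have index_le: "real i + 1 \<le> (2 + 2 / (N - \<bar>\<epsilon>\<bar>)) * uncoupled_eigval N \<epsilon> i"
    using index_le_uncoupled_eigval[of \<epsilon> 0 N i] N Delta_nonneg by simp
  have "((real i + 1) * crd x i)\<^sup>2 = (real i + 1)\<^sup>2 * (crd x i)\<^sup>2" by (simp add: power_mult_distrib)
  also have "\<dots> \<le> ((2 + 2 / (N - \<bar>\<epsilon>\<bar>)) * uncoupled_eigval N \<epsilon> i)\<^sup>2 * (crd x i)\<^sup>2"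
    by (intro mult_right_mono power_mono index_le) auto
  finally show "norm (((real i + 1) * crd x i)\<^sup>2) \<le> (2 + 2 / (N - \<bar>\<epsilon>\<bar>))\<^sup>2 * (uncoupled_eigval N \<epsilon> i * crd x i)\<^sup>2"
    by (simp add: power_mult_distrib mult.assoc)
qed

lemma eigenvec_weighted_summable: "eigenvec x l \<Longrightarrow> weighted_summable x"
  by (rule weighted_summable_of_diag_image) (use summable_crd_sq[of "l *\<^sub>R x - B x"] in \<open>simp add: eigenvec_iff_diag_image diag_image_def\<close>)

text \<open>Identifies B with the exchange of components on synthesised pairs, by integrating the
  series term by term.\<close>

lemma coupling_term_eq_crd:
  assumes "weighted_summable x"
  shows "\<Delta> * displaced_coef c (synth_right c x) (synth_left c x) i = crd (B x) i"
proof -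
  have "(\<lambda>j. crd x j * ((LBINT t. left_fun c j t * right_fun c i t) + (LBINT t. right_fun c j t * left_fun c i t))) sums
     ((LBINT t. synth_left c x t * right_fun c i t) + (LBINT t. synth_right c x t * left_fun c i t))"
    by (intro synth_integral assms continuous_left_fun continuous_right_fun rapid_decay_left_fun rapid_decay_right_fun)
  from sums_mult[OF this, of \<Delta>] have "(\<lambda>j. coupling_matrix \<Delta> c i j * crd x j) sums (\<Delta> * displaced_coef c (synth_right c x) (synth_left c x) i)"
    by (simp add: coupling_matrix_def displaced_coef_def mult_ac add.commute)
  then show ?thesis using BW sums_unique2 by blast
qed

lemma eigenvec_imp_sector_solution:
  assumes e: "eigenvec x l"
  shows "sector_solution \<Delta> c (N + \<epsilon>) (N - \<epsilon>) l (synth_left c x) (synth_right c x)"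
proof -
  note f = eigenvec_weighted_summable[OF e]
  note U = synth_props[OF f]
  have eq: "(uncoupled_eigval N \<epsilon> i - l) * displaced_coef c (synth_left c x) (synth_right c x) i + \<Delta> * displaced_coef c (synth_right c x) (synth_left c x) i = 0" for i
    using e unfolding eigenvec_def displaced_coef_synth[OF f] coupling_term_eq_crd[OF f] by (simp add: algebra_simps)
  have "\<exists>u'. \<forall>t. (synth_left c x has_real_derivative u' t) (at t) \<and>
     (u' has_real_derivative 2 * ((((t + c)\<^sup>2 - 1) / 2 + (N + \<epsilon>) - l) * synth_left c x t + \<Delta> * synth_right c x t)) (at t)"
    using eq[of "2 * n" for n] by (intro coef_imp_component_equation U) (simp add: displaced_coef_even uncoupled_eigval_def add.assoc)
  moreover have "\<exists>v'. \<forall>t. (synth_right c x has_real_derivative v' t) (at t) \<and>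
     (v' has_real_derivative 2 * ((((t + - c)\<^sup>2 - 1) / 2 + (N - \<epsilon>) - l) * synth_right c x t + \<Delta> * synth_left c x t)) (at t)"
    using eq[of "Suc (2 * n)" for n] by (intro coef_imp_component_equation U) (simp add: displaced_coef_odd uncoupled_eigval_def add_diff_eq)
  ultimately show ?thesis
    unfolding sector_solution_def using synth_square_integrable[OF f] by simp blast
qed

lemma sector_solution_imp_eigenvec:
  assumes "sector_solution \<Delta> c (N + \<epsilon>) (N - \<epsilon>) l u v"
  obtains x where "eigenvec x l" "u = synth_left c x" "v = synth_right c x"
proof -
  obtain u' v' where r:
    "\<And>x. (u has_real_derivative u' x) (at x)"
    "\<And>x. (v has_real_derivative v' x) (at x)"
    "\<And>x. (u' has_real_derivative 2 * ((((x + c)\<^sup>2 - 1) / 2 + (N + \<epsilon>) - l) * u x + \<Delta> * v x)) (at x)"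
    "\<And>x. (v' has_real_derivative 2 * ((((x - c)\<^sup>2 - 1) / 2 + (N - \<epsilon>) - l) * v x + \<Delta> * u x)) (at x)"
    and i: "integrable lborel (\<lambda>x. (u x)\<^sup>2)" "integrable lborel (\<lambda>x. (v x)\<^sup>2)"
    and eb: "exp_bounded u" "exp_bounded v" "exp_bounded u'" "exp_bounded v'"
    and cont: "continuous_on UNIV u" "continuous_on UNIV v"
    by (rule sector_solutionE[OF assms]) (rule that)
  define x where "x = Abs_l2 (displaced_coef c u v)"
  have cx: "crd x j = displaced_coef c u v j" for j
    unfolding x_def using bessel[OF cont(1) eb(1) cont(2) eb(2) i] by (simp add: Abs_l2_inverse)
  have ce: "(real n + (N + \<epsilon>) - l) * (LBINT x. u x * herm n (x + c)) + \<Delta> * (LBINT x. v x * herm n (x + c)) = 0" for n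
    by (rule component_equation_imp_coef[OF r(1) r(3) refl cont(2) eb(1,3,2)])
  have co: "(real n + (N - \<epsilon>) - l) * (LBINT x. v x * herm n (x + - c)) + \<Delta> * (LBINT x. u x * herm n (x + - c)) = 0" for n
    by (rule component_equation_imp_coef[OF r(2) r(4) _ cont(1) eb(2,4,1)]) simp
  have eq: "(uncoupled_eigval N \<epsilon> j - l) * displaced_coef c u v j + \<Delta> * displaced_coef c v u j = 0" for j
  proof (cases "even j")
    case True
    then obtain n where "j = 2 * n" by blast
    then show ?thesis using ce[of n] by (simp add: displaced_coef_even uncoupled_eigval_def add.assoc)
  next
    case False
    then obtain n where "j = Suc (2 * n)" using oddE by fastforce
    then show ?thesis using co[of n] by (simp add: displaced_coef_odd uncoupled_eigval_def add_diff_eq)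
  qed
  \<comment> \<open>Bessel's inequality for the exchanged pair makes the coupling term
    square-summable. The equation then puts \<open>x\<close> in the domain of D before B can be
    identified with the coupling, which avoids a circle.\<close>
  define y where "y = Abs_l2 (displaced_coef c v u)"
  have cy: "crd y j = displaced_coef c v u j" for j
    unfolding y_def using bessel[OF cont(2) eb(2) cont(1) eb(1) i(2,1)] by (simp add: Abs_l2_inverse)
  have "uncoupled_eigval N \<epsilon> j * crd x j = crd (l *\<^sub>R x - \<Delta> *\<^sub>R y) j" for j
    using eq[of j] by (simp add: cx cy algebra_simps)
  then have f: "weighted_summable x" using summable_crd_sq[of "l *\<^sub>R x - \<Delta> *\<^sub>R y"] by (intro weighted_summable_of_diag_image) simp
  have uv: "u = synth_left c x" "v = synth_right c x"
    using expansion_unique[OF cont(1) eb(1) cont(2) eb(2) f cx[symmetric]] by auto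
  have "eigenvec x l" unfolding eigenvec_def
    using eq cx coupling_term_eq_crd[OF f] unfolding uv[symmetric] by (simp add: algebra_simps)
  then show ?thesis using that uv by blast
qed

end

section \<open>Complex spinors and the real two-well system\<close>

text \<open>Real coefficients let real and imaginary parts solve the system separately; the
  parameter \<open>r\<close> treats both at once.\<close>

lemma aqrm_solution_imp_sector_solution:
  fixes r :: "complex \<Rightarrow> real"
  assumes sol: "aqrm_solution \<Delta> g \<epsilon> E \<psi>1 \<psi>2" and r: "r = Re \<or> r = Im"
  shows "sector_solution \<Delta> (sqrt 2 * g) (N + \<epsilon>) (N - \<epsilon>) (E + g\<^sup>2 + N) (\<lambda>x. r (\<psi>1 x) + r (\<psi>2 x)) (\<lambda>x. r (\<psi>1 x) - r (\<psi>2 x))"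
proof -
  define c where "c = sqrt 2 * g"
  have bl: "bounded_linear r" using r bounded_linear_Re bounded_linear_Im by auto
  have rm: "r (complex_of_real a * z) = a * r z" for a z using r by auto
  have ra: "r (y + z) = r y + r z" "r (- y / 2) = - r y / 2" for y z using r by auto
  obtain p p' q q' where d: "\<And>x. (\<psi>1 has_vector_derivative p x) (at x)" "\<And>x. (p has_vector_derivative p' x) (at x)"
    "\<And>x. (\<psi>2 has_vector_derivative q x) (at x)" "\<And>x. (q has_vector_derivative q' x) (at x)"
    and e1: "\<And>x. - p' x / 2 + complex_of_real ((x\<^sup>2 - 1) / 2 + \<Delta>) * \<psi>1 x
               + complex_of_real (sqrt 2 * g * x + \<epsilon>) * \<psi>2 x = complex_of_real E * \<psi>1 x"
    and e2: "\<And>x. - q' x / 2 + complex_of_real ((x\<^sup>2 - 1) / 2 - \<Delta>) * \<psi>2 x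
               + complex_of_real (sqrt 2 * g * x + \<epsilon>) * \<psi>1 x = complex_of_real E * \<psi>2 x"
    and int: "(\<lambda>x. (cmod (\<psi>1 x))\<^sup>2) integrable_on UNIV" "(\<lambda>x. (cmod (\<psi>2 x))\<^sup>2) integrable_on UNIV"
    using sol unfolding aqrm_solution_def by blast
  have dr: "((\<lambda>x. r (f x)) has_real_derivative r (f' x)) (at x)" if "\<And>x. (f has_vector_derivative f' x) (at x)" for f f' and x :: real
    using bounded_linear.has_vector_derivative[OF bl that] by (simp add: has_real_derivative_iff_has_vector_derivative)
  have q1: "r (p' x) = 2 * (((x\<^sup>2 - 1) / 2 + \<Delta> - E) * r (\<psi>1 x) + (c * x + \<epsilon>) * r (\<psi>2 x))" for x
    using arg_cong[OF e1[of x], of r] unfolding ra rm c_def by (simp add: algebra_simps)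
  have q2: "r (q' x) = 2 * (((x\<^sup>2 - 1) / 2 - \<Delta> - E) * r (\<psi>2 x) + (c * x + \<epsilon>) * r (\<psi>1 x))" for x
    using arg_cong[OF e2[of x], of r] unfolding ra rm c_def by (simp add: algebra_simps)
  \<comment> \<open>Half of (x + c)^2 is x^2 / 2 + c x + g^2; the last term is the one compensated
    by the shift of \<open>E\<close> by g^2.\<close>
  have c2: "c\<^sup>2 = 2 * g\<^sup>2" by (simp add: c_def power_mult_distrib)
  have cont: "continuous_on UNIV f" if "\<And>x. (f has_vector_derivative f' x) (at x)" for f f' :: "real \<Rightarrow> complex"
    using that by (meson continuous_at_imp_continuous_on has_vector_derivative_continuous)
  have cr: "continuous_on UNIV (\<lambda>x. r (f x))" if "continuous_on UNIV f" for f :: "real \<Rightarrow> complex"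
    using that by (rule bounded_linear.continuous_on[OF bl])
  have sq: "integrable lborel (\<lambda>x. (cmod (f x))\<^sup>2)"
    if "continuous_on UNIV f" "(\<lambda>x. (cmod (f x))\<^sup>2) integrable_on UNIV" for f :: "real \<Rightarrow> complex"
  proof -
    have "(\<lambda>x. (cmod (f x))\<^sup>2) absolutely_integrable_on UNIV"
      using that(2) by (intro nonnegative_absolutely_integrable_1) auto
    then have "integrable lebesgue (\<lambda>x. (cmod (f x))\<^sup>2)" by (simp add: set_integrable_def)
    moreover have "(\<lambda>x. (cmod (f x))\<^sup>2) \<in> borel_measurable lborel"
      using that(1) by (simp add: borel_measurable_continuous_onI continuous_on_norm continuous_on_power)
    ultimately show ?thesis by (simp add: integrable_completion)
  qed
  note i = Bochner_Integration.integrable_add[OF sq[OF cont[OF d(1)] int(1)] sq[OF cont[OF d(3)] int(2)]]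
  have bound: "(r y + s * r z)\<^sup>2 \<le> 2 * ((cmod y)\<^sup>2 + (cmod z)\<^sup>2)" if "s = 1 \<or> s = - 1" for y z and s :: real
  proof -
    have le: "(r y)\<^sup>2 \<le> (cmod y)\<^sup>2" for y
      using r abs_Re_le_cmod[of y] abs_Im_le_cmod[of y] by (auto simp: power2_le_iff_abs_le abs_le_square_iff[symmetric])
    have "(r y + s * r z)\<^sup>2 + (r y - s * r z)\<^sup>2 = 2 * ((r y)\<^sup>2 + (r z)\<^sup>2)"
      using that by (auto simp: power2_eq_square algebra_simps)
    then have "(r y + s * r z)\<^sup>2 \<le> 2 * ((r y)\<^sup>2 + (r z)\<^sup>2)"
      using zero_le_power2[of "r y - s * r z"] by linarith
    also have "\<dots> \<le> 2 * ((cmod y)\<^sup>2 + (cmod z)\<^sup>2)" using le[of y] le[of z] by simp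
    finally show ?thesis .
  qed
  have "integrable lborel (\<lambda>x. (r (\<psi>1 x) + s * r (\<psi>2 x))\<^sup>2)" if "s = 1 \<or> s = - 1" for s
  proof (rule Bochner_Integration.integrable_bound[OF integrable_mult_right[OF i, of 2]])
    show "(\<lambda>x. (r (\<psi>1 x) + s * r (\<psi>2 x))\<^sup>2) \<in> borel_measurable lborel"
      by (simp, intro borel_measurable_continuous_onI continuous_intros cr cont[OF d(1)] cont[OF d(3)])
    show "AE x in lborel. norm ((r (\<psi>1 x) + s * r (\<psi>2 x))\<^sup>2) \<le> norm (2 * ((cmod (\<psi>1 x))\<^sup>2 + (cmod (\<psi>2 x))\<^sup>2))"
      using bound[OF that] by (intro AE_I2) simp
  qed
  from this[of 1] this[of "- 1"] have
    "integrable lborel (\<lambda>x. (r (\<psi>1 x) + r (\<psi>2 x))\<^sup>2)" "integrable lborel (\<lambda>x. (r (\<psi>1 x) - r (\<psi>2 x))\<^sup>2)" by simp_all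
  moreover have "((\<lambda>x. r (\<psi>1 x) + r (\<psi>2 x)) has_real_derivative r (p x) + r (q x)) (at x)"
    "((\<lambda>x. r (\<psi>1 x) - r (\<psi>2 x)) has_real_derivative r (p x) - r (q x)) (at x)" for x
    by (intro DERIV_add DERIV_diff dr d)+
  moreover have "r (p' x) + r (q' x) = 2 * ((((x + c)\<^sup>2 - 1) / 2 + (N + \<epsilon>) - (E + g\<^sup>2 + N)) * (r (\<psi>1 x) + r (\<psi>2 x)) + \<Delta> * (r (\<psi>1 x) - r (\<psi>2 x)))"
    "r (p' x) - r (q' x) = 2 * ((((x - c)\<^sup>2 - 1) / 2 + (N - \<epsilon>) - (E + g\<^sup>2 + N)) * (r (\<psi>1 x) - r (\<psi>2 x)) + \<Delta> * (r (\<psi>1 x) + r (\<psi>2 x)))" for x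
    unfolding q1 q2 power2_sum[of x c] power2_diff[of x c] c2 by (simp_all add: field_simps)
  moreover have "((\<lambda>x. r (p x) + r (q x)) has_real_derivative r (p' x) + r (q' x)) (at x)"
    "((\<lambda>x. r (p x) - r (q x)) has_real_derivative r (p' x) - r (q' x)) (at x)" for x
    by (intro DERIV_add DERIV_diff dr d)+
  ultimately show ?thesis unfolding sector_solution_def c_def[symmetric]
    by (intro conjI exI[of _ "\<lambda>x. r (p x) + r (q x)"] exI[of _ "\<lambda>x. r (p x) - r (q x)"] allI) (simp_all only:)
qed

lemma sector_solution_imp_aqrm_solution:
  assumes sol: "sector_solution \<Delta> (sqrt 2 * g) (N + \<epsilon>) (N - \<epsilon>) (E + g\<^sup>2 + N) u v"
  shows "aqrm_solution \<Delta> g \<epsilon> E (\<lambda>x. complex_of_real ((u x + v x) / 2)) (\<lambda>x. complex_of_real ((u x - v x) / 2))"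
proof -
  define c where "c = sqrt 2 * g"
  have c2: "c\<^sup>2 = 2 * g\<^sup>2" by (simp add: c_def power_mult_distrib)
  obtain u' v' where r:
    "\<And>x. (u has_real_derivative u' x) (at x)"
    "\<And>x. (v has_real_derivative v' x) (at x)"
    "\<And>x. (u' has_real_derivative 2 * ((((x + c)\<^sup>2 - 1) / 2 + (N + \<epsilon>) - (E + g\<^sup>2 + N)) * u x + \<Delta> * v x)) (at x)"
    "\<And>x. (v' has_real_derivative 2 * ((((x - c)\<^sup>2 - 1) / 2 + (N - \<epsilon>) - (E + g\<^sup>2 + N)) * v x + \<Delta> * u x)) (at x)"
    and i: "integrable lborel (\<lambda>x. (u x)\<^sup>2)" "integrable lborel (\<lambda>x. (v x)\<^sup>2)"
    and eb: "exp_bounded u" "exp_bounded v" "exp_bounded u'" "exp_bounded v'"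
    and cont: "continuous_on UNIV u" "continuous_on UNIV v"
    by (rule sector_solutionE[OF sol[folded c_def]]) (rule that)
  define k where "k x = 2 * ((((x + c)\<^sup>2 - 1) / 2 + (N + \<epsilon>) - (E + g\<^sup>2 + N)) * u x + \<Delta> * v x)" for x
  define m where "m x = 2 * ((((x - c)\<^sup>2 - 1) / 2 + (N - \<epsilon>) - (E + g\<^sup>2 + N)) * v x + \<Delta> * u x)" for x
  have dc: "((\<lambda>x. complex_of_real ((f x + s * h x) / 2)) has_vector_derivative complex_of_real ((f' x + s * h' x) / 2)) (at x)"
    if "\<And>x. (f has_real_derivative f' x) (at x)" "\<And>x. (h has_real_derivative h' x) (at x)" for f f' h h' and x s :: real
  proof -
    have "((\<lambda>x. (f x + s * h x) / 2) has_real_derivative (f' x + s * h' x) / 2) (at x)"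
      by (intro DERIV_cdivide DERIV_add DERIV_cmult that)
    then show ?thesis
      unfolding has_real_derivative_iff_has_vector_derivative
      by (rule bounded_linear.has_vector_derivative[OF bounded_linear_of_real])
  qed
  note dp = dc[where s = 1, simplified mult_1_left] and dm = dc[where s = "- 1", simplified mult_minus1 add_uminus_conv_diff]
  note d1 = dp[OF r(1,2)] dp[OF r(3,4), folded k_def m_def] dm[OF r(1,2)] dm[OF r(3,4), folded k_def m_def]
  have e1: "- ((k x + m x) / 2) / 2 + ((x\<^sup>2 - 1) / 2 + \<Delta>) * ((u x + v x) / 2) + (sqrt 2 * g * x + \<epsilon>) * ((u x - v x) / 2) = E * ((u x + v x) / 2)" for x
    unfolding k_def m_def c_def[symmetric] power2_sum[of x c] power2_diff[of x c] c2 by (simp add: field_simps)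
  have e2: "- ((k x - m x) / 2) / 2 + ((x\<^sup>2 - 1) / 2 - \<Delta>) * ((u x - v x) / 2) + (sqrt 2 * g * x + \<epsilon>) * ((u x + v x) / 2) = E * ((u x - v x) / 2)" for x
    unfolding k_def m_def c_def[symmetric] power2_sum[of x c] power2_diff[of x c] c2 by (simp add: field_simps)
  have E1: "- complex_of_real ((k x + m x) / 2) / 2 + complex_of_real ((x\<^sup>2 - 1) / 2 + \<Delta>) * complex_of_real ((u x + v x) / 2) + complex_of_real (sqrt 2 * g * x + \<epsilon>) * complex_of_real ((u x - v x) / 2) = complex_of_real E * complex_of_real ((u x + v x) / 2)" for x
    using arg_cong[OF e1[of x], of complex_of_real] by (simp only: of_real_add of_real_minus of_real_mult of_real_divide of_real_numeral)
  have E2: "- complex_of_real ((k x - m x) / 2) / 2 + complex_of_real ((x\<^sup>2 - 1) / 2 - \<Delta>) * complex_of_real ((u x - v x) / 2) + complex_of_real (sqrt 2 * g * x + \<epsilon>) * complex_of_real ((u x + v x) / 2) = complex_of_real E * complex_of_real ((u x - v x) / 2)" for x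
    using arg_cong[OF e2[of x], of complex_of_real] by (simp only: of_real_add of_real_minus of_real_mult of_real_divide of_real_numeral)
  have I: "(\<lambda>x. (cmod (complex_of_real (w x / 2)))\<^sup>2) integrable_on UNIV"
    if w: "continuous_on UNIV w" and le: "\<And>x. (w x)\<^sup>2 \<le> 2 * ((u x)\<^sup>2 + (v x)\<^sup>2)" for w
  proof -
    have "integrable lborel (\<lambda>x. (cmod (complex_of_real (w x / 2)))\<^sup>2)"
    proof (rule Bochner_Integration.integrable_bound[OF integrable_mult_right[OF Bochner_Integration.integrable_add[OF i], of 2]])
      show "(\<lambda>x. (cmod (complex_of_real (w x / 2)))\<^sup>2) \<in> borel_measurable lborel"
      proof -
        have m: "f \<in> borel_measurable lborel" if "continuous_on UNIV f" for f :: "real \<Rightarrow> real"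
          using that by (simp add: borel_measurable_continuous_onI)
        show ?thesis by (intro m continuous_intros w) simp
      qed
      have "(w x / 2)\<^sup>2 \<le> 2 * ((u x)\<^sup>2 + (v x)\<^sup>2)" for x
        using order_trans[OF _ le[of x], of "(w x / 2)\<^sup>2"] by (simp add: power_divide)
      then show "AE x in lborel. norm ((cmod (complex_of_real (w x / 2)))\<^sup>2) \<le> norm (2 * ((u x)\<^sup>2 + (v x)\<^sup>2))"
        unfolding norm_of_real power2_abs by (intro AE_I2) simp
    qed
    then show ?thesis by (rule integrable_on_lborel)
  qed
  have le: "(a + b)\<^sup>2 \<le> 2 * (a\<^sup>2 + b\<^sup>2)" "(a - b)\<^sup>2 \<le> 2 * (a\<^sup>2 + b\<^sup>2)" for a b :: real
    using zero_le_power2[of "a - b"] zero_le_power2[of "a + b"] unfolding power2_sum power2_diff by simp_all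
  show ?thesis
    unfolding aqrm_solution_def
    by (intro conjI exI allI) (rule d1 E1 E2 I le continuous_intros cont)+
qed

section \<open>Multiplicities\<close>

locale aqrm_coupling = aqrm_matrix \<Delta> "sqrt 2 * g" N \<epsilon> B \<sigma> \<psi> eigval
  for \<Delta> g N \<epsilon> B \<sigma> \<psi> eigval
begin

definition eigenfun1 :: "nat \<Rightarrow> real \<Rightarrow> complex" where
  "eigenfun1 k t = complex_of_real ((synth_left (sqrt 2 * g) (\<psi> k) t + synth_right (sqrt 2 * g) (\<psi> k) t) / 2)"

definition eigenfun2 :: "nat \<Rightarrow> real \<Rightarrow> complex" where
  "eigenfun2 k t = complex_of_real ((synth_left (sqrt 2 * g) (\<psi> k) t - synth_right (sqrt 2 * g) (\<psi> k) t) / 2)"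

lemma eigenfun_solution: "eigval k = E + g\<^sup>2 + N \<Longrightarrow> aqrm_solution \<Delta> g \<epsilon> E (eigenfun1 k) (eigenfun2 k)"
  unfolding eigenfun1_def[abs_def] eigenfun2_def[abs_def] by (rule sector_solution_imp_aqrm_solution) (use eigenvec_imp_sector_solution[OF psi_eigenvec[of k]] in simp)

lemma real_solution_span:
  assumes "sector_solution \<Delta> (sqrt 2 * g) (N + \<epsilon>) (N - \<epsilon>) l u v"
  obtains d where "\<And>t. u t = (\<Sum>k | eigval k = l. d k * synth_left (sqrt 2 * g) (\<psi> k) t)" "\<And>t. v t = (\<Sum>k | eigval k = l. d k * synth_right (sqrt 2 * g) (\<psi> k) t)"
proof -
  obtain x where x: "eigenvec x l" and uv: "u = synth_left (sqrt 2 * g) x" "v = synth_right (sqrt 2 * g) x"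
    by (rule sector_solution_imp_eigenvec[OF assms]) (rule that)
  have f: "weighted_summable (\<psi> k)" for k by (rule eigenvec_weighted_summable[OF psi_eigenvec])
  have "u t = (\<Sum>k | eigval k = l. (x \<bullet> \<psi> k) * synth_left (sqrt 2 * g) (\<psi> k) t)"
    "v t = (\<Sum>k | eigval k = l. (x \<bullet> \<psi> k) * synth_right (sqrt 2 * g) (\<psi> k) t)" for t
    unfolding uv by (subst eigenvec_expansion[OF x], rule synth_sum[OF f])+
  then show ?thesis by (rule that)
qed

lemma solution_span:
  assumes "aqrm_solution \<Delta> g \<epsilon> E \<phi>1 \<phi>2"
  shows "\<exists>d. \<forall>t. \<phi>1 t = (\<Sum>k | eigval k = E + g\<^sup>2 + N. d k * eigenfun1 k t) \<and> \<phi>2 t = (\<Sum>k | eigval k = E + g\<^sup>2 + N. d k * eigenfun2 k t)"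
proof -
  obtain a where a: "\<And>t. Re (\<phi>1 t) + Re (\<phi>2 t) = (\<Sum>k | eigval k = E + g\<^sup>2 + N. a k * synth_left (sqrt 2 * g) (\<psi> k) t)"
     "\<And>t. Re (\<phi>1 t) - Re (\<phi>2 t) = (\<Sum>k | eigval k = E + g\<^sup>2 + N. a k * synth_right (sqrt 2 * g) (\<psi> k) t)"
    by (rule real_solution_span[OF aqrm_solution_imp_sector_solution[OF assms, of Re]]) (simp, rule that)
  obtain b where b: "\<And>t. Im (\<phi>1 t) + Im (\<phi>2 t) = (\<Sum>k | eigval k = E + g\<^sup>2 + N. b k * synth_left (sqrt 2 * g) (\<psi> k) t)"
     "\<And>t. Im (\<phi>1 t) - Im (\<phi>2 t) = (\<Sum>k | eigval k = E + g\<^sup>2 + N. b k * synth_right (sqrt 2 * g) (\<psi> k) t)"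
    by (rule real_solution_span[OF aqrm_solution_imp_sector_solution[OF assms, of Im]]) (simp, rule that)
  have half: "(\<Sum>k | eigval k = E + g\<^sup>2 + N. a k * ((synth_left (sqrt 2 * g) (\<psi> k) t + s * synth_right (sqrt 2 * g) (\<psi> k) t) / 2))
     = ((\<Sum>k | eigval k = E + g\<^sup>2 + N. a k * synth_left (sqrt 2 * g) (\<psi> k) t) + s * (\<Sum>k | eigval k = E + g\<^sup>2 + N. a k * synth_right (sqrt 2 * g) (\<psi> k) t)) / 2" for a t and s :: real
    by (simp add: sum_divide_distrib[symmetric] sum.distrib distrib_left sum_distrib_left mult.left_commute)
  have p1: "Re (eigenfun1 k t) = (synth_left (sqrt 2 * g) (\<psi> k) t + 1 * synth_right (sqrt 2 * g) (\<psi> k) t) / 2" "Im (eigenfun1 k t) = 0"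
    and p2: "Re (eigenfun2 k t) = (synth_left (sqrt 2 * g) (\<psi> k) t + (- 1) * synth_right (sqrt 2 * g) (\<psi> k) t) / 2" "Im (eigenfun2 k t) = 0" for k t
    unfolding eigenfun1_def eigenfun2_def Re_complex_of_real by simp_all
  \<comment> \<open>The eigenfunctions are real-valued, so the real expansions of the real and
    imaginary parts combine into one with coefficients \<open>Complex (a k) (b k)\<close>.\<close>
  show ?thesis
  proof (intro exI[of _ "\<lambda>k. Complex (a k) (b k)"] allI conjI complex_eqI)
    fix t
    show "Re (\<phi>1 t) = Re (\<Sum>k | eigval k = E + g\<^sup>2 + N. Complex (a k) (b k) * eigenfun1 k t)"
      "Im (\<phi>1 t) = Im (\<Sum>k | eigval k = E + g\<^sup>2 + N. Complex (a k) (b k) * eigenfun1 k t)"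
      unfolding Re_sum Im_sum times_complex.sel complex.sel p1 mult_zero_right diff_zero add_0_left add_0_right half a[symmetric] b[symmetric] by simp_all
    show "Re (\<phi>2 t) = Re (\<Sum>k | eigval k = E + g\<^sup>2 + N. Complex (a k) (b k) * eigenfun2 k t)"
      "Im (\<phi>2 t) = Im (\<Sum>k | eigval k = E + g\<^sup>2 + N. Complex (a k) (b k) * eigenfun2 k t)"
      unfolding Re_sum Im_sum times_complex.sel complex.sel p2 mult_zero_right diff_zero add_0_left add_0_right half a[symmetric] b[symmetric] by simp_all
  qed
qed

text \<open>Real and imaginary parts of the relation pass to \<open>synth_left\<close> and
  \<open>synth_right\<close>. Taking displaced coefficients brings the relation back to the sequence
  space, where the \<open>\<psi> k\<close> are orthonormal.\<close>

lemma eigenfun_independent: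
  assumes "finite A" and z: "\<And>t. (\<Sum>k\<in>A. d k * eigenfun1 k t) = 0" "\<And>t. (\<Sum>k\<in>A. d k * eigenfun2 k t) = 0"
  shows "\<forall>k\<in>A. d k = 0"
proof -
  have real_case: "\<forall>k\<in>A. a k = 0"
    if a: "\<And>t. (\<Sum>k\<in>A. a k * synth_left (sqrt 2 * g) (\<psi> k) t) = 0" "\<And>t. (\<Sum>k\<in>A. a k * synth_right (sqrt 2 * g) (\<psi> k) t) = 0" for a :: "nat \<Rightarrow> real"
  proof
    fix j assume j: "j \<in> A"
    have f: "weighted_summable (\<psi> k)" for k by (rule eigenvec_weighted_summable[OF psi_eigenvec])
    define x where "x = (\<Sum>k\<in>A. a k *\<^sub>R \<psi> k)"
    have "weighted_summable x"
    proof (rule weighted_summable_of_diag_image)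
      have "diag_image x (\<Sum>k\<in>A. a k *\<^sub>R (eigval k *\<^sub>R \<psi> k - B (\<psi> k)))"
        unfolding x_def by (intro diag_image_sum diag_image_scaleR) (use psi_eigenvec eigenvec_iff_diag_image in blast)
      then show "summable (\<lambda>i. (uncoupled_eigval N \<epsilon> i * crd x i)\<^sup>2)"
        unfolding diag_image_def using summable_crd_sq[of "\<Sum>k\<in>A. a k *\<^sub>R (eigval k *\<^sub>R \<psi> k - B (\<psi> k))"] by simp
    qed
    from displaced_coef_synth[OF this, of "sqrt 2 * g"] have "crd x i = 0" for i
      unfolding x_def displaced_coef_def synth_sum[OF f] a by simp
    then have "x = 0" by (intro l2_eqI) simp
    then have "0 = x \<bullet> \<psi> j" by simp
    also have "\<dots> = (\<Sum>k\<in>A. if k = j then a k else 0)"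
      unfolding x_def by (simp add: inner_sum_left psi_inner if_distrib[of "(*) _"] cong: if_cong)
    also have "\<dots> = a j" using assms(1) j by simp
    finally show "a j = 0" by simp
  qed
  have uv: "complex_of_real (synth_left (sqrt 2 * g) (\<psi> k) t) = eigenfun1 k t + eigenfun2 k t" "complex_of_real (synth_right (sqrt 2 * g) (\<psi> k) t) = eigenfun1 k t - eigenfun2 k t" for k t
    unfolding eigenfun1_def eigenfun2_def by (simp_all add: field_simps)
  have s: "(\<Sum>k\<in>A. d k * complex_of_real (synth_left (sqrt 2 * g) (\<psi> k) t)) = 0" "(\<Sum>k\<in>A. d k * complex_of_real (synth_right (sqrt 2 * g) (\<psi> k) t)) = 0" for t
    unfolding uv distrib_left right_diff_distrib sum.distrib sum_subtractf z by simp_all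
  have "\<forall>k\<in>A. Re (d k) = 0"
    by (rule real_case) (use arg_cong[OF s(1), of Re] arg_cong[OF s(2), of Re] in simp_all)
  moreover have "\<forall>k\<in>A. Im (d k) = 0"
    by (rule real_case) (use arg_cong[OF s(1), of Im] arg_cong[OF s(2), of Im] in simp_all)
  ultimately show ?thesis by (simp add: complex_eq_iff)
qed

text \<open>
  The supremum in the definition of the multiplicity is one of natural numbers, meaningful only
  because the set is bounded; it is shown to be \<open>{..card J}\<close>.
\<close>

theorem aqrm_mult_eq_card: "aqrm_mult \<Delta> g \<epsilon> E = card {k. eigval k = E + g\<^sup>2 + N}"
proof -
  define J where "J = {k. eigval k = E + g\<^sup>2 + N}"
  have fJ: "finite J" unfolding J_def by (rule finite_eigval_eq)
  define P where "P n \<longleftrightarrow> (\<exists>\<Phi>1 \<Phi>2 :: nat \<Rightarrow> real \<Rightarrow> complex.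
       (\<forall>i<n. aqrm_solution \<Delta> g \<epsilon> E (\<Phi>1 i) (\<Phi>2 i)) \<and>
       (\<forall>c :: nat \<Rightarrow> complex.
          (\<forall>x. (\<Sum>i<n. c i * \<Phi>1 i x) = 0 \<and> (\<Sum>i<n. c i * \<Phi>2 i x) = 0)
          \<longrightarrow> (\<forall>i<n. c i = 0)))" for n
  have "P n" if n: "n \<le> card J" for n
  proof -
    obtain h where h: "bij_betw h {..<card J} J" using ex_bij_betw_nat_finite[OF fJ] by (auto simp: atLeast0LessThan)
    have inj: "inj_on h {..<n}" using h n by (meson bij_betw_def inj_on_subset lessThan_subset_iff)
    have hJ: "h i \<in> J" if "i < n" for i using h that n by (auto simp: bij_betw_def)
    show ?thesis unfolding P_def
    proof (rule exI[of _ "\<lambda>i. eigenfun1 (h i)"], rule exI[of _ "\<lambda>i. eigenfun2 (h i)"], intro conjI allI impI)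
      show "aqrm_solution \<Delta> g \<epsilon> E (eigenfun1 (h i)) (eigenfun2 (h i))" if "i < n" for i
        using hJ[OF that] by (intro eigenfun_solution) (simp add: J_def)
      fix c :: "nat \<Rightarrow> complex" and i
      assume z: "\<forall>x. (\<Sum>i<n. c i * eigenfun1 (h i) x) = 0 \<and> (\<Sum>i<n. c i * eigenfun2 (h i) x) = 0" and i: "i < n"
      define d where "d k = c (the_inv_into {..<n} h k)" for k
      have dh: "d (h i) = c i" if "i < n" for i using that inj by (simp add: d_def the_inv_into_f_f)
      have "(\<Sum>k\<in>h ` {..<n}. d k * F k x) = (\<Sum>i<n. c i * F (h i) x)" for F :: "nat \<Rightarrow> real \<Rightarrow> complex" and x
        unfolding sum.reindex[OF inj] o_def by (intro sum.cong refl) (simp add: dh)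
      then have "\<forall>k\<in>h ` {..<n}. d k = 0"
        using z by (intro eigenfun_independent) auto
      then show "c i = 0" using dh[OF i] i by force
    qed
  qed
  moreover have "n \<le> card J" if "P n" for n
  proof (rule ccontr)
    assume n: "\<not> n \<le> card J"
    obtain \<Phi>1 \<Phi>2 where sol: "\<And>i. i < n \<Longrightarrow> aqrm_solution \<Delta> g \<epsilon> E (\<Phi>1 i) (\<Phi>2 i)"
      and ind: "\<And>c :: nat \<Rightarrow> complex. (\<forall>x. (\<Sum>i<n. c i * \<Phi>1 i x) = 0 \<and> (\<Sum>i<n. c i * \<Phi>2 i x) = 0) \<Longrightarrow> (\<forall>i<n. c i = 0)"
      using \<open>P n\<close> unfolding P_def by blast
    have "\<forall>i. \<exists>d. i < n \<longrightarrow> (\<forall>t. \<Phi>1 i t = (\<Sum>k\<in>J. d k * eigenfun1 k t) \<and> \<Phi>2 i t = (\<Sum>k\<in>J. d k * eigenfun2 k t))"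
      using solution_span[OF sol] unfolding J_def by blast
    then obtain d where d: "\<And>i t. i < n \<Longrightarrow> \<Phi>1 i t = (\<Sum>k\<in>J. d i k * eigenfun1 k t)" "\<And>i t. i < n \<Longrightarrow> \<Phi>2 i t = (\<Sum>k\<in>J. d i k * eigenfun2 k t)"
      by metis
    obtain h where h: "bij_betw h {..<card J} J" using ex_bij_betw_nat_finite[OF fJ] by (auto simp: atLeast0LessThan)
    \<comment> \<open>More solutions than eigenfunctions: there are n coefficients and only
      \<open>card J\<close> conditions, so some nontrivial combination of the solutions vanishes
      identically.\<close>
    obtain c where c: "\<exists>i\<in>{..<n}. c i \<noteq> 0" "\<forall>k<card J. (\<Sum>i\<in>{..<n}. c i * d i (h k)) = 0"
      using homogeneous_system_nontrivial[of "{..<n}" "card J" "\<lambda>i k. d i (h k)"] n by auto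
    have cJ: "(\<Sum>i<n. c i * d i k) = 0" if k: "k \<in> J" for k
    proof -
      obtain k' where "k' < card J" "k = h k'" using h k by (auto simp: bij_betw_def)
      then show ?thesis using c(2) by simp
    qed
    have "(\<Sum>i<n. c i * (\<Sum>k\<in>J. d i k * F k x)) = 0" for F :: "nat \<Rightarrow> real \<Rightarrow> complex" and x
    proof -
      have "(\<Sum>i<n. c i * (\<Sum>k\<in>J. d i k * F k x)) = (\<Sum>k\<in>J. (\<Sum>i<n. c i * d i k) * F k x)"
        unfolding sum_distrib_left sum_distrib_right by (subst sum.swap) (simp add: mult.assoc)
      then show ?thesis using cJ by simp
    qed
    then have "\<forall>x. (\<Sum>i<n. c i * \<Phi>1 i x) = 0 \<and> (\<Sum>i<n. c i * \<Phi>2 i x) = 0" using d by simp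
    then show False using ind c(1) by blast
  qed
  ultimately have "{n. P n} = {..card J}" by auto
  moreover have "Sup {..card J} = card J" by (rule cSup_atMost)
  ultimately show ?thesis unfolding aqrm_mult_def P_def[symmetric] J_def[symmetric] by simp
qed

end

section \<open>The limit of strong coupling\<close>

lemma exists_sorting_bijection:
  fixes \<mu> :: "nat \<Rightarrow> real"
  assumes lim: "filterlim \<mu> at_top sequentially"
  shows "\<exists>\<sigma> :: nat \<Rightarrow> nat. bij \<sigma> \<and> mono (\<lambda>j. \<mu> (\<sigma> j))"
proof -
  have exmin: "\<exists>r. r \<notin> S \<and> (\<forall>i. i \<notin> S \<longrightarrow> \<mu> r \<le> \<mu> i)" if "finite S" for S
  proof -
    obtain a where a: "a \<notin> S" using ex_new_if_finite[OF infinite_UNIV_nat \<open>finite S\<close>] by blast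
    define A where "A = {i. i \<notin> S \<and> \<mu> i \<le> \<mu> a}"
    obtain M where M: "\<And>n. n \<ge> M \<Longrightarrow> \<mu> a + 1 \<le> \<mu> n"
      using lim unfolding filterlim_at_top eventually_sequentially by blast
    have "i < M" if "i \<in> A" for i
    proof (rule ccontr)
      assume "\<not> i < M"
      then show False using M[of i] that by (simp add: A_def)
    qed
    then have fA: "finite A" by (rule bounded_nat_set_is_finite[OF ballI])
    have aA: "a \<in> A" using a by (simp add: A_def)
    define r where "r = arg_min_on \<mu> A"
    have r: "r \<in> A" "\<And>i. i \<in> A \<Longrightarrow> \<mu> r \<le> \<mu> i"
      unfolding r_def using arg_min_if_finite(1)[OF fA] arg_min_least[OF fA] aA by auto
    have "\<mu> r \<le> \<mu> i" if "i \<notin> S" for i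
      using r(1) r(2)[of i] that by (cases "\<mu> i \<le> \<mu> a") (auto simp: A_def)
    then show ?thesis using r(1) by (auto simp: A_def)
  qed
  define P where "P f j r \<longleftrightarrow> r \<notin> f ` {..<j} \<and> (\<forall>i. i \<notin> f ` {..<j} \<longrightarrow> \<mu> r \<le> \<mu> i)" for f :: "nat \<Rightarrow> nat" and j r :: nat
  have "\<exists>\<sigma>. \<forall>j. P \<sigma> j (\<sigma> j)"
  proof (rule dependent_wf_choice[OF wf_less])
    show "P f x r = P g x r" if "\<And>z. (z, x) \<in> {(x, y). x < y} \<Longrightarrow> f z = g z" for f g x r
    proof -
      have "f ` {..<x} = g ` {..<x}" using that by (intro image_cong) auto
      then show ?thesis by (simp add: P_def)
    qed
    show "\<exists>r. P f j r" for f j unfolding P_def by (rule exmin) simp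
  qed
  then obtain \<sigma> where "\<And>j. P \<sigma> j (\<sigma> j)" by blast
  then have new: "\<And>j. \<sigma> j \<notin> \<sigma> ` {..<j}" and least: "\<And>j i. i \<notin> \<sigma> ` {..<j} \<Longrightarrow> \<mu> (\<sigma> j) \<le> \<mu> i"
    unfolding P_def by blast+
  have inj: "inj \<sigma>"
  proof (rule injI)
    fix i j assume eq: "\<sigma> i = \<sigma> j"
    show "i = j"
    proof (rule ccontr)
      assume "i \<noteq> j"
      then consider "i < j" | "j < i" by linarith
      then show False
      proof cases
        case 1
        then show ?thesis using new[of j] eq by (metis imageI lessThan_iff)
      next
        case 2
        then show ?thesis using new[of i] eq by (metis imageI lessThan_iff)
      qed
    qed
  qed
  have mono: "mono (\<lambda>j. \<mu> (\<sigma> j))"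
  proof (rule mono_iff_le_Suc[THEN iffD2], rule allI)
    fix j
    have "\<sigma> (Suc j) \<notin> \<sigma> ` {..<j}" using new[of "Suc j"] by auto
    then show "\<mu> (\<sigma> j) \<le> \<mu> (\<sigma> (Suc j))" by (rule least)
  qed
  have "surj \<sigma>"
  proof (rule ccontr)
    assume "\<not> surj \<sigma>"
    then obtain i where i: "i \<notin> range \<sigma>" by blast
    have "\<mu> (\<sigma> j) \<le> \<mu> i" for j using i by (intro least) blast
    moreover obtain j where "\<mu> i + 1 \<le> \<mu> (\<sigma> j)"
      using filterlim_of_inj_real_at_top[OF lim inj] unfolding filterlim_at_top eventually_sequentially by blast
    ultimately show False using add_le_same_cancel1 not_one_le_zero order_trans by (metis add.commute)
  qed
  then show ?thesis using inj mono by (intro exI[of _ \<sigma>]) (simp add: bij_def)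
qed

lemma uncoupled_eigval_at_top: "filterlim (uncoupled_eigval N \<epsilon>) at_top sequentially"
proof (rule filterlim_at_top_mono)
  show "filterlim (\<lambda>i. real i / 2 + (N - \<bar>\<epsilon>\<bar> - 1)) at_top sequentially" by real_asymp
  have "real i / 2 - 1 \<le> real (i div 2)" for i
  proof -
    have "i \<le> 2 * (i div 2) + 1" by simp
    then have "real i \<le> real (2 * (i div 2) + 1)" by (rule of_nat_mono)
    then show ?thesis by simp
  qed
  then have "real i / 2 + (N - \<bar>\<epsilon>\<bar> - 1) \<le> uncoupled_eigval N \<epsilon> i" for i
    by (auto simp: uncoupled_eigval_def abs_if)
  then show "\<forall>\<^sub>F i in sequentially. real i / 2 + (N - \<bar>\<epsilon>\<bar> - 1) \<le> uncoupled_eigval N \<epsilon> i" by simp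
qed

lemma exists_aqrm_coupling:
  assumes D: "\<Delta> > 0" and N: "\<Delta> + \<bar>\<epsilon>\<bar> < N" and s: "bij \<sigma>" "mono (\<lambda>j. uncoupled_eigval N \<epsilon> (\<sigma> j))"
  shows "\<exists>B \<psi> eigval. aqrm_coupling \<Delta> g N \<epsilon> B \<sigma> \<psi> eigval"
proof -
  have D0: "\<Delta> \<ge> 0" using D by simp
  obtain B where B: "linear B" "\<And>x. norm (B x) \<le> \<Delta> * norm x" "\<And>x y. B x \<bullet> y = x \<bullet> B y"
    "\<And>x i. (\<lambda>j. coupling_matrix \<Delta> (sqrt 2 * g) i j * crd x j) sums crd (B x) i"
    by (rule symmetric_matrix_operator[of "coupling_matrix \<Delta> (sqrt 2 * g)", OF coupling_matrix_sym D0 coupling_matrix_quadratic_bound[OF D0]]) (rule that)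
  interpret l2_perturbation "uncoupled_eigval N \<epsilon>" B \<Delta>
  proof (rule l2_perturbation.intro)
    show "\<Delta> < uncoupled_eigval N \<epsilon> i" for i using N by (auto simp: uncoupled_eigval_def abs_if split: if_splits)
  qed (use B uncoupled_eigval_at_top in auto)
  obtain \<psi> eigval where "\<And>j. norm (\<psi> j) = 1 \<and> (\<forall>i<j. \<psi> j \<bullet> \<psi> i = 0) \<and> eigenvec (\<psi> j) (eigval j) \<and> minimal \<psi> j (eigval j)"
    using exists_eigensequence by blast
  then have "l2_eigensequence (uncoupled_eigval N \<epsilon>) B \<Delta> \<psi> eigval \<sigma>"
    by unfold_locales (use s in auto)
  then have "aqrm_coupling \<Delta> g N \<epsilon> B \<sigma> \<psi> eigval"
    unfolding aqrm_coupling_def aqrm_matrix_def using N B(4) by blast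
  then show ?thesis by blast
qed

context aqrm_coupling
begin

text \<open>Write v = p + t with p the first \<open>M\<close> coordinates. The block on p is
  estimated by absolute entries, while the energy bound makes the norm of t at most sqrt (C / K)
  times that of v. The terms B p with t and B t with v each cost \<open>\<Delta>\<close> times this
  factor, whence the 2.\<close>

lemma coupling_form_bound:
  assumes e: "energy v a" and a: "a \<le> C * (norm v)\<^sup>2" and C: "C \<ge> 0"
    and K: "K > 0" "\<And>i. i \<ge> M \<Longrightarrow> K \<le> uncoupled_eigval N \<epsilon> i"
  shows "\<bar>B v \<bullet> v\<bar> \<le> ((\<Sum>i<M. \<Sum>j<M. \<bar>coupling_matrix \<Delta> (sqrt 2 * g) i j\<bar>) + 2 * \<Delta> * sqrt (C / K)) * (norm v)\<^sup>2"
proof -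
  define p where "p = trunc M v"
  define t where "t = v - p"
  have np: "norm p \<le> norm v" unfolding p_def by (rule norm_trunc_le)
  have "(norm t)\<^sup>2 \<le> a / K" unfolding t_def p_def
    by (rule form_tail_le[OF e[unfolded energy_def] mu_nonneg K(2) K(1)])
  also have "\<dots> \<le> (C / K) * (norm v)\<^sup>2" using a K by (simp add: divide_right_mono)
  finally have "norm t \<le> sqrt ((C / K) * (norm v)\<^sup>2)" by (rule real_le_rsqrt)
  also have "\<dots> = sqrt (C / K) * norm v" by (subst real_sqrt_mult) simp
  finally have nt: "norm t \<le> sqrt (C / K) * norm v" .
  have Bp: "crd (B p) i = (\<Sum>j<M. coupling_matrix \<Delta> (sqrt 2 * g) i j * crd v j)" for i
  proof -
    have "(\<lambda>j. coupling_matrix \<Delta> (sqrt 2 * g) i j * crd p j) sums (\<Sum>j<M. coupling_matrix \<Delta> (sqrt 2 * g) i j * crd p j)"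
      by (rule sums_finite) (auto simp: p_def crd_trunc)
    then have "crd (B p) i = (\<Sum>j<M. coupling_matrix \<Delta> (sqrt 2 * g) i j * crd p j)" using BW sums_unique2 by blast
    then show ?thesis by (simp add: p_def crd_trunc)
  qed
  have "B p \<bullet> p = (\<Sum>i<M. \<Sum>j<M. crd v i * coupling_matrix \<Delta> (sqrt 2 * g) i j * crd v j)"
    unfolding p_def[unfolded trunc_def] inner_sum_right
    by (simp add: p_def[unfolded trunc_def, symmetric] Bp sum_distrib_left mult.assoc)
  also have "\<bar>\<dots>\<bar> \<le> (\<Sum>i<M. \<Sum>j<M. \<bar>coupling_matrix \<Delta> (sqrt 2 * g) i j\<bar> * (norm v)\<^sup>2)"
  proof (intro order_trans[OF sum_abs] sum_mono)
    fix i j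
    have "\<bar>crd v i * coupling_matrix \<Delta> (sqrt 2 * g) i j * crd v j\<bar> = \<bar>coupling_matrix \<Delta> (sqrt 2 * g) i j\<bar> * (\<bar>crd v i\<bar> * \<bar>crd v j\<bar>)"
      by (simp add: abs_mult)
    also have "\<dots> \<le> \<bar>coupling_matrix \<Delta> (sqrt 2 * g) i j\<bar> * (norm v * norm v)"
      by (intro mult_left_mono mult_mono abs_crd_le) auto
    finally show "\<bar>crd v i * coupling_matrix \<Delta> (sqrt 2 * g) i j * crd v j\<bar> \<le> \<bar>coupling_matrix \<Delta> (sqrt 2 * g) i j\<bar> * (norm v)\<^sup>2"
      by (simp add: power2_eq_square)
  qed
  also have "\<dots> = (\<Sum>i<M. \<Sum>j<M. \<bar>coupling_matrix \<Delta> (sqrt 2 * g) i j\<bar>) * (norm v)\<^sup>2"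
    by (simp add: sum_distrib_right)
  finally have pp: "\<bar>B p \<bullet> p\<bar> \<le> (\<Sum>i<M. \<Sum>j<M. \<bar>coupling_matrix \<Delta> (sqrt 2 * g) i j\<bar>) * (norm v)\<^sup>2" .
  have cs: "\<bar>B x \<bullet> y\<bar> \<le> \<Delta> * (norm x * norm y)" for x y
  proof -
    have "\<bar>B x \<bullet> y\<bar> \<le> norm (B x) * norm y" by (rule Cauchy_Schwarz_ineq2)
    also have "\<dots> \<le> \<Delta> * norm x * norm y" by (intro mult_right_mono bdd) simp
    finally show ?thesis by (simp add: mult.assoc)
  qed
  have vt: "norm v * norm t \<le> sqrt (C / K) * (norm v)\<^sup>2"
    using mult_left_mono[OF nt, of "norm v"] by (simp add: power2_eq_square mult_ac)
  have "\<bar>B p \<bullet> t\<bar> \<le> \<Delta> * (sqrt (C / K) * (norm v)\<^sup>2)"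
  proof -
    have "\<Delta> * (norm p * norm t) \<le> \<Delta> * (norm v * norm t)"
      using np Delta_nonneg by (intro mult_left_mono mult_right_mono) auto
    also have "\<dots> \<le> \<Delta> * (sqrt (C / K) * (norm v)\<^sup>2)" by (intro mult_left_mono vt Delta_nonneg)
    finally show ?thesis using cs[of p t] by simp
  qed
  moreover have "\<bar>B t \<bullet> v\<bar> \<le> \<Delta> * (sqrt (C / K) * (norm v)\<^sup>2)"
  proof -
    have "\<Delta> * (norm t * norm v) \<le> \<Delta> * (sqrt (C / K) * (norm v)\<^sup>2)"
      using vt Delta_nonneg by (intro mult_left_mono) (simp_all add: mult.commute)
    then show ?thesis using cs[of t v] by simp
  qed
  moreover have "B v \<bullet> v = B p \<bullet> p + B p \<bullet> t + B t \<bullet> v"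
  proof -
    have v: "v = p + t" by (simp add: t_def)
    have "B v \<bullet> v = (B p + B t) \<bullet> v" using B_add[of p t] v by simp
    also have "\<dots> = B p \<bullet> (p + t) + B t \<bullet> v" using v by (simp add: inner_add_left)
    finally show ?thesis by (simp add: inner_add_right)
  qed
  ultimately have "\<bar>B v \<bullet> v\<bar> \<le> (\<Sum>i<M. \<Sum>j<M. \<bar>coupling_matrix \<Delta> (sqrt 2 * g) i j\<bar>) * (norm v)\<^sup>2
     + \<Delta> * (sqrt (C / K) * (norm v)\<^sup>2) + \<Delta> * (sqrt (C / K) * (norm v)\<^sup>2)"
    using pp by linarith
  then show ?thesis by (simp add: algebra_simps)
qed

end

lemma overlap_tendsto_zero: "((\<lambda>g. LBINT t. left_fun (sqrt 2 * g) i t * right_fun (sqrt 2 * g) j t) \<longlongrightarrow> 0) at_top"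
proof -
  obtain C where C: "C \<ge> 0" "\<And>x. \<bar>herm (i div 2) x\<bar> \<le> C * exp (- 1 * \<bar>x\<bar>)" using rapid_decayE[OF rapid_decay_herm] by metis
  obtain D where D: "D \<ge> 0" "\<And>x. \<bar>herm (j div 2) x\<bar> \<le> D * exp (- 1 * \<bar>x\<bar>)" using rapid_decayE[OF rapid_decay_herm] by metis
  define I where "I = (LBINT t. exp (- \<bar>t::real\<bar>))"
  have "norm (LBINT t. left_fun (sqrt 2 * g) i t * right_fun (sqrt 2 * g) j t) \<le> C * D * I * exp (- g)" if g: "g \<ge> 0" for g
  proof -
    define c where "c = sqrt 2 * g"
    have c: "0 \<le> c" "g \<le> c" using g mult_right_mono[of 1 "sqrt 2" g] by (simp_all add: c_def)
    have le: "\<bar>left_fun c i t * right_fun c j t\<bar> \<le> C * D * exp (- g) * exp (- \<bar>t\<bar>)" for t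
    proof -
      have "\<bar>left_fun c i t\<bar> \<le> C * exp (- \<bar>t + c\<bar>)" "\<bar>right_fun c j t\<bar> \<le> D * exp (- \<bar>t - c\<bar>)"
        using C D(1) C(2)[of "t + c"] D(2)[of "t - c"] by (auto simp: left_fun_def right_fun_def)
      then have "\<bar>left_fun c i t\<bar> * \<bar>right_fun c j t\<bar> \<le> (C * exp (- \<bar>t + c\<bar>)) * (D * exp (- \<bar>t - c\<bar>))"
        using C(1) by (intro mult_mono) auto
      also have "\<dots> = C * D * exp (- \<bar>t + c\<bar> - \<bar>t - c\<bar>)" by (simp add: exp_diff exp_minus field_simps)
      \<comment> \<open>|t + c| + |t - c| is twice the larger of |t| and c, hence at least |t| + c,
        and c is at least g.\<close>
      also have "\<dots> \<le> C * D * exp (- g - \<bar>t\<bar>)"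
        using C(1) D(1) c by (intro mult_left_mono) auto
      also have "\<dots> = C * D * exp (- g) * exp (- \<bar>t\<bar>)" by (simp add: exp_diff exp_minus field_simps)
      finally show ?thesis by (simp add: abs_mult)
    qed
    have "norm (LBINT t. left_fun c i t * right_fun c j t) \<le> (LBINT t. \<bar>left_fun c i t * right_fun c j t\<bar>)"
      using integral_abs_bound by simp
    also have "\<dots> \<le> (LBINT t. C * D * exp (- g) * exp (- \<bar>t\<bar>))"
      using le by (intro integral_mono integrable_abs integrable_basis integrable_mult_right integrable_exp_minus_abs)
    also have "\<dots> = C * D * I * exp (- g)" by (simp add: I_def)
    finally show ?thesis by (simp add: c_def)
  qed
  then have "\<forall>\<^sub>F g in at_top. norm (LBINT t. left_fun (sqrt 2 * g) i t * right_fun (sqrt 2 * g) j t) \<le> C * D * I * exp (- g)"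
    by (rule eventually_mono[OF eventually_ge_at_top[of 0]])
  moreover have "((\<lambda>g. C * D * I * exp (- g)) \<longlongrightarrow> 0) at_top" by real_asymp
  ultimately show ?thesis by (rule Lim_null_comparison)
qed

lemma coupling_matrix_tendsto_zero: "((\<lambda>g. coupling_matrix \<Delta> (sqrt 2 * g) i j) \<longlongrightarrow> 0) at_top"
proof -
  have "((\<lambda>g. \<Delta> * ((LBINT t. left_fun (sqrt 2 * g) j t * right_fun (sqrt 2 * g) i t) + (LBINT t. left_fun (sqrt 2 * g) i t * right_fun (sqrt 2 * g) j t))) \<longlongrightarrow> \<Delta> * (0 + 0)) at_top"
    by (intro tendsto_mult tendsto_add tendsto_const overlap_tendsto_zero)
  then show ?thesis by (simp add: coupling_matrix_def mult.commute[of "right_fun _ _ _"])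
qed

text \<open>The energy threshold depends on \<open>k\<close> but not on g, so the cut
  \<open>M\<close> can be fixed first; then g is taken large enough for the finitely many overlaps
  inside the block.\<close>

lemma eigenvalue_tendsto:
  fixes eigval :: "real \<Rightarrow> nat \<Rightarrow> real"
  assumes D: "\<Delta> > 0" and cpl: "\<And>g. aqrm_coupling \<Delta> g N \<epsilon> (B g) \<sigma> (\<psi> g) (eigval g)"
  shows "((\<lambda>g. eigval g k) \<longlongrightarrow> uncoupled_eigval N \<epsilon> (\<sigma> k)) at_top"
proof (rule tendstoI)
  fix \<eta> :: real assume eta: "\<eta> > 0"
  define C where "C = uncoupled_eigval N \<epsilon> (\<sigma> k) + 2 * \<Delta>"
  \<comment> \<open>Any value of g would do: only positivity of the diagonal is drawn from this
    instance, and the diagonal does not depend on g.\<close>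
  interpret c0: aqrm_coupling \<Delta> 0 N \<epsilon> "B 0" \<sigma> "\<psi> 0" "eigval 0" by (rule cpl)
  have C: "C > 0" unfolding C_def using D c0.mu_nonneg[of "\<sigma> k"] by simp
  \<comment> \<open>Chosen to make the tail contribution 2 \<Delta> sqrt (C / K) exactly \<eta> / 4;
    the block supplies another \<eta> / 4.\<close>
  define K where "K = C * (8 * \<Delta> / \<eta>)\<^sup>2"
  have K: "K > 0" unfolding K_def using C D eta by simp
  have sK: "2 * \<Delta> * sqrt (C / K) = \<eta> / 4"
  proof -
    have "C / K = (\<eta> / (8 * \<Delta>))\<^sup>2" unfolding K_def using C D eta by (simp add: power_divide field_simps)
    then have "sqrt (C / K) = \<eta> / (8 * \<Delta>)" using D eta by simp
    then show ?thesis using D by simp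
  qed
  obtain M where M: "\<And>i. i \<ge> M \<Longrightarrow> K \<le> uncoupled_eigval N \<epsilon> i"
    using uncoupled_eigval_at_top[of N \<epsilon>] unfolding filterlim_at_top eventually_sequentially by blast
  have "((\<lambda>g. \<Sum>i<M. \<Sum>j<M. \<bar>coupling_matrix \<Delta> (sqrt 2 * g) i j\<bar>) \<longlongrightarrow> (\<Sum>i<M. \<Sum>j<M. \<bar>0\<bar>)) at_top"
    by (intro tendsto_sum tendsto_rabs coupling_matrix_tendsto_zero)
  then have "\<forall>\<^sub>F g in at_top. (\<Sum>i<M. \<Sum>j<M. \<bar>coupling_matrix \<Delta> (sqrt 2 * g) i j\<bar>) < \<eta> / 4"
    by (rule order_tendstoD(2)) (use eta in simp)
  then show "\<forall>\<^sub>F g in at_top. dist (eigval g k) (uncoupled_eigval N \<epsilon> (\<sigma> k)) < \<eta>"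
  proof eventually_elim
    case (elim g)
    interpret c: aqrm_coupling \<Delta> g N \<epsilon> "B g" \<sigma> "\<psi> g" "eigval g" by (rule cpl)
    have "\<bar>eigval g k - uncoupled_eigval N \<epsilon> (\<sigma> k)\<bar> \<le> \<eta> / 2"
    proof (rule c.eigval_close)
      fix v a assume v: "c.energy v a" "a \<le> (uncoupled_eigval N \<epsilon> (\<sigma> k) + 2 * \<Delta>) * (norm v)\<^sup>2"
      have "\<bar>B g v \<bullet> v\<bar> \<le> ((\<Sum>i<M. \<Sum>j<M. \<bar>coupling_matrix \<Delta> (sqrt 2 * g) i j\<bar>) + 2 * \<Delta> * sqrt (C / K)) * (norm v)\<^sup>2"
        by (rule c.coupling_form_bound[OF v(1) v(2)[folded C_def] _ K M]) (use C in simp)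
      also have "\<dots> \<le> \<eta> / 2 * (norm v)\<^sup>2"
        using elim unfolding sK by (intro mult_right_mono) auto
      finally show "\<bar>B g v \<bullet> v\<bar> \<le> \<eta> / 2 * (norm v)\<^sup>2" .
    qed
    then show ?case using eta by (simp add: dist_real_def)
  qed
qed

section \<open>Sums over the spectrum\<close>

text \<open>The series over indices is carried to pairs (energy, index), and summation over each
  finite fibre first produces the multiplicity. Absolute summability licenses the
  regrouping.\<close>

lemma infsum_with_multiplicity:
  fixes L :: "nat \<Rightarrow> real" and f :: "real \<Rightarrow> complex"
  assumes fin: "\<And>l. finite {k. L k = l}" and sm: "summable (\<lambda>k. norm (f (L k)))"
  shows "infsum (\<lambda>E. of_nat (card {k. L k = E + t}) * f (E + t)) {E. card {k. L k = E + t} > 0} = (\<Sum>k. f (L k))"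
proof -
  define A where "A = {E. card {k. L k = E + t} > 0}"
  define h where "h k = (L k - t, k)" for k
  have "((\<lambda>k. f (L k)) has_sum (\<Sum>k. f (L k))) UNIV"
    by (rule norm_summable_imp_has_sum[OF sm summable_sums[OF summable_norm_cancel[OF sm]]])
  then have "(((\<lambda>(E, k). f (E + t)) \<circ> h) has_sum (\<Sum>k. f (L k))) UNIV" by (simp add: h_def o_def)
  then have "((\<lambda>(E, k). f (E + t)) has_sum (\<Sum>k. f (L k))) (h ` UNIV)"
    by (subst has_sum_reindex) (auto simp: h_def inj_on_def)
  also have "h ` UNIV = Sigma A (\<lambda>E. {k. L k = E + t})"
    by (auto simp: h_def A_def card_gt_0_iff fin image_iff)
  finally have "((\<lambda>E. of_nat (card {k. L k = E + t}) * f (E + t)) has_sum (\<Sum>k. f (L k))) A"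
    by (rule has_sum_SigmaD) (simp add: has_sum_constant fin)
  then show ?thesis unfolding A_def by (rule infsumI)
qed

lemma summable_uncoupled_eigval_powr:
  assumes "\<bar>\<epsilon>\<bar> + b < N" "0 \<le> b" "a > 1"
  shows "summable (\<lambda>i. (uncoupled_eigval N \<epsilon> i - b) powr (- a))"
proof -
  define K where "K = 2 + 2 / (N - \<bar>\<epsilon>\<bar> - b)"
  have K: "K > 0" unfolding K_def using assms(1) by (simp add: add_pos_pos)
  have "summable (\<lambda>i. real (i + 1) powr (- a))"
    by (subst summable_iff_shift) (use assms(3) in \<open>simp add: summable_real_powr_iff\<close>)
  then have "summable (\<lambda>i. K powr a * (real i + 1) powr (- a))" by (intro summable_mult) (simp add: add.commute)
  then show ?thesis
  proof (rule summable_comparison_test')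
    fix i
    have le: "real i + 1 \<le> K * (uncoupled_eigval N \<epsilon> i - b)" unfolding K_def by (rule index_le_uncoupled_eigval[OF assms(1,2)])
    then have "0 < K * (uncoupled_eigval N \<epsilon> i - b)" by linarith
    then have p: "0 < uncoupled_eigval N \<epsilon> i - b" using K by (simp add: zero_less_mult_iff)
    have "(uncoupled_eigval N \<epsilon> i - b) powr (- a) = K powr a * (K * (uncoupled_eigval N \<epsilon> i - b)) powr (- a)"
    proof -
      have "(K * (uncoupled_eigval N \<epsilon> i - b)) powr (- a) = K powr (- a) * (uncoupled_eigval N \<epsilon> i - b) powr (- a)"
        by (rule powr_mult)
      moreover have "K powr a * K powr (- a) = 1" using K by (simp add: powr_add[symmetric])
      ultimately show ?thesis by (simp add: mult.assoc[symmetric])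
    qed
    also have "\<dots> \<le> K powr a * (real i + 1) powr (- a)"
      using le assms(3) by (intro mult_left_mono powr_mono2') auto
    finally show "norm ((uncoupled_eigval N \<epsilon> i - b) powr (- a)) \<le> K powr a * (real i + 1) powr (- a)" by simp
  qed
qed

text \<open>Even indices give the progression from N + \<epsilon>, odd ones that from N -
  \<epsilon>. The split is made for unordered sums, where it is a partition of the index
  set.\<close>

lemma suminf_uncoupled_eigval:
  assumes "\<bar>\<epsilon>\<bar> < N" "Re s > 1"
  shows "(\<Sum>i. complex_of_real (uncoupled_eigval N \<epsilon> i) powr (- s)) = hurwitz_zeta s (N + \<epsilon>) + hurwitz_zeta s (N - \<epsilon>)"
proof -
  let ?f = "\<lambda>i. complex_of_real (uncoupled_eigval N \<epsilon> i) powr (- s)"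
  have pos: "0 < uncoupled_eigval N \<epsilon> i" for i using assms(1) by (auto simp: uncoupled_eigval_def abs_if split: if_splits)
  have "norm (?f i) = uncoupled_eigval N \<epsilon> i powr (- Re s)" for i
    using pos[of i] by (simp add: norm_powr_real_powr)
  then have ns: "summable (\<lambda>i. norm (?f i))"
    using summable_uncoupled_eigval_powr[of \<epsilon> 0 N "Re s"] assms by simp
  have hs: "(?f has_sum suminf ?f) UNIV"
    by (rule norm_summable_imp_has_sum[OF ns summable_sums[OF summable_norm_cancel[OF ns]]])
  have sm: "?f summable_on UNIV" using hs by (rule has_sum_imp_summable)
  have half: "(?f has_sum (\<Sum>n. ?f (h n))) (range h)" if "inj h" for h
  proof -
    have "(?f has_sum infsum ?f (range h)) (range h)"
      by (intro has_sum_infsum summable_on_subset_banach[OF sm]) simp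
    moreover from this have "(\<lambda>n. ?f (h n)) sums infsum ?f (range h)"
      unfolding has_sum_reindex[OF that] by (auto dest: has_sum_imp_sums simp: o_def)
    ultimately show ?thesis by (simp add: sums_iff)
  qed
  have "(?f has_sum ((\<Sum>n. ?f (2 * n)) + (\<Sum>n. ?f (Suc (2 * n))))) (range (\<lambda>n. 2 * n) \<union> range (\<lambda>n. Suc (2 * n)))"
    by (intro has_sum_Un_disjoint half) (auto intro!: injI, presburger)
  also have "range (\<lambda>n. 2 * n) \<union> range (\<lambda>n. Suc (2 * n)) = UNIV"
  proof -
    have "i \<in> range (\<lambda>n. 2 * n) \<union> range (\<lambda>n. Suc (2 * n))" for i :: nat
      by (cases "even i") (auto elim!: evenE oddE)
    then show ?thesis by blast
  qed
  finally have "suminf ?f = (\<Sum>n. ?f (2 * n)) + (\<Sum>n. ?f (Suc (2 * n)))"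
    using hs has_sum_unique by blast
  then show ?thesis by (simp add: hurwitz_zeta_def uncoupled_eigval_def add_diff_eq add.assoc)
qed

theorem theorem3p1:
  fixes \<Delta> \<epsilon> :: real and s :: complex
  assumes "\<Delta> > 0" and "Re s > 1"
  defines "N \<equiv> nat \<lfloor>\<Delta> + \<bar>\<epsilon>\<bar> + 1\<rfloor>"
  shows "((\<lambda>g. aqrm_zeta \<Delta> g \<epsilon> s (g\<^sup>2 + real N)) \<longlongrightarrow>
            hurwitz_zeta s (real N + \<epsilon>) + hurwitz_zeta s (real N - \<epsilon>)) at_top
         \<and> (\<epsilon> = 0 \<and> \<Delta> < 1 \<longrightarrow>
           ((\<lambda>g. aqrm_zeta \<Delta> g 0 s (g\<^sup>2 + 1)) \<longlongrightarrow> 2 * riemann_zeta s) at_top)"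
proof -
  \<comment> \<open>The integer part of y + 1 exceeds y, so the inequality is strict.\<close>
  have N: "\<Delta> + \<bar>\<epsilon>\<bar> < real N" unfolding N_def using assms(1) by linarith
  let ?uncoupled_eigval = "uncoupled_eigval (real N) \<epsilon>"
  let ?f = "\<lambda>y. complex_of_real y powr (- s)"
  \<comment> \<open>The order is fixed before g enters, so that limits and majorant are attached to
    the same index \<open>k\<close> for every g.\<close>
  obtain \<sigma> :: "nat \<Rightarrow> nat" where \<sigma>: "bij \<sigma>" "mono (\<lambda>j. ?uncoupled_eigval (\<sigma> j))"
    using exists_sorting_bijection[OF uncoupled_eigval_at_top] by blast
  have "\<forall>g. \<exists>B \<psi> eigval. aqrm_coupling \<Delta> g (real N) \<epsilon> B \<sigma> \<psi> eigval"
    using exists_aqrm_coupling[OF assms(1) N \<sigma>] by blast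
  then obtain B \<psi> eigval where cpl: "\<And>g. aqrm_coupling \<Delta> g (real N) \<epsilon> (B g) \<sigma> (\<psi> g) (eigval g)" by metis
  have gap: "\<Delta> < ?uncoupled_eigval i" for i using N by (auto simp: uncoupled_eigval_def abs_if split: if_splits)
  have low: "?uncoupled_eigval (\<sigma> k) - \<Delta> \<le> eigval g k" for g k
  proof -
    interpret aqrm_coupling \<Delta> g "real N" \<epsilon> "B g" \<sigma> "\<psi> g" "eigval g" by (rule cpl)
    show ?thesis using eigval_close_Delta[of k] by (simp add: abs_le_iff)
  qed
  \<comment> \<open>The negative power is decreasing, so the lower bound \<open>low\<close> on the
    eigenvalues becomes an upper bound on the terms; the gap keeps its base positive.\<close>
  have dom: "norm (?f (eigval g k)) \<le> (?uncoupled_eigval (\<sigma> k) - \<Delta>) powr (- Re s)" for g k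
  proof -
    have "0 < ?uncoupled_eigval (\<sigma> k) - \<Delta>" using gap by simp
    moreover from this have "0 < eigval g k" using low[of k g] by linarith
    ultimately show ?thesis using low[of k g] assms(2) by (simp add: norm_powr_real_powr powr_mono2')
  qed
  have sm: "summable (\<lambda>k. (?uncoupled_eigval (\<sigma> k) - \<Delta>) powr (- Re s))"
  proof -
    have "summable (\<lambda>i. (?uncoupled_eigval i - \<Delta>) powr (- Re s))"
      by (rule summable_uncoupled_eigval_powr) (use N assms(1,2) in \<open>simp_all add: add.commute\<close>)
    from summable_reindex[OF this bij_is_inj[OF \<sigma>(1)]] show ?thesis by (simp add: o_def)
  qed
  have zeta: "aqrm_zeta \<Delta> g \<epsilon> s (g\<^sup>2 + real N) = (\<Sum>k. ?f (eigval g k))" for g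
  proof -
    interpret aqrm_coupling \<Delta> g "real N" \<epsilon> "B g" \<sigma> "\<psi> g" "eigval g" by (rule cpl)
    have "summable (\<lambda>k. norm (?f (eigval g k)))"
      by (rule summable_comparison_test'[OF sm]) (use dom in simp)
    from infsum_with_multiplicity[OF finite_eigval_eq this, of "g\<^sup>2 + real N"]
    show ?thesis unfolding aqrm_zeta_def aqrm_mult_eq_card by (simp add: add.assoc)
  qed
  \<comment> \<open>Tannery's theorem, that is, dominated convergence for series. The limits are
    positive, away from the cut of the complex power.\<close>
  have "((\<lambda>g. \<Sum>k. ?f (eigval g k)) \<longlongrightarrow> (\<Sum>k. ?f (?uncoupled_eigval (\<sigma> k)))) at_top"
  proof (rule tannerys_theorem[THEN conjunct2, THEN conjunct2])
    show "((\<lambda>g. ?f (eigval g k)) \<longlongrightarrow> ?f (?uncoupled_eigval (\<sigma> k))) at_top" for k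
    proof (rule tendsto_powr_complex)
      show "complex_of_real (?uncoupled_eigval (\<sigma> k)) \<notin> \<real>\<^sub>\<le>\<^sub>0"
        using gap[of "\<sigma> k"] assms(1) by (simp add: complex_nonpos_Reals_iff)
      show "((\<lambda>g. complex_of_real (eigval g k)) \<longlongrightarrow> complex_of_real (?uncoupled_eigval (\<sigma> k))) at_top"
        by (intro tendsto_of_real eigenvalue_tendsto[OF assms(1) cpl])
    qed simp
    show "\<forall>\<^sub>F (k, g) in at_top \<times>\<^sub>F at_top. norm (?f (eigval g k)) \<le> (?uncoupled_eigval (\<sigma> k) - \<Delta>) powr (- Re s)"
      using dom by (intro always_eventually) auto
  qed (use sm in simp_all)
  moreover have "(\<Sum>k. ?f (?uncoupled_eigval (\<sigma> k))) = (\<Sum>i. ?f (?uncoupled_eigval i))"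
  proof -
    have "norm (?f (?uncoupled_eigval i)) = ?uncoupled_eigval i powr (- Re s)" for i
      using gap[of i] assms(1) by (simp add: norm_powr_real_powr)
    then have ns: "summable (\<lambda>i. norm (?f (?uncoupled_eigval i)))"
      using summable_uncoupled_eigval_powr[of \<epsilon> 0 "real N" "Re s"] N assms(1,2) by simp
    have "((\<lambda>i. ?f (?uncoupled_eigval i)) has_sum (\<Sum>i. ?f (?uncoupled_eigval i))) UNIV"
      by (rule norm_summable_imp_has_sum[OF ns summable_sums[OF summable_norm_cancel[OF ns]]])
    then have "((\<lambda>k. ?f (?uncoupled_eigval (\<sigma> k))) has_sum (\<Sum>i. ?f (?uncoupled_eigval i))) UNIV"
      by (rule has_sum_reindex_bij_betw[OF \<sigma>(1), of "\<lambda>i. ?f (?uncoupled_eigval i)", THEN iffD2])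
    from sums_unique[OF has_sum_imp_sums[OF this]] show ?thesis by (rule sym)
  qed
  moreover have "(\<Sum>i. ?f (?uncoupled_eigval i)) = hurwitz_zeta s (real N + \<epsilon>) + hurwitz_zeta s (real N - \<epsilon>)"
    using N assms(1,2) by (intro suminf_uncoupled_eigval) simp_all
  ultimately have main: "((\<lambda>g. aqrm_zeta \<Delta> g \<epsilon> s (g\<^sup>2 + real N)) \<longlongrightarrow>
            hurwitz_zeta s (real N + \<epsilon>) + hurwitz_zeta s (real N - \<epsilon>)) at_top"
    by (simp only: zeta)
  moreover have "((\<lambda>g. aqrm_zeta \<Delta> g 0 s (g\<^sup>2 + 1)) \<longlongrightarrow> 2 * riemann_zeta s) at_top" if "\<epsilon> = 0 \<and> \<Delta> < 1"
  proof -
    have "\<lfloor>\<Delta>\<rfloor> = 0" using that assms(1) by (simp add: floor_eq_iff)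
    then have "N = 1" unfolding N_def using that by simp
    then show ?thesis using main that by (simp add: hurwitz_zeta_def riemann_zeta_def)
  qed
  ultimately show ?thesis by blast
qed

end
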